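(* Let $p\ge 1$ and let $\rho$ be a (positive) $p\times p$ matrix measure on the unit circle, with Lebesgue decomposition $$d\rho(\theta)=\rho'(\theta)\,\frac{d\theta}{2\pi}+d\rho_s(\theta),$$ where $\rho_s$ is the singular part of $\rho$. Let $H_n$ ($n\ge 1$) be the reflection coefficients of the orthonormal matrix polynomials with respect to $\rho$. If $\det\rho'(\theta)>0$ for almost every $\theta\in[0,2\pi)$, then $$\lim_{n\to\infty}H_n=0.$$
   Context: A (positive) $p\times p$ matrix measure $\rho$ on the unit circle $\mathbb{T}=\{z\in\mathbb{C}:|z|=1\}$ (identified with $[0,2\pi)$ via $z=e^{i\theta}$) is a finite countably additive Borel measure whose values are Hermitian positive semidefinite $p\times p$ complex matrices. Its absolutely continuous density with respect to $d\theta/2\pi$ is denoted $\rho'$, and its part singular with respect to Lebesgue measure is denoted $\rho_s$. $A^*$ denotes the Hermitian transpose of a matrix $A$. A matrix polynomial is a polynomial in $z$ with $p\times p$ complex matrix coefficients. The left and right orthonormal matrix polynomials $\varphi_n^L,\varphi_n^R$ ($n=0,1,2,\dots$) are matrix polynomials of degree $n$ with nonsingular leading coefficients such that, with $z=e^{i\theta}$, $$\int_0^{2\pi}\varphi_n^L(z)\,d\rho(\theta)\,[\varphi_m^L(z)]^*=\delta_{m,n}I=\int_0^{2\pi}[\varphi_n^R(z)]^*\,d\rho(\theta)\,\varphi_m^R(z).$$ They exist for all $n$ provided $\rho$ is nondegenerate, i.e. $\int_0^{2\pi} v(z)\,d\rho(\theta)\,v(z)^*>0$ for every nonzero row-vector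 polynomial $v$ (this holds automatically when $\det\rho'>0$ almost everywhere). They are unique up to multiplication by a constant unitary matrix, on the left for $\varphi_n^L$ and on the right for $\varphi_n^R$. Write $\varphi_n^L(z)=L_{n,n}z^n+\cdots+L_{n,0}$ and $\varphi_n^R(z)=K_{n,n}z^n+\cdots+K_{n,0}$. The reflection coefficients are the $p\times p$ matrices $$H_n=(L_{n,n}^* )^{-1}K_{n,0}=L_{n,0}(K_{n,n}^* )^{-1}$$ (the two expressions agree). Changing the unitary normalization of $\varphi_n^L,\varphi_n^R$ replaces $H_n$ by $UH_nV$ with $U,V$ unitary, so the statement does not depend on the normalization. *)

theory Defs
  imports "HOL-Analysis.Analysis" "HOL-Library.Complex_Order"
    "HOL-Computational_Algebra.Polynomial"
begin

text \<open>
  The unit circle is identified with the half-open interval from \<open>0\<close> to \<open>2 * pi\<close> via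
  \<open>z = cis \<theta>\<close>; \<open>p \<times> p\<close> complex matrices are elements of \<^typ>\<open>complex^'p^'p\<close>.
  The multiplication \<open>*\<close> on this type is entrywise, so matrix products are written \<open>**\<close>,
  the identity matrix is \<open>mat 1\<close>, and the library's evaluation \<^const>\<open>poly\<close> cannot be used
  for matrix polynomials.
\<close>

abbreviation circle :: "real measure" where
  "circle \<equiv> restrict_space borel {0..<2*pi}"

definition hermitian_transpose :: "complex^'n^'m \<Rightarrow> complex^'m^'n" where
  "hermitian_transpose A = (\<chi> i j. cnj (A $ j $ i))"

definition pos_semidef :: "complex^'p^'p \<Rightarrow> bool" where
  "pos_semidef A \<longleftrightarrow> hermitian_transpose A = A \<and>
     (\<forall>v. 0 \<le> (\<Sum>i\<in>UNIV. \<Sum>j\<in>UNIV. cnj (v $ i) * A $ i $ j * v $ j))"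

definition matrix_measure :: "(real set \<Rightarrow> complex^'p^'p) \<Rightarrow> bool" where
  "matrix_measure \<rho> \<longleftrightarrow>
     (\<forall>A\<in>sets circle. pos_semidef (\<rho> A)) \<and>
     (\<forall>A. range A \<subseteq> sets circle \<longrightarrow> disjoint_family A \<longrightarrow>
        (\<lambda>i. \<rho> (A i)) sums \<rho> (\<Union>i::nat. A i))"

text \<open>
  Integration against a complex measure \<open>\<nu>\<close>: write \<open>\<nu>\<close> as
  \<open>m\<^sub>0 + \<i> m\<^sub>1 - m\<^sub>2 - \<i> m\<^sub>3\<close> with finite positive measures \<open>m\<^sub>k\<close> and integrate
  against each of them. For bounded measurable integrands the result does not depend on
  the decomposition (\<open>complex_measure_integral_eq\<close> below), and the entries of a matrix
  measure admit one (\<open>matrix_measure_decomposition\<close>).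
\<close>

definition measure_decomposition :: "(real set \<Rightarrow> complex) \<Rightarrow> (nat \<Rightarrow> real measure) \<Rightarrow> bool" where
  "measure_decomposition \<nu> m \<longleftrightarrow>
     (\<forall>k<4. finite_measure (m k) \<and> sets (m k) = sets circle) \<and>
     (\<forall>A\<in>sets circle. \<nu> A = (\<Sum>k<4. \<i> ^ k * of_real (measure (m k) A)))"

definition complex_measure_integral :: "(real set \<Rightarrow> complex) \<Rightarrow> (real \<Rightarrow> complex) \<Rightarrow> complex" where
  "complex_measure_integral \<nu> f =
     (THE I. \<exists>m. measure_decomposition \<nu> m \<and> I = (\<Sum>k<4. \<i> ^ k * integral\<^sup>L (m k) f))"

text \<open>The matrix \<open>\<integral> A(z) d\<rho>(\<theta>) B(z)\<close> with \<open>z = cis \<theta>\<close>; the order of the factors matters.\<close>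

definition matrix_measure_integral ::
    "(complex \<Rightarrow> complex^'p^'p) \<Rightarrow> (real set \<Rightarrow> complex^'p^'p) \<Rightarrow> (complex \<Rightarrow> complex^'p^'p)
      \<Rightarrow> complex^'p^'p" where
  "matrix_measure_integral A \<rho> B =
     (\<chi> i j. \<Sum>k\<in>UNIV. \<Sum>l\<in>UNIV.
        complex_measure_integral (\<lambda>X. \<rho> X $ k $ l) (\<lambda>\<theta>. A (cis \<theta>) $ i $ k * B (cis \<theta>) $ l $ j))"

definition matrix_poly :: "(complex^'p^'p) poly \<Rightarrow> complex \<Rightarrow> complex^'p^'p" where
  "matrix_poly P z = (\<Sum>k\<le>degree P. mat (z ^ k) ** coeff P k)"

definition left_orthonormal :: "(real set \<Rightarrow> complex^'p^'p) \<Rightarrow> (nat \<Rightarrow> (complex^'p^'p) poly) \<Rightarrow> bool" where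
  "left_orthonormal \<rho> \<phi> \<longleftrightarrow>
     (\<forall>n. degree (\<phi> n) = n \<and> invertible (lead_coeff (\<phi> n))) \<and>
     (\<forall>m n. matrix_measure_integral (matrix_poly (\<phi> n)) \<rho>
              (\<lambda>z. hermitian_transpose (matrix_poly (\<phi> m) z)) = (if m = n then mat 1 else 0))"

definition right_orthonormal :: "(real set \<Rightarrow> complex^'p^'p) \<Rightarrow> (nat \<Rightarrow> (complex^'p^'p) poly) \<Rightarrow> bool" where
  "right_orthonormal \<rho> \<phi> \<longleftrightarrow>
     (\<forall>n. degree (\<phi> n) = n \<and> invertible (lead_coeff (\<phi> n))) \<and>
     (\<forall>m n. matrix_measure_integral (\<lambda>z. hermitian_transpose (matrix_poly (\<phi> n) z)) \<rho>
              (matrix_poly (\<phi> m)) = (if m = n then mat 1 else 0))"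

definition reflection_coeff ::
    "(nat \<Rightarrow> (complex^'p^'p) poly) \<Rightarrow> (nat \<Rightarrow> (complex^'p^'p) poly) \<Rightarrow> nat \<Rightarrow> complex^'p^'p" where
  "reflection_coeff \<phi>L \<phi>R n =
     matrix_inv (hermitian_transpose (coeff (\<phi>L n) n)) ** coeff (\<phi>R n) 0"

text \<open>
  \<open>d\<rho> = w d\<theta>/2\<pi> + d\<rho>\<^sub>s\<close> with \<open>\<rho>\<^sub>s\<close> a matrix measure carried by a Lebesgue null set. Positive
  semidefiniteness of \<open>w\<close> almost everywhere is a consequence.
\<close>

definition lebesgue_decomposition ::
    "(real set \<Rightarrow> complex^'p^'p) \<Rightarrow> (real \<Rightarrow> complex^'p^'p) \<Rightarrow> (real set \<Rightarrow> complex^'p^'p) \<Rightarrow> bool" where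
  "lebesgue_decomposition \<rho> w \<rho>s \<longleftrightarrow>
     set_integrable lborel {0..<2*pi} w \<and>
     matrix_measure \<rho>s \<and>
     (\<exists>N\<in>sets circle. N \<in> null_sets lborel \<and> (\<forall>A\<in>sets circle. A \<inter> N = {} \<longrightarrow> \<rho>s A = 0)) \<and>
     (\<forall>A\<in>sets circle. \<rho> A = (1 / (2*pi)) *\<^sub>R (LINT \<theta>:A|lborel. w \<theta>) + \<rho>s A)"

text \<open>Well-definedness of the integral against the entries of a matrix measure.\<close>

lemma nn_integral_add_measures_eq:
  fixes f :: "'a \<Rightarrow> ennreal"
  assumes [measurable_cong]: "sets b = sets a" "sets c = sets a" "sets d = sets a"
    and eq: "\<And>A. A \<in> sets a \<Longrightarrow> emeasure a A + emeasure b A = emeasure c A + emeasure d A"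
    and f: "f \<in> borel_measurable a"
  shows "nn_integral a f + nn_integral b f = nn_integral c f + nn_integral d f"
  using f
proof (induction rule: borel_measurable_induct)
  case (cong f g)
  have "nn_integral m f = nn_integral m g" if "sets m = sets a" for m
    by (rule nn_integral_cong) (use cong sets_eq_imp_space_eq[OF that] in auto)
  then show ?case using cong assms by simp
next
  case (set A)
  then show ?case using eq assms by simp
next
  case (mult u c)
  have [measurable]: "u \<in> borel_measurable a" by fact
  show ?case using mult.IH by (simp add: nn_integral_cmult flip: distrib_left)
next
  case (add u v)
  have [measurable]: "u \<in> borel_measurable a" "v \<in> borel_measurable a" by fact+
  show ?case using add.IH by (simp add: nn_integral_add) (metis add.assoc add.commute)
next
  case (seq U)
  have [measurable]: "U i \<in> borel_measurable a" for i by fact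
  have sup: "nn_integral m (SUP i. U i) = (SUP i. nn_integral m (U i))" if [measurable_cong]: "sets m = sets a" for m
  proof -
    have "(SUP i. U i) = (\<lambda>x. SUP i. U i x)" by (auto simp: fun_eq_iff image_comp)
    then show ?thesis using nn_integral_monotone_convergence_SUP[OF \<open>incseq U\<close>, of m] by simp
  qed
  have inc: "incseq (\<lambda>i. nn_integral m (U i))" for m
    using \<open>incseq U\<close> by (auto simp: incseq_def le_fun_def intro!: nn_integral_mono)
  show ?case
    unfolding sup[OF refl] assms(1-3)[THEN sup] ennreal_SUP_add[OF inc inc, symmetric] seq.IH ..
qed

lemma integral_diff_measures_eq:
  fixes f :: "'a \<Rightarrow> real"
  assumes fin: "finite_measure a" "finite_measure b" "finite_measure c" "finite_measure d"
    and s: "sets b = sets a" "sets c = sets a" "sets d = sets a"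
    and eq: "\<And>A. A \<in> sets a \<Longrightarrow> measure a A - measure b A = measure c A - measure d A"
    and f: "f \<in> borel_measurable a" and bd: "\<And>x. \<bar>f x\<bar> \<le> C"
  shows "integral\<^sup>L a f - integral\<^sup>L b f = integral\<^sup>L c f - integral\<^sup>L d f"
proof -
  have E: "emeasure a A + emeasure d A = emeasure c A + emeasure b A" if "A \<in> sets a" for A
    using eq[OF that] fin by (simp add: finite_measure.emeasure_eq_measure flip: ennreal_plus)
  have mm: "f \<in> borel_measurable m" if "sets m = sets a" for m
    using f measurable_cong_sets[OF that refl] by auto
  have int: "integrable m f" if "finite_measure m" "sets m = sets a" for m
    by (rule finite_measure.integrable_const_bound[OF that(1), where B = C]) (use bd mm that in auto)
  have nn: "nn_integral m (\<lambda>x. ennreal (f x + C)) = ennreal (integral\<^sup>L m f + C * measure m (space m))"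
    and pos: "0 \<le> integral\<^sup>L m f + C * measure m (space m)"
    if "finite_measure m" "sets m = sets a" for m
  proof -
    interpret finite_measure m by fact
    have eqi: "integral\<^sup>L m (\<lambda>x. f x + C) = integral\<^sup>L m f + C * measure m (space m)"
      using int[OF that] by simp
    have p: "0 \<le> f x + C" for x using bd[of x] by linarith
    show "nn_integral m (\<lambda>x. ennreal (f x + C)) = ennreal (integral\<^sup>L m f + C * measure m (space m))"
      using nn_integral_eq_integral[of m "\<lambda>x. f x + C"] int[OF that] p eqi by simp
    show "0 \<le> integral\<^sup>L m f + C * measure m (space m)"
      unfolding eqi[symmetric] using p by (intro integral_nonneg_AE) auto
  qed
  have "nn_integral a (\<lambda>x. ennreal (f x + C)) + nn_integral d (\<lambda>x. ennreal (f x + C))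
      = nn_integral c (\<lambda>x. ennreal (f x + C)) + nn_integral b (\<lambda>x. ennreal (f x + C))"
    by (rule nn_integral_add_measures_eq) (use s E f in auto)
  then have "integral\<^sup>L a f + C * measure a (space a) + (integral\<^sup>L d f + C * measure d (space d))
     = integral\<^sup>L c f + C * measure c (space c) + (integral\<^sup>L b f + C * measure b (space b))"
    using fin s nn pos by (simp flip: ennreal_plus)
  moreover have "C * (measure a (space a) - measure b (space b)) = C * (measure c (space c) - measure d (space d))"
    using eq[OF sets.top] s[THEN sets_eq_imp_space_eq] by simp
  ultimately show ?thesis unfolding right_diff_distrib by linarith
qed

lemma sum_i_powers: "(\<Sum>k<4. \<i> ^ k * g k) = (g 0 - g 2) + \<i> * (g 1 - g 3)"
  by (simp add: eval_nat_numeral algebra_simps)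

lemma complex_measure_integral_eq:
  assumes m: "measure_decomposition \<nu> m"
    and f: "f \<in> borel_measurable circle" and bd: "\<And>x. norm (f x) \<le> C"
  shows "complex_measure_integral \<nu> f = (\<Sum>k<4. \<i> ^ k * integral\<^sup>L (m k) f)"
  unfolding complex_measure_integral_def
proof (rule the_equality)
  fix I assume "\<exists>n. measure_decomposition \<nu> n \<and> I = (\<Sum>k<4. \<i> ^ k * integral\<^sup>L (n k) f)"
  then obtain n where n: "measure_decomposition \<nu> n" and I: "I = (\<Sum>k<4. \<i> ^ k * integral\<^sup>L (n k) f)"
    by auto
  have fs: "finite_measure (m k)" "sets (m k) = sets circle"
    "finite_measure (n k)" "sets (n k) = sets circle" if "k < 4" for k
    using m n that unfolding measure_decomposition_def by blast+
  have meq: "(\<Sum>k<4. \<i> ^ k * of_real (measure (m k) A)) = (\<Sum>k<4. \<i> ^ k * of_real (measure (n k) A))"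
    if "A \<in> sets circle" for A
    using m n that unfolding measure_decomposition_def by metis
  have e: "measure (m 0) A - measure (m 2) A = measure (n 0) A - measure (n 2) A"
    "measure (m 1) A - measure (m 3) A = measure (n 1) A - measure (n 3) A"
    if "A \<in> sets circle" for A
    using meq[OF that] by (auto simp: sum_i_powers complex_eq_iff)
  have R: "integral\<^sup>L (m j) g - integral\<^sup>L (m (j+2)) g = integral\<^sup>L (n j) g - integral\<^sup>L (n (j+2)) g"
    if "j < 2" "g \<in> borel_measurable circle" "\<And>x. \<bar>g x\<bar> \<le> C" for j and g :: "real \<Rightarrow> real"
  proof (rule integral_diff_measures_eq[where C = C])
    show "measure (m j) A - measure (m (j+2)) A = measure (n j) A - measure (n (j+2)) A"
      if "A \<in> sets (m j)" for A
    proof -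
      have "j = 0 \<or> j = 1" using \<open>j < 2\<close> by auto
      then show ?thesis
        using that e[of A] fs(2)[of j] by (auto simp: numeral_2_eq_2 numeral_3_eq_3)
    qed
    show "g \<in> borel_measurable (m j)"
      using that measurable_cong_sets[OF fs(2)[of j] refl] by auto
  qed (use that fs in auto)
  have C: "integral\<^sup>L (m j) f - integral\<^sup>L (m (j+2)) f = integral\<^sup>L (n j) f - integral\<^sup>L (n (j+2)) f"
    if j: "j < 2" for j
  proof -
    have int: "integrable M f" if "finite_measure M" "sets M = sets circle" for M
      by (rule finite_measure.integrable_const_bound[OF that(1), where B = C])
        (use bd f measurable_cong_sets[OF that(2) refl] in auto)
    have ii: "integrable (m j) f" "integrable (m (j+2)) f" "integrable (n j) f" "integrable (n (j+2)) f"
      using j by (auto intro!: int fs)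
    have "\<bar>Re (f x)\<bar> \<le> C" "\<bar>Im (f x)\<bar> \<le> C" for x
      using bd[of x] abs_Re_le_cmod[of "f x"] abs_Im_le_cmod[of "f x"] by linarith+
    then have "integral\<^sup>L (m j) (\<lambda>x. Re (f x)) - integral\<^sup>L (m (j+2)) (\<lambda>x. Re (f x))
         = integral\<^sup>L (n j) (\<lambda>x. Re (f x)) - integral\<^sup>L (n (j+2)) (\<lambda>x. Re (f x))"
      "integral\<^sup>L (m j) (\<lambda>x. Im (f x)) - integral\<^sup>L (m (j+2)) (\<lambda>x. Im (f x))
         = integral\<^sup>L (n j) (\<lambda>x. Im (f x)) - integral\<^sup>L (n (j+2)) (\<lambda>x. Im (f x))"
      using f by (intro R[OF j]; measurable)+
    then show ?thesis using ii by (simp add: complex_eq_iff)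
  qed
  show "I = (\<Sum>k<4. \<i> ^ k * integral\<^sup>L (m k) f)"
    using C[of 0] C[of 1] unfolding I sum_i_powers by (simp add: numeral_2_eq_2 numeral_3_eq_3)
qed (use m in auto)

lemma matrix_measure_decomposition:
  fixes \<rho> :: "real set \<Rightarrow> complex^'p^'p"
  assumes \<rho>: "matrix_measure \<rho>"
  shows "\<exists>m. measure_decomposition (\<lambda>A. \<rho> A $ a $ b) m"
proof -
  define q where "q v A = (\<Sum>i\<in>UNIV. \<Sum>j\<in>UNIV. cnj (v $ i) * \<rho> A $ i $ j * v $ j)" for v :: "complex^'p" and A
  have q0: "0 \<le> q v A" if "A \<in> sets circle" for v A
    using \<rho> that unfolding matrix_measure_def pos_semidef_def q_def by blast
  have qs: "(\<lambda>i. q v (A i)) sums q v (\<Union>i. A i)"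
    if A: "range A \<subseteq> sets circle" "disjoint_family A" for v A
  proof -
    have "(\<lambda>i. \<rho> (A i)) sums \<rho> (\<Union>i. A i)" using \<rho> A unfolding matrix_measure_def by blast
    then have "(\<lambda>n. \<rho> (A n) $ i $ j) sums (\<rho> (\<Union>i. A i) $ i $ j)" for i j
      by (intro bounded_linear.sums[OF bounded_linear_vec_nth])
    then show ?thesis unfolding q_def by (intro sums_sum sums_mult sums_mult2)
  qed
  have q_empty: "q v {} = 0" for v
    using qs[of "\<lambda>_. {}" v] by (auto simp: disjoint_family_on_def sums_iff summable_const_iff)
  define \<mu> where "\<mu> v = measure_of (space circle) (sets circle) (\<lambda>A. ennreal (Re (q v A) / 4))" for v
  have em: "emeasure (\<mu> v) A = ennreal (Re (q v A) / 4)" if A: "A \<in> sets circle" for v A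
    unfolding \<mu>_def
  proof (rule emeasure_measure_of_sigma[OF _ _ _ A])
    show "sigma_algebra (space circle) (sets circle)" by (rule sets.sigma_algebra_axioms)
    show "positive (sets circle) (\<lambda>A. ennreal (Re (q v A) / 4))" by (simp add: positive_def q_empty)
    show "countably_additive (sets circle) (\<lambda>A. ennreal (Re (q v A) / 4))"
    proof (rule countably_additiveI)
      fix A :: "nat \<Rightarrow> real set"
      assume A: "range A \<subseteq> sets circle" "disjoint_family A"
      have s: "(\<lambda>i. Re (q v (A i)) / 4) sums (Re (q v (\<Union>i. A i)) / 4)"
        by (intro sums_divide sums_Re qs A)
      have "0 \<le> Re (q v (A i))" for i
        using q0[of "A i" v] A(1) by (auto simp: less_eq_complex_def)
      then show "(\<Sum>i. ennreal (Re (q v (A i)) / 4)) = ennreal (Re (q v (\<Union>i. A i)) / 4)"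
        by (subst suminf_ennreal2) (use s[THEN sums_summable] s[THEN sums_unique] in simp_all)
    qed
  qed
  have sm: "sets (\<mu> v) = sets circle" for v
    unfolding \<mu>_def by (rule sets.sets_measure_of_eq)
  have fm: "finite_measure (\<mu> v)" for v
    by (rule finite_measureI) (use em[OF sets.top, of v] sets_eq_imp_space_eq[OF sm[of v]] in auto)
  have q4: "complex_of_real (measure (\<mu> v) A) = q v A / 4" if "A \<in> sets circle" for v A
    using em[OF that, of v] q0[OF that, of v]
    by (auto simp: measure_def less_eq_complex_def complex_eq_iff)
  define u :: "nat \<Rightarrow> complex^'p" where "u k = (\<chi> i. (if i = a then 1 else 0) + (if i = b then cnj (\<i> ^ k) else 0))" for k
  have qu: "q (u k) A = \<rho> A $ a $ a + cnj (\<i> ^ k) * \<rho> A $ a $ b + \<i> ^ k * \<rho> A $ b $ a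
      + \<i> ^ k * cnj (\<i> ^ k) * \<rho> A $ b $ b" for k A
  proof -
    have "q (u k) A = (\<Sum>i\<in>UNIV. \<Sum>j\<in>UNIV.
        (if j = a then (if i = a then \<rho> A $ i $ j else 0) else 0)
      + (if j = b then (if i = a then cnj (\<i> ^ k) * \<rho> A $ i $ j else 0) else 0)
      + (if j = a then (if i = b then \<i> ^ k * \<rho> A $ i $ j else 0) else 0)
      + (if j = b then (if i = b then \<i> ^ k * cnj (\<i> ^ k) * \<rho> A $ i $ j else 0) else 0))"
      unfolding q_def u_def by (intro sum.cong refl) (auto simp: algebra_simps)
    then show ?thesis by (simp add: sum.distrib)
  qed
  have "measure_decomposition (\<lambda>A. \<rho> A $ a $ b) (\<lambda>k. \<mu> (u k))"
    unfolding measure_decomposition_def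
  proof (intro conjI ballI allI impI)
    fix A assume A: "A \<in> sets circle"
    show "\<rho> A $ a $ b = (\<Sum>k<4. \<i> ^ k * complex_of_real (measure (\<mu> (u k)) A))"
      unfolding q4[OF A] qu sum_i_powers by (simp add: eval_nat_numeral field_simps)
  qed (use fm sm in auto)
  then show ?thesis by blast
qed

end

(*
  Let phi be the left orthonormal polynomial of degree n. Its Bernstein--Szego weight
  (phi^* phi)^{-1} has the same moments of order at most n as the given matrix measure, so for every
  constant C > 0 Hadamard's inequality, applied to the product of M = phi rho' phi^* and
  phi^{-*} C^{-1} phi^{-1}, together with ln x <= x - 1 gives
    2 sum_i sqrt M_ii >= 3 p - tr (C^{-1} (phi^* phi)^{-1}) + ln (det rho' / det C).
  Integrating over a compact set on which rho' is nearly C, and letting n tend to infinity (weak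
  convergence of the Bernstein--Szego weights to rho), shows that the mean of sum_i sqrt M_ii tends
  to p; as the mean of M is at most the identity, M_ii tends to 1 in mean. Applied to U phi with U a
  plane rotation this gives M -> I in mean, and the singular part of phi d rho phi^* tends to 0.

  The left and right polynomials are related on the circle by phi^R = phi^{L*} B with B unitary, and
  z^{1-n} B is the boundary value of a function that is analytic in the disc and vanishes at 0. Hence
  G_n, the integral of z^{1-n} phi^L d rho phi^R, tends to 0, and H_{n+1} is bounded by a multiple of
  G_n because of the recurrence z phi^L_n = A phi^L_{n+1} + G_n z^n phi^{R*}_n.
*)

theory Submission
  imports Defs "HOL-Complex_Analysis.Cauchy_Integral_Formula"
begin

section \<open>Matrix algebra\<close>

text \<open>The measure need not satisfy Szego's condition: ln det rho' may fail to be integrable,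
  so determinants cannot be compared on the whole circle at once. They are compared on finitely many
  compact pieces that exhaust the circle up to small mass; elsewhere the nonnegative square roots
  are dropped. The trace enters with a minus sign, so weak convergence is needed only as an upper
  bound on compact sets. Square roots are used for M because the mean of M_ii is at most 1: a mean
  of sqrt M_ii near 1 then forces sqrt M_ii to be near 1 in mean square, whereas ln x <= x - 1 alone
  would only bound the mean of M_ii from below. The constant 3 p is 2 p from the square roots plus p
  from the diagonal of the second factor. Analyticity of z^{1-n} B rests on the zeros of det phi
  lying in the open disc, which makes the reversed polynomial invertible on the closed disc. The
  matrix measure is handled as a semidefinite density with respect to one scalar measure that equals
  normalised Lebesgue measure off a null set; right polynomials are left polynomials of the
  transposed density.\<close>

abbreviation ht :: "complex^'n^'m \<Rightarrow> complex^'m^'n" where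
  "ht \<equiv> hermitian_transpose"

text \<open>Complex scalars for matrices: \<open>*\<^sub>R\<close> takes only real ones, and
  \<open>*\<close> is entrywise.\<close>

definition cscale :: "complex \<Rightarrow> complex^'n^'m \<Rightarrow> complex^'n^'m" (infixr "*\<^sub>C" 75) where
  "c *\<^sub>C A = (\<chi> i j. c * A $ i $ j)"

lemma cscale_nth [simp]: "(c *\<^sub>C A) $ i $ j = c * A $ i $ j"
  by (simp add: cscale_def)

lemma ht_nth [simp]: "ht A $ i $ j = cnj (A $ j $ i)"
  by (simp add: hermitian_transpose_def)

lemma matrix_mult_nth: "(A ** B) $ i $ j = (\<Sum>k\<in>UNIV. A $ i $ k * B $ k $ j)"
  by (simp add: matrix_matrix_mult_def)

lemma matrix_eqI: "(\<And>i j. A $ i $ j = B $ i $ j) \<Longrightarrow> A = B"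
  by (simp add: vec_eq_iff)

lemma mat_nth: "mat c $ i $ j = (if i = j then c else 0)"
  by (simp add: mat_def)

lemma cscale_simps [simp]:
  "0 *\<^sub>C A = 0" "1 *\<^sub>C A = A" "c *\<^sub>C 0 = 0" "a *\<^sub>C b *\<^sub>C A = (a * b) *\<^sub>C A"
  "(- c) *\<^sub>C A = - (c *\<^sub>C A)"
  by (rule matrix_eqI; simp add: mult.assoc)+

lemma cscale_distribs:
  "c *\<^sub>C (A + B) = c *\<^sub>C A + c *\<^sub>C B" "c *\<^sub>C (A - B) = c *\<^sub>C A - c *\<^sub>C B" "c *\<^sub>C (- A) = - (c *\<^sub>C A)"
  "(c + d) *\<^sub>C A = c *\<^sub>C A + d *\<^sub>C A" "(c - d) *\<^sub>C A = c *\<^sub>C A - d *\<^sub>C A"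
  by (rule matrix_eqI; simp add: algebra_simps)+

lemma cscale_sum: "c *\<^sub>C (\<Sum>k\<in>S. f k) = (\<Sum>k\<in>S. c *\<^sub>C f k)"
  by (rule matrix_eqI) (simp add: sum_component sum_distrib_left)

lemma sum_cscale: "(\<Sum>k\<in>S. f k) *\<^sub>C A = (\<Sum>k\<in>S. f k *\<^sub>C A)"
  by (rule matrix_eqI) (simp add: sum_component sum_distrib_right)

lemma cscale_mult [simp]:
  "(c *\<^sub>C A) ** B = c *\<^sub>C (A ** B)" "A ** (c *\<^sub>C B) = c *\<^sub>C (A ** B)"
  by (rule matrix_eqI; simp add: matrix_mult_nth sum_distrib_left algebra_simps)+

lemma mat_mult_eq_cscale: "mat c ** A = c *\<^sub>C A"
  by (rule matrix_eqI) (simp add: matrix_mult_nth mat_nth if_distrib[where f="\<lambda>x. x * _"] cong: if_cong)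

lemma cscale_scaleR: "complex_of_real r *\<^sub>C A = r *\<^sub>R A"
  by (rule matrix_eqI) (simp add: scaleR_conv_of_real[where 'a=complex])

lemma cnj_mult_norm:
  "z * cnj z = (complex_of_real (norm z))\<^sup>2" "cnj z * z = (complex_of_real (norm z))\<^sup>2"
  using complex_norm_square[of z] by (simp_all add: mult.commute)

lemma matrix_mult_ring:
  fixes A B C :: "complex^'n^'n"
  shows "A ** (B + C) = A ** B + A ** C" "(A + B) ** C = A ** C + B ** C"
    "A ** (B - C) = A ** B - A ** C" "(A - B) ** C = A ** C - B ** C"
    "A ** (- B) = - (A ** B)" "(- A) ** B = - (A ** B)"
  by (rule matrix_eqI; simp add: matrix_mult_nth sum.distrib sum_subtractf sum_negf algebra_simps)+

lemma matrix_mult_zero [simp]: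
  fixes A :: "complex^'n^'n"
  shows "0 ** A = 0" "A ** 0 = 0"
  by (rule matrix_eqI; simp add: matrix_mult_nth)+

lemma matrix_mult_sum:
  fixes A :: "complex^'n^'n"
  shows "A ** (\<Sum>k\<in>S. f k) = (\<Sum>k\<in>S. A ** f k)" "(\<Sum>k\<in>S. f k) ** A = (\<Sum>k\<in>S. f k ** A)"
  by (induction S rule: infinite_finite_induct; simp add: matrix_mult_ring)+

lemma ht_simps [simp]:
  "ht (ht A) = A" "ht (A + B) = ht A + ht B" "ht (A - B) = ht A - ht B" "ht (- A) = - ht A"
  "ht 0 = 0" "ht (c *\<^sub>C A) = cnj c *\<^sub>C ht A"
  by (rule matrix_eqI; simp)+

lemma ht_mat_1 [simp]: "ht (mat 1) = mat 1"
  by (rule matrix_eqI) (simp add: mat_nth)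

lemma ht_mult [simp]: "ht (A ** B) = ht B ** ht A"
  by (rule matrix_eqI) (simp add: matrix_mult_nth mult.commute)

lemma ht_sum [simp]: "ht (\<Sum>k\<in>S. f k) = (\<Sum>k\<in>S. ht (f k))"
  by (rule matrix_eqI) (simp add: sum_component)

lemma trace_cscale [simp]: "trace (c *\<^sub>C A) = c * trace A"
  by (simp add: trace_def sum_distrib_left)

lemma trace_ht [simp]: "trace (ht A) = cnj (trace A)"
  by (simp add: trace_def)

lemma det_ht [simp]: "det (ht A) = cnj (det A)"
proof -
  have "det (ht A) = det (transpose (ht A))" by simp
  also have "\<dots> = cnj (det A)" by (simp add: det_def transpose_def)
  finally show ?thesis .
qed

lemma norm_matrix_power2: "(norm A)\<^sup>2 = (\<Sum>i\<in>UNIV. \<Sum>j\<in>UNIV. (norm (A $ i $ j))\<^sup>2)"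
  by (simp add: norm_vec_def L2_set_def sum_nonneg)

text \<open>The norm of the type is the Frobenius norm. As a trace it can be averaged over the
  circle and evaluated by orthonormality or by the mean value property.\<close>

lemma norm_matrix_trace:
  fixes A :: "complex^'n^'n"
  shows "complex_of_real ((norm A)\<^sup>2) = trace (A ** ht A)"
  by (simp add: norm_matrix_power2 trace_def matrix_mult_nth complex_norm_square[symmetric])

lemma norm_ht [simp]:
  fixes A :: "complex^'n^'n"
  shows "norm (ht A) = norm A"
proof -
  have "(norm (ht A))\<^sup>2 = (norm A)\<^sup>2"
    unfolding norm_matrix_power2 by (subst sum.swap) simp
  then show ?thesis by simp
qed

lemma norm_cscale [simp]:
  fixes A :: "complex^'n^'n"
  shows "norm (c *\<^sub>C A) = norm c * norm A"
proof -
  have "(norm (c *\<^sub>C A))\<^sup>2 = (norm c * norm A)\<^sup>2"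
    unfolding power_mult_distrib norm_matrix_power2
    by (simp add: norm_mult power_mult_distrib sum_distrib_left)
  then show ?thesis by (simp only: power2_eq_iff_nonneg norm_ge_zero mult_nonneg_nonneg)
qed

text \<open>Cauchy-Schwarz on each entry of the product; the double sum of the bounds
  factorises.\<close>

lemma norm_matrix_mult:
  fixes A B :: "complex^'n^'n"
  shows "norm (A ** B) \<le> norm A * norm B"
proof -
  have "(norm (A ** B))\<^sup>2 \<le> (\<Sum>i\<in>UNIV. \<Sum>j\<in>UNIV. (\<Sum>k\<in>UNIV. (norm (A $ i $ k))\<^sup>2) * (\<Sum>k\<in>UNIV. (norm (B $ k $ j))\<^sup>2))"
    unfolding norm_matrix_power2
  proof (intro sum_mono)
    fix i j
    have "norm ((A ** B) $ i $ j) \<le> (\<Sum>k\<in>UNIV. norm (A $ i $ k) * norm (B $ k $ j))"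
      unfolding matrix_mult_nth norm_mult[symmetric] by (rule norm_sum)
    then have "(norm ((A ** B) $ i $ j))\<^sup>2 \<le> (\<Sum>k\<in>UNIV. norm (A $ i $ k) * norm (B $ k $ j))\<^sup>2"
      by (rule power_mono) simp
    also have "\<dots> \<le> (\<Sum>k\<in>UNIV. (norm (A $ i $ k))\<^sup>2) * (\<Sum>k\<in>UNIV. (norm (B $ k $ j))\<^sup>2)"
      by (rule Cauchy_Schwarz_ineq_sum)
    finally show "(norm ((A ** B) $ i $ j))\<^sup>2 \<le> (\<Sum>k\<in>UNIV. (norm (A $ i $ k))\<^sup>2) * (\<Sum>k\<in>UNIV. (norm (B $ k $ j))\<^sup>2)" .
  qed
  also have "\<dots> = (norm A)\<^sup>2 * (\<Sum>j\<in>UNIV. \<Sum>k\<in>UNIV. (norm (B $ k $ j))\<^sup>2)"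
    by (simp add: norm_matrix_power2 sum_product)
  also have "\<dots> = (norm A * norm B)\<^sup>2"
    unfolding power_mult_distrib norm_matrix_power2 by (subst (3) sum.swap) simp
  finally show ?thesis by (simp add: power2_le_iff_abs_le)
qed

lemma norm_entry_le:
  fixes A :: "complex^'n^'m"
  shows "norm (A $ i $ j) \<le> norm A"
  by (rule order_trans[OF Finite_Cartesian_Product.norm_nth_le Finite_Cartesian_Product.norm_nth_le])

lemma bounded_bilinear_matrix_mult:
  "bounded_bilinear ((**) :: complex^'n^'n \<Rightarrow> complex^'n^'n \<Rightarrow> complex^'n^'n)"
proof
  show "\<exists>K. \<forall>(a :: complex^'n^'n) (b :: complex^'n^'n). norm (a ** b) \<le> norm a * norm b * K"
    by (rule exI[of _ 1]) (auto intro: norm_matrix_mult)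
qed (simp_all add: matrix_mult_ring flip: cscale_scaleR)

lemma bounded_bilinear_cscale:
  "bounded_bilinear ((*\<^sub>C) :: complex \<Rightarrow> complex^'n^'n \<Rightarrow> complex^'n^'n)"
proof
  show "\<exists>K. \<forall>a. \<forall>b :: complex^'n^'n. norm (a *\<^sub>C b) \<le> norm a * norm b * K"
    by (rule exI[of _ 1]) auto
qed (simp_all add: cscale_distribs scaleR_conv_of_real[where 'a=complex] mult.commute flip: cscale_scaleR)

lemma bounded_linear_ht: "bounded_linear (ht :: complex^'n^'n \<Rightarrow> complex^'n^'n)"
proof
  show "\<exists>K. \<forall>x :: complex^'n^'n. norm (ht x) \<le> norm x * K"
    by (rule exI[of _ 1]) auto
qed (simp_all flip: cscale_scaleR)

lemma bounded_linear_entry: "bounded_linear (\<lambda>A :: complex^'n^'m. A $ i $ j)"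
  by (rule bounded_linear_compose[OF bounded_linear_vec_nth bounded_linear_vec_nth])

lemma bounded_linear_trace: "bounded_linear (trace :: complex^'n^'n \<Rightarrow> complex)"
  unfolding trace_def by (intro bounded_linear_sum bounded_linear_entry)

section \<open>Inverse matrices\<close>

lemma matrix_inv_works:
  fixes A :: "complex^'n^'n"
  assumes "invertible A"
  shows "A ** matrix_inv A = mat 1" "matrix_inv A ** A = mat 1"
  using assms someI_ex[of "\<lambda>B. A ** B = mat 1 \<and> B ** A = mat 1"]
  unfolding invertible_def matrix_inv_def by auto

lemma matrix_inv_cancel:
  fixes A :: "complex^'n^'n"
  assumes "invertible A"
  shows "A ** (matrix_inv A ** X) = X" "matrix_inv A ** (A ** X) = X"
    "X ** A ** matrix_inv A = X" "X ** matrix_inv A ** A = X"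
  using matrix_inv_works[OF assms] by (simp_all add: matrix_mul_assoc) (simp_all flip: matrix_mul_assoc)

lemma matrix_inv_unique:
  fixes A :: "complex^'n^'n"
  assumes "A ** B = mat 1"
  shows "matrix_inv A = B" "invertible A"
proof -
  have "B ** A = mat 1" using assms matrix_left_right_inverse by blast
  then show i: "invertible A" using assms invertible_def by blast
  show "matrix_inv A = B"
    using matrix_inv_cancel(2)[OF i, of B] by (simp add: assms)
qed

lemma invertible_ht:
  fixes A :: "complex^'n^'n"
  assumes "invertible A"
  shows "invertible (ht A)" "matrix_inv (ht A) = ht (matrix_inv A)"
proof -
  have "ht A ** ht (matrix_inv A) = mat 1"
    using matrix_inv_works(2)[OF assms] by (metis ht_mult ht_mat_1)
  then show "invertible (ht A)" "matrix_inv (ht A) = ht (matrix_inv A)"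
    using matrix_inv_unique by blast+
qed

lemma matrix_inv_mult:
  fixes A B :: "complex^'n^'n"
  assumes "invertible A" "invertible B"
  shows "invertible (A ** B)" "matrix_inv (A ** B) = matrix_inv B ** matrix_inv A"
proof -
  have "(A ** B) ** (matrix_inv B ** matrix_inv A) = mat 1"
    using matrix_inv_works[OF assms(1)] matrix_inv_cancel(3)[OF assms(2), of A] by (simp add: matrix_mul_assoc)
  then show "invertible (A ** B)" "matrix_inv (A ** B) = matrix_inv B ** matrix_inv A"
    using matrix_inv_unique by blast+
qed

lemma invertible_cscale:
  fixes A :: "complex^'n^'n"
  assumes "invertible A" "c \<noteq> 0"
  shows "invertible (c *\<^sub>C A)" "matrix_inv (c *\<^sub>C A) = inverse c *\<^sub>C matrix_inv A"
proof -
  have "(c *\<^sub>C A) ** (inverse c *\<^sub>C matrix_inv A) = mat 1"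
    using matrix_inv_works[OF assms(1)] assms(2) by simp
  then show "invertible (c *\<^sub>C A)" "matrix_inv (c *\<^sub>C A) = inverse c *\<^sub>C matrix_inv A"
    using matrix_inv_unique by blast+
qed

lemma transpose_ht: "transpose (ht A) = ht (transpose A)"
  by (rule matrix_eqI) (simp add: transpose_def)

section \<open>Positive semidefinite matrices\<close>

text \<open>Moves X onto the vector, so that congruence preserves every sign condition on the
  form.\<close>

lemma quadratic_form_congruence:
  fixes A X :: "complex^'n^'n"
  shows "(\<Sum>i\<in>UNIV. \<Sum>j\<in>UNIV. cnj (v $ i) * (X ** A ** ht X) $ i $ j * v $ j)
       = (\<Sum>k\<in>UNIV. \<Sum>l\<in>UNIV. cnj ((ht X *v v) $ k) * A $ k $ l * (ht X *v v) $ l)"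
    (is "?L = ?R")
proof -
  have "?L = (\<Sum>i\<in>UNIV. cnj (v $ i) * ((X ** A ** ht X) *v v) $ i)"
    by (simp add: matrix_vector_mult_def sum_distrib_left mult.assoc)
  also have "\<dots> = (\<Sum>i\<in>UNIV. cnj (v $ i) * (X *v (A *v (ht X *v v))) $ i)"
    by (simp add: matrix_vector_mul_assoc matrix_mul_assoc)
  also have "\<dots> = (\<Sum>i\<in>UNIV. \<Sum>k\<in>UNIV. cnj (v $ i) * X $ i $ k * (A *v (ht X *v v)) $ k)"
    by (simp add: matrix_vector_mult_def[of X] sum_distrib_left mult.assoc)
  also have "\<dots> = (\<Sum>k\<in>UNIV. cnj ((ht X *v v) $ k) * (A *v (ht X *v v)) $ k)"
    by (subst sum.swap) (simp add: matrix_vector_mult_def[of "ht X"] sum_distrib_right mult.commute)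
  also have "\<dots> = ?R"
    by (simp add: matrix_vector_mult_def[of A] sum_distrib_left mult.assoc)
  finally show ?thesis .
qed

lemma pos_semidef_congruence:
  fixes A X :: "complex^'n^'n"
  assumes "pos_semidef A"
  shows "pos_semidef (X ** A ** ht X)"
  using assms unfolding pos_semidef_def by (simp add: quadratic_form_congruence matrix_mul_assoc)

lemma pos_semidef_mat_1: "pos_semidef (mat 1 :: complex^'n^'n)"
  unfolding pos_semidef_def
proof (intro conjI allI)
  fix v :: "complex^'n"
  have "(\<Sum>i\<in>UNIV. \<Sum>j\<in>UNIV. cnj (v $ i) * mat 1 $ i $ j * v $ j) = (\<Sum>i\<in>UNIV. complex_of_real ((norm (v $ i))\<^sup>2))"
    by (simp add: mat_nth if_distrib if_distribR cnj_mult_norm mult.commute cong: if_cong)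
  also have "\<dots> = complex_of_real (\<Sum>i\<in>UNIV. (norm (v $ i))\<^sup>2)" by simp
  finally show "0 \<le> (\<Sum>i\<in>UNIV. \<Sum>j\<in>UNIV. cnj (v $ i) * mat 1 $ i $ j * v $ j)"
    by (simp add: less_eq_complex_def sum_nonneg)
qed simp

lemma pos_semidef_mult_ht:
  fixes X :: "complex^'n^'n"
  shows "pos_semidef (X ** ht X)"
  using pos_semidef_congruence[OF pos_semidef_mat_1, of X] by simp

lemma pos_semidef_ht: "pos_semidef A \<Longrightarrow> ht A = A"
  by (simp add: pos_semidef_def)

text \<open>The form at a vector supported on two coordinates, the source of the entry bounds below.
  The case i = j is included, so b = 0 gives the diagonal.\<close>

lemma pos_semidef_pair:
  assumes "pos_semidef A"
  shows "0 \<le> (norm a)\<^sup>2 * Re (A $ i $ i) + (norm b)\<^sup>2 * Re (A $ j $ j) + 2 * Re (cnj a * b * A $ i $ j)"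
    and "Im (A $ i $ i) = 0"
proof -
  have h: "A $ l $ k = cnj (A $ k $ l)" for k l
    using pos_semidef_ht[OF assms] by (metis ht_nth)
  show im: "Im (A $ i $ i) = 0" for i
    using h[of i i] by (simp add: complex_eq_iff)
  define v where "v = axis i a + axis j b"
  have v: "v $ k = (if k = i then a else 0) + (if k = j then b else 0)" for k
    by (auto simp: v_def axis_def)
  let ?Q = "\<Sum>k\<in>UNIV. \<Sum>l\<in>UNIV. cnj (v $ k) * A $ k $ l * v $ l"
  have nn: "0 \<le> Re ?Q"
    using assms unfolding pos_semidef_def less_eq_complex_def zero_complex.simps by blast
  have "?Q = (\<Sum>k\<in>UNIV. \<Sum>l\<in>UNIV. (if l = i then (if k = i then cnj a * A $ k $ l * a else 0) else 0)
       + (if l = j then (if k = i then cnj a * A $ k $ l * b else 0) else 0)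
       + (if l = i then (if k = j then cnj b * A $ k $ l * a else 0) else 0)
       + (if l = j then (if k = j then cnj b * A $ k $ l * b else 0) else 0))"
    by (intro sum.cong refl) (auto simp: v algebra_simps)
  also have "\<dots> = cnj a * A $ i $ i * a + cnj a * A $ i $ j * b + cnj b * A $ j $ i * a + cnj b * A $ j $ j * b"
    by (simp add: sum.distrib)
  finally have "Re (cnj a * A $ i $ i * a + cnj a * A $ i $ j * b + cnj b * A $ j $ i * a + cnj b * A $ j $ j * b) \<ge> 0"
    using nn by (simp only:)
  moreover have "Re (cnj a * A $ i $ i * a) = (norm a)\<^sup>2 * Re (A $ i $ i)"
    "Re (cnj b * A $ j $ j * b) = (norm b)\<^sup>2 * Re (A $ j $ j)"
    using im by (simp_all add: cmod_def power2_eq_square algebra_simps)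
  moreover have "Re (cnj b * A $ j $ i * a) = Re (cnj a * A $ i $ j * b)"
    unfolding h[of j i] by (simp add: algebra_simps)
  ultimately show "0 \<le> (norm a)\<^sup>2 * Re (A $ i $ i) + (norm b)\<^sup>2 * Re (A $ j $ j) + 2 * Re (cnj a * b * A $ i $ j)"
    by (simp add: algebra_simps)
qed

lemma pos_semidef_diag: "pos_semidef A \<Longrightarrow> 0 \<le> Re (A $ i $ i)"
  using pos_semidef_pair(1)[of A 1 i 0 i] by simp

lemma pos_semidef_diag_eq: "pos_semidef A \<Longrightarrow> A $ i $ i = complex_of_real (Re (A $ i $ i))"
  using pos_semidef_pair(2)[of A i] by (simp add: complex_eq_iff)

text \<open>The phase of b turns the cross term into -2 |A_ij|. The arithmetic mean suffices because
  the entries are later bounded by the trace.\<close>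

lemma pos_semidef_entry_le:
  assumes "pos_semidef A"
  shows "norm (A $ i $ j) \<le> (Re (A $ i $ i) + Re (A $ j $ j)) / 2"
proof -
  define b where "b = - cnj (sgn (A $ i $ j))"
  have "b * A $ i $ j = - complex_of_real (norm (A $ i $ j))"
    by (cases "A $ i $ j = 0") (auto simp: b_def sgn_eq complex_norm_square[symmetric] power2_eq_square divide_simps mult.commute)
  moreover have "(norm b)\<^sup>2 * Re (A $ j $ j) \<le> Re (A $ j $ j)"
    using pos_semidef_diag[OF assms, of j] by (auto simp: b_def norm_sgn)
  ultimately show ?thesis
    using pos_semidef_pair(1)[OF assms, of 1 i b j] by simp
qed

lemma pos_semidef_zero_diag:
  assumes "pos_semidef A" "A $ k $ k = 0"
  shows "A $ k $ j = 0"
proof (rule ccontr)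
  assume nz: "A $ k $ j \<noteq> 0"
  define N where "N = (norm (A $ k $ j))\<^sup>2"
  have N: "N > 0" using nz by (simp add: N_def)
  \<comment> \<open>The form at this vector is affine in t with slope -2 N; this t makes it
    -1.\<close>
  define t where "t = (Re (A $ j $ j) + 1) / (2 * N)"
  have "Re (cnj (- complex_of_real t * A $ k $ j) * 1 * A $ k $ j) = - (t * N)"
    unfolding N_def cmod_power2 by (simp add: power2_eq_square algebra_simps)
  then have "0 \<le> Re (A $ j $ j) - 2 * (t * N)"
    using pos_semidef_pair(1)[OF assms(1), of "- complex_of_real t * A $ k $ j" k 1 j] assms(2)
    by (simp only: zero_complex.simps norm_one one_power2 mult_1 mult_zero_right)
  then show False using N by (simp add: t_def)
qed

text \<open>For a Hermitian matrix a cleared row is a cleared column as well, so rows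
  suffice.\<close>

definition diagonal_row :: "complex^'n^'n \<Rightarrow> 'n \<Rightarrow> bool" where
  "diagonal_row M i \<longleftrightarrow> (\<forall>j. j \<noteq> i \<longrightarrow> M $ i $ j = 0)"

text \<open>One step of symmetric Gaussian elimination: congruence by a matrix of determinant 1
  clears row k, and each diagonal entry can only drop. If the pivot vanishes, its row is already
  zero. Rows cleared before stay cleared, which makes the step iterable.\<close>

lemma pos_semidef_eliminate:
  fixes M :: "complex^'n^'n"
  assumes M: "pos_semidef M"
  obtains M' where "pos_semidef M'" "det M' = det M" "\<And>i. Re (M' $ i $ i) \<le> Re (M $ i $ i)"
    "diagonal_row M' k" "\<And>i. diagonal_row M i \<Longrightarrow> diagonal_row M' i"
proof (cases "M $ k $ k = 0")
  case True
  show thesis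
    by (rule that[of M]) (use M pos_semidef_zero_diag[OF M True] in \<open>auto simp: diagonal_row_def\<close>)
next
  case False
  have h: "cnj (M $ a $ b) = M $ b $ a" for a b
    using pos_semidef_ht[OF M] by (metis ht_nth)
  define m where "m = Re (M $ k $ k)"
  have m: "M $ k $ k = complex_of_real m" "m > 0"
    using False pos_semidef_diag_eq[OF M, of k] pos_semidef_diag[OF M, of k] by (auto simp: m_def order_less_le)
  define c where "c j = (if j = k then 0 else M $ j $ k / m)" for j
  define E :: "complex^'n^'n" where "E = (\<chi> j l. (if l = j then 1 else 0) - (if l = k then c j else 0))"
  define M' where "M' = E ** M ** ht E"
  have EM: "(E ** X) $ j $ l = X $ j $ l - c j * X $ k $ l" for X :: "complex^'n^'n" and j l
    by (simp add: matrix_mult_nth E_def left_diff_distrib sum_subtractf if_distrib[where f="\<lambda>x. x * _"] cong: if_cong)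
  have ME: "(X ** ht E) $ j $ l = X $ j $ l - X $ j $ k * cnj (c l)" for X :: "complex^'n^'n" and j l
    by (simp add: matrix_mult_nth E_def right_diff_distrib sum_subtractf if_distrib[where f="\<lambda>x. _ * x"] if_distrib[where f=cnj] cong: if_cong)
  have M'_eq: "M' $ j $ l = (M $ j $ l - c j * M $ k $ l) - (M $ j $ k - c j * M $ k $ k) * cnj (c l)" for j l
    unfolding M'_def ME EM ..
  \<comment> \<open>The transpose of E is the identity with multiples of the other rows added to row
    k.\<close>
  have "det E = 1"
  proof -
    let ?I = "mat 1 :: complex^'n^'n"
    have "(\<Sum>j\<in>UNIV - {k}. (- c j) *s row j ?I) \<in> vec.span {row j ?I |j. j \<noteq> k}"
      by (intro vec.span_sum vec.span_scale vec.span_base) auto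
    then have "det (\<chi> i. if i = k then row k ?I + (\<Sum>j\<in>UNIV - {k}. (- c j) *s row j ?I) else row i ?I) = 1"
      by (subst det_row_span) auto
    moreover have "(\<chi> i. if i = k then row k ?I + (\<Sum>j\<in>UNIV - {k}. (- c j) *s row j ?I) else row i ?I) = transpose E"
    proof (rule matrix_eqI)
      fix i l
      have "(\<Sum>j\<in>UNIV - {k}. (- c j) *s row j ?I) $ l = (\<Sum>j\<in>UNIV. if j = l then - c j else 0)"
        unfolding sum_component by (rule sum.mono_neutral_cong_left) (auto simp: row_def mat_nth c_def)
      then show "(\<chi> i. if i = k then row k ?I + (\<Sum>j\<in>UNIV - {k}. (- c j) *s row j ?I) else row i ?I) $ i $ l = transpose E $ i $ l"
        by (auto simp: transpose_def E_def row_def mat_nth)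
    qed
    ultimately show ?thesis by (metis det_transpose)
  qed
  then have 1: "det M' = det M" by (simp add: M'_def det_mul)
  have 2: "pos_semidef M'" unfolding M'_def by (rule pos_semidef_congruence[OF M])
  have 3: "Re (M' $ i $ i) \<le> Re (M $ i $ i)" for i
  proof (cases "i = k")
    case True
    then show ?thesis by (simp add: M'_eq c_def)
  next
    case False
    \<comment> \<open>The Schur complement: entry (i, i) loses |M_ik|^2 / m.\<close>
    have "c i * M $ k $ i = complex_of_real ((norm (M $ i $ k))\<^sup>2 / m)"
      using False by (simp add: c_def cnj_mult_norm flip: h[of i k])
    moreover have "M $ i $ k - c i * M $ k $ k = 0" using False m by (simp add: c_def)
    ultimately show ?thesis using m(2) by (simp add: M'_eq)
  qed
  have 4: "M' $ k $ j = 0" if "j \<noteq> k" for j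
    using that m by (simp add: M'_eq c_def h)
  have 5: "M' $ i $ j = 0" if i: "diagonal_row M i" and j: "j \<noteq> i" for i j
  proof (cases "i = k")
    case True then show ?thesis using 4 j by simp
  next
    case False
    then have "M $ i $ k = 0" using i by (simp add: diagonal_row_def)
    moreover have "M $ i $ j = 0" using i j by (simp add: diagonal_row_def)
    ultimately show ?thesis by (simp add: M'_eq c_def)
  qed
  show thesis by (rule that[of M', OF 2 1 3]) (use 4 5 in \<open>auto simp: diagonal_row_def\<close>)
qed

text \<open>Clearing all rows in turn leaves a diagonal matrix with the same determinant and no
  larger diagonal entries, so the determinant is a product of nonnegative numbers.\<close>

lemma hadamard:
  fixes M :: "complex^'n^'n"
  assumes M: "pos_semidef M"
  shows "det M = complex_of_real (Re (det M))" "0 \<le> Re (det M)" "Re (det M) \<le> (\<Prod>i\<in>UNIV. Re (M $ i $ i))"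
proof -
  have "\<exists>M'. pos_semidef M' \<and> det M' = det M \<and> (\<forall>i. Re (M' $ i $ i) \<le> Re (M $ i $ i)) \<and>
    (\<forall>i\<in>S. diagonal_row M' i)" if "finite S" for S :: "'n set"
    using that
  proof (induction S)
    case empty
    then show ?case using M by auto
  next
    case (insert k S)
    then obtain M1 where M1: "pos_semidef M1" "det M1 = det M" "\<And>i. Re (M1 $ i $ i) \<le> Re (M $ i $ i)"
      "\<forall>i\<in>S. diagonal_row M1 i" by blast
    obtain M2 where M2:
      "pos_semidef M2" "det M2 = det M1" "\<And>i. Re (M2 $ i $ i) \<le> Re (M1 $ i $ i)"
      "diagonal_row M2 k" "\<And>i. diagonal_row M1 i \<Longrightarrow> diagonal_row M2 i"
      using pos_semidef_eliminate[OF M1(1), of k] by metis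
    have "Re (M2 $ i $ i) \<le> Re (M $ i $ i)" for i using M2(3)[of i] M1(3)[of i] by simp
    moreover have "diagonal_row M2 i" if "i \<in> insert k S" for i
      using that M2(4,5) M1(4) by blast
    ultimately show ?case using M1(2) M2(1,2) by (intro exI[of _ M2]) simp
  qed
  from this[of UNIV] obtain D where D: "pos_semidef D" "det D = det M" "\<And>i. Re (D $ i $ i) \<le> Re (M $ i $ i)"
      "\<And>i. diagonal_row D i" by auto
  have "det D = (\<Prod>i\<in>UNIV. D $ i $ i)" by (rule det_diagonal) (use D(4) in \<open>auto simp: diagonal_row_def\<close>)
  also have "\<dots> = (\<Prod>i\<in>UNIV. complex_of_real (Re (D $ i $ i)))"
    by (intro prod.cong refl pos_semidef_diag_eq D(1))
  finally have eq: "det M = complex_of_real (\<Prod>i\<in>UNIV. Re (D $ i $ i))" using D(2) by simp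
  show "det M = complex_of_real (Re (det M))" "0 \<le> Re (det M)" "Re (det M) \<le> (\<Prod>i\<in>UNIV. Re (M $ i $ i))"
    using D(3) pos_semidef_diag[OF D(1)] unfolding eq Re_complex_of_real
    by (auto intro!: prod_nonneg prod_mono)
qed

lemma pos_semidef_transpose:
  assumes "pos_semidef A"
  shows "pos_semidef (transpose A)"
  unfolding pos_semidef_def
proof (intro conjI allI)
  show "ht (transpose A) = transpose A"
    using pos_semidef_ht[OF assms] by (metis transpose_ht)
  fix v :: "complex^'a"
  have "(\<Sum>i\<in>UNIV. \<Sum>j\<in>UNIV. cnj (v $ i) * transpose A $ i $ j * v $ j)
      = (\<Sum>i\<in>UNIV. \<Sum>j\<in>UNIV. cnj ((\<chi> i. cnj (v $ i)) $ i) * A $ i $ j * (\<chi> i. cnj (v $ i)) $ j)"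
    by (subst sum.swap) (simp add: transpose_def mult_ac)
  moreover have "0 \<le> (\<Sum>i\<in>UNIV. \<Sum>j\<in>UNIV. cnj (u $ i) * A $ i $ j * u $ j)" for u
    using assms unfolding pos_semidef_def by blast
  ultimately show "0 \<le> (\<Sum>i\<in>UNIV. \<Sum>j\<in>UNIV. cnj (v $ i) * transpose A $ i $ j * v $ j)"
    by (simp only:)
qed

section \<open>The normalised Lebesgue measure on the circle\<close>

definition circle_lebesgue :: "real measure" where
  "circle_lebesgue = density (restrict_space lborel {0..<2*pi}) (\<lambda>_. ennreal (1 / (2*pi)))"

lemma sets_circle_lebesgue [simp, measurable_cong]: "sets circle_lebesgue = sets circle"
  by (simp add: circle_lebesgue_def sets_restrict_space)

lemma space_circle_lebesgue [simp]: "space circle_lebesgue = {0..<2*pi}"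
  by (simp add: circle_lebesgue_def space_restrict_space)

lemma emeasure_circle_lebesgue:
  assumes "A \<in> sets circle"
  shows "emeasure circle_lebesgue A = ennreal (1 / (2*pi)) * emeasure lborel A"
proof -
  have "A \<in> sets (restrict_space lborel {0..<2*pi})" using assms by (simp add: sets_restrict_space)
  moreover have "A \<subseteq> {0..<2*pi}" using sets.sets_into_space[OF assms] by (simp add: space_restrict_space)
  ultimately show ?thesis
    by (simp add: circle_lebesgue_def emeasure_density nn_integral_cmult emeasure_restrict_space)
qed

lemma sets_circle_borel: "A \<in> sets circle \<Longrightarrow> A \<in> sets borel"
  by (auto simp: sets_restrict_space)

lemma emeasure_circle_lebesgue_space: "emeasure circle_lebesgue {0..<2*pi} = 1"
proof -
  have "{0..<2*pi} \<in> sets circle" using sets.top[of circle] by (simp add: space_restrict_space)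
  then have "emeasure circle_lebesgue {0..<2*pi} = ennreal (1 / (2*pi)) * emeasure lborel {0..<2*pi}"
    by (rule emeasure_circle_lebesgue)
  also have "\<dots> = 1" by (simp flip: ennreal_mult)
  finally show ?thesis .
qed

interpretation circle_lebesgue: finite_measure circle_lebesgue
  by (rule finite_measureI) (simp add: emeasure_circle_lebesgue_space)

lemma measure_circle_lebesgue_space [simp]: "measure circle_lebesgue {0..<2*pi} = 1"
  by (simp add: measure_def emeasure_circle_lebesgue_space)

lemma integral_circle_lebesgue:
  fixes f :: "real \<Rightarrow> 'a :: {banach, second_countable_topology}"
  assumes "f \<in> borel_measurable circle"
  shows "(LINT \<theta>|circle_lebesgue. f \<theta>) = (1 / (2*pi)) *\<^sub>R (LINT \<theta>:{0..<2*pi}|lborel. f \<theta>)"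
    and "integrable circle_lebesgue f \<longleftrightarrow> set_integrable lborel {0..<2*pi} f"
proof -
  have m: "f \<in> borel_measurable (restrict_space lborel {0..<2*pi})"
    using assms by (simp add: measurable_def space_restrict_space sets_restrict_space)
  have "(LINT \<theta>|circle_lebesgue. f \<theta>) = (LINT \<theta>|restrict_space lborel {0..<2*pi}. (1 / (2*pi)) *\<^sub>R f \<theta>)"
    unfolding circle_lebesgue_def using m by (subst integral_density) auto
  then show "(LINT \<theta>|circle_lebesgue. f \<theta>) = (1 / (2*pi)) *\<^sub>R (LINT \<theta>:{0..<2*pi}|lborel. f \<theta>)"
    by (simp add: integral_restrict_space set_lebesgue_integral_def)
  have "integrable circle_lebesgue f \<longleftrightarrow> integrable (restrict_space lborel {0..<2*pi}) (\<lambda>\<theta>. (1 / (2*pi)) *\<^sub>R f \<theta>)"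
    unfolding circle_lebesgue_def using m by (subst integrable_density) auto
  also have "\<dots> \<longleftrightarrow> integrable (restrict_space lborel {0..<2*pi}) f"
  proof
    assume "integrable (restrict_space lborel {0..<2*pi}) (\<lambda>\<theta>. (1 / (2*pi)) *\<^sub>R f \<theta>)"
    then have "integrable (restrict_space lborel {0..<2*pi}) (\<lambda>\<theta>. (2*pi) *\<^sub>R (1 / (2*pi)) *\<^sub>R f \<theta>)"
      by (rule integrable_scaleR_right)
    then show "integrable (restrict_space lborel {0..<2*pi}) f" by simp
  qed (rule integrable_scaleR_right)
  finally show "integrable circle_lebesgue f \<longleftrightarrow> set_integrable lborel {0..<2*pi} f"
    by (simp add: integrable_restrict_space set_integrable_def)
qed

section \<open>Continuous functions on the circle and their means\<close>

lemma measurable_circle_continuous: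
  fixes f :: "complex \<Rightarrow> 'a :: topological_space"
  assumes "continuous_on (sphere 0 1) f" and M: "sets M = sets circle"
  shows "(\<lambda>\<theta>. f (cis \<theta>)) \<in> borel_measurable M"
proof -
  have "continuous_on UNIV (\<lambda>\<theta>. f (cis \<theta>))"
    by (rule continuous_on_compose2[OF assms(1)]) (auto intro!: continuous_intros)
  then have "(\<lambda>\<theta>. f (cis \<theta>)) \<in> borel_measurable borel"
    by (rule borel_measurable_continuous_onI)
  then have "(\<lambda>\<theta>. f (cis \<theta>)) \<in> borel_measurable circle" by (rule measurable_restrict_space1)
  then show ?thesis using measurable_cong_sets[OF M refl] by blast
qed

lemma sphere_bound:
  fixes f :: "complex \<Rightarrow> 'a :: real_normed_vector"
  assumes "continuous_on (sphere 0 1) f"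
  obtains K where "K \<ge> 0" "\<And>\<theta>. norm (f (cis \<theta>)) \<le> K"
proof -
  have "compact (f ` sphere 0 1)" using assms by (intro compact_continuous_image) auto
  then obtain K where "K > 0" "\<And>y. y \<in> f ` sphere 0 1 \<Longrightarrow> norm y \<le> K"
    by (meson compact_imp_bounded bounded_pos)
  then show thesis using that[of K] by auto
qed

lemma integrable_circle_continuous:
  fixes f :: "complex \<Rightarrow> 'a :: {banach, second_countable_topology}"
  assumes "continuous_on (sphere 0 1) f"
  shows "integrable circle_lebesgue (\<lambda>\<theta>. f (cis \<theta>))"
proof -
  obtain K where "\<And>\<theta>. norm (f (cis \<theta>)) \<le> K" using sphere_bound[OF assms] by blast
  then show ?thesis
    using measurable_circle_continuous[OF assms, of circle_lebesgue]
    by (intro circle_lebesgue.integrable_const_bound[where B = K]) auto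
qed

abbreviation circle_mean :: "(complex \<Rightarrow> 'a :: {banach, second_countable_topology}) \<Rightarrow> 'a" where
  "circle_mean f \<equiv> LINT \<theta>|circle_lebesgue. f (cis \<theta>)"

text \<open>Cauchy's formula at the centre. Continuity up to the circle is enough, so boundary
  values are integrated without extending f beyond the disc.\<close>

theorem mean_value:
  fixes f :: "complex \<Rightarrow> complex"
  assumes c: "continuous_on (cball 0 1) f" and h: "f holomorphic_on ball 0 1"
  shows "circle_mean f = f 0"
proof -
  have "((\<lambda>u. f u / (u - 0)) has_contour_integral (2 * of_real pi * \<i> * f 0)) (circlepath 0 1)"
    by (rule Cauchy_integral_circlepath) (use assms in auto)
  then have "((\<lambda>t. f (cis t) * \<i>) has_integral (2 * of_real pi * \<i> * f 0)) {0..2*pi}"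
    unfolding circlepath_def by (subst (asm) has_contour_integral_part_circlepath_iff) auto
  then have "((\<lambda>t. f (cis t) * \<i> * (- \<i>)) has_integral (2 * of_real pi * \<i> * f 0 * (- \<i>))) {0..2*pi}"
    by (rule has_integral_mult_left)
  then have I: "integral {0..2*pi} (\<lambda>t. f (cis t)) = 2 * of_real pi * f 0"
    by (simp add: mult.assoc integral_unique)
  have cs: "continuous_on (sphere 0 1) f" using c by (rule continuous_on_subset) auto
  have "continuous_on {0..2*pi} (\<lambda>t. f (cis t))"
    by (rule continuous_on_compose2[OF c]) (auto intro!: continuous_intros)
  then have "set_integrable lborel {0..2*pi} (\<lambda>t. f (cis t))"
    by (rule borel_integrable_atLeastAtMost')
  then have "(LINT t:{0..2*pi}|lborel. f (cis t)) = 2 * of_real pi * f 0"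
    by (simp add: set_borel_integral_eq_integral(2) I)
  \<comment> \<open>The contour integral covers the closed interval, \<open>circle_lebesgue\<close>
    the half-open one; they differ by one null point.\<close>
  moreover have "(LINT t:{0..<2*pi}|lborel. f (cis t)) = (LINT t:{0..2*pi}|lborel. f (cis t))"
    unfolding set_lebesgue_integral_def
  proof (rule integral_cong_AE)
    have [measurable]: "(\<lambda>t. f (cis t)) \<in> borel_measurable borel"
      by (intro borel_measurable_continuous_onI continuous_on_compose2[OF cs]) (auto intro!: continuous_intros)
    show "(\<lambda>x. indicat_real {0..<2 * pi} x *\<^sub>R f (cis x)) \<in> borel_measurable lborel"
      "(\<lambda>x. indicat_real {0..2 * pi} x *\<^sub>R f (cis x)) \<in> borel_measurable lborel" by measurable
    show "AE x in lborel. indicat_real {0..<2 * pi} x *\<^sub>R f (cis x) = indicat_real {0..2 * pi} x *\<^sub>R f (cis x)"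
      using AE_lborel_singleton[of "2*pi"] by eventually_elim (auto simp: indicator_def)
  qed
  ultimately show ?thesis
    using measurable_circle_continuous[OF cs, of circle]
    by (simp add: integral_circle_lebesgue scaleR_conv_of_real)
qed

section \<open>Matrix functions in the disc algebra\<close>

text \<open>Stated by entries, because holomorphy is a notion for scalar functions.\<close>

definition disc_algebra :: "(complex \<Rightarrow> complex^'n^'m) \<Rightarrow> bool" where
  "disc_algebra F \<longleftrightarrow> (\<forall>i j. continuous_on (cball 0 1) (\<lambda>z. F z $ i $ j) \<and> (\<lambda>z. F z $ i $ j) holomorphic_on ball 0 1)"

lemma disc_algebra_const: "disc_algebra (\<lambda>_. A)"
  by (simp add: disc_algebra_def)

lemma disc_algebra_add: "disc_algebra F \<Longrightarrow> disc_algebra G \<Longrightarrow> disc_algebra (\<lambda>z. F z + G z)"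
  by (simp add: disc_algebra_def continuous_on_add holomorphic_on_add)

lemma disc_algebra_diff: "disc_algebra F \<Longrightarrow> disc_algebra G \<Longrightarrow> disc_algebra (\<lambda>z. F z - G z)"
  by (simp add: disc_algebra_def continuous_on_diff holomorphic_on_diff)

lemma disc_algebra_mult: "disc_algebra F \<Longrightarrow> disc_algebra G \<Longrightarrow> disc_algebra (\<lambda>z. F z ** G z)"
  unfolding disc_algebra_def matrix_mult_nth
  by (auto intro!: continuous_on_sum continuous_on_mult holomorphic_intros)

lemma disc_algebra_cscale:
  assumes "continuous_on (cball 0 1) c" "c holomorphic_on ball 0 1" "disc_algebra F"
  shows "disc_algebra (\<lambda>z. c z *\<^sub>C F z)"
  using assms by (simp add: disc_algebra_def continuous_on_mult holomorphic_on_mult)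

lemma disc_algebra_power:
  assumes "disc_algebra F" shows "disc_algebra (\<lambda>z. z ^ k *\<^sub>C F z)" "disc_algebra (\<lambda>z. z *\<^sub>C F z)"
  by (intro disc_algebra_cscale assms continuous_intros holomorphic_intros)+

lemma disc_algebra_sum: "(\<And>k. k \<in> S \<Longrightarrow> disc_algebra (F k)) \<Longrightarrow> disc_algebra (\<lambda>z. \<Sum>k\<in>S. F k z)"
  unfolding disc_algebra_def sum_component by (auto intro!: continuous_on_sum holomorphic_on_sum)

lemmas disc_algebra_intros =
  disc_algebra_const disc_algebra_add disc_algebra_diff disc_algebra_mult disc_algebra_power disc_algebra_sum

text \<open>Cramer's rule: entries of the inverse are quotients of determinants, so continuity and
  holomorphy pass from a matrix function to its inverse.\<close>

lemma matrix_inv_entry: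
  fixes A :: "complex^'n^'n"
  assumes "invertible A"
  shows "matrix_inv A $ i $ j = det (\<chi> k l. if l = i then (if k = j then 1 else 0) else A $ k $ l) / det A"
proof -
  have d: "det A \<noteq> 0" using assms invertible_det_nz by blast
  have "A *v column j (matrix_inv A) = axis j 1"
    using matrix_inv_works(1)[OF assms]
    by (auto simp: vec_eq_iff matrix_vector_mult_def column_def matrix_mult_nth mat_nth axis_def)
  then have "column j (matrix_inv A) = (\<chi> k. det (\<chi> i l. if l = k then axis j 1 $ i else A $ i $ l) / det A)"
    by (rule cramer[OF d, THEN iffD1])
  then have "column j (matrix_inv A) $ i = det (\<chi> k l. if l = i then axis j 1 $ k else A $ k $ l) / det A" by simp
  moreover have "(\<chi> k l. if l = i then axis j 1 $ k else A $ k $ l) = (\<chi> k l. if l = i then (if k = j then 1 else 0) else A $ k $ l)"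
    by (auto simp: vec_eq_iff axis_def)
  ultimately show ?thesis by (simp add: column_def)
qed

lemma continuous_on_det:
  fixes F :: "'a :: topological_space \<Rightarrow> complex^'n^'n"
  assumes "\<And>i j. continuous_on S (\<lambda>z. F z $ i $ j)"
  shows "continuous_on S (\<lambda>z. det (F z))"
  unfolding det_def by (intro continuous_intros assms)

lemma holomorphic_on_det:
  assumes "\<And>i j. (\<lambda>z. F z $ i $ j) holomorphic_on S"
  shows "(\<lambda>z. det (F z)) holomorphic_on S"
  unfolding det_def by (intro holomorphic_intros assms)

lemma continuous_on_matrix_iff:
  fixes F :: "'a :: topological_space \<Rightarrow> complex^'n^'m"
  shows "continuous_on S F \<longleftrightarrow> (\<forall>i j. continuous_on S (\<lambda>z. F z $ i $ j))"
proof
  assume "continuous_on S F"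
  then show "\<forall>i j. continuous_on S (\<lambda>z. F z $ i $ j)"
    by (auto intro!: bounded_linear.continuous_on[OF bounded_linear_entry])
next
  assume "\<forall>i j. continuous_on S (\<lambda>z. F z $ i $ j)"
  then have "continuous_on S (\<lambda>z. \<chi> i. \<chi> j. F z $ i $ j)"
    by (intro continuous_on_vec_lambda) simp
  moreover have "(\<lambda>z. \<chi> i. \<chi> j. F z $ i $ j) = F" by (simp add: fun_eq_iff vec_eq_iff)
  ultimately show "continuous_on S F" by (simp only:)
qed

lemma continuous_on_entry:
  fixes F :: "'a :: topological_space \<Rightarrow> complex^'n^'m"
  shows "continuous_on S F \<Longrightarrow> continuous_on S (\<lambda>z. F z $ i $ j)"
  by (simp only: continuous_on_matrix_iff)

lemma continuous_on_matrix_inv: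
  fixes F :: "'a :: topological_space \<Rightarrow> complex^'n^'n"
  assumes F: "continuous_on S F" and inv: "\<And>z. z \<in> S \<Longrightarrow> invertible (F z)"
  shows "continuous_on S (\<lambda>z. matrix_inv (F z))"
proof -
  have e: "continuous_on S (\<lambda>z. F z $ i $ j)" for i j by (rule continuous_on_entry[OF F])
  have d: "continuous_on S (\<lambda>z. det (\<chi> k l. if l = i then (if k = j then 1 else 0) else F z $ k $ l) / det (F z))" for i j
  proof (intro continuous_on_divide continuous_on_det)
    show "\<forall>z\<in>S. det (F z) \<noteq> 0" using inv invertible_det_nz by blast
    show "continuous_on S (\<lambda>z. (\<chi> k l. if l = i then (if k = j then 1 else 0) else F z $ k $ l) $ a $ b)" for a b
      using e[of a b] by (cases "b = i"; cases "a = j") simp_all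
  qed (rule e)
  have "continuous_on S (\<lambda>z. matrix_inv (F z) $ i $ j)" for i j
    by (rule continuous_on_eq[OF d[of i j]]) (simp add: matrix_inv_entry inv)
  then show ?thesis by (subst continuous_on_matrix_iff) blast
qed

lemma disc_algebra_matrix_inv:
  fixes F :: "complex \<Rightarrow> complex^'n^'n"
  assumes F: "disc_algebra F" and inv: "\<And>z. norm z \<le> 1 \<Longrightarrow> invertible (F z)"
  shows "disc_algebra (\<lambda>z. matrix_inv (F z))"
  unfolding disc_algebra_def
proof (intro allI conjI)
  fix i j
  have "continuous_on (cball 0 1) F" using F by (simp add: disc_algebra_def continuous_on_matrix_iff[of _ F])
  then have "continuous_on (cball 0 1) (\<lambda>z. matrix_inv (F z))"
    by (rule continuous_on_matrix_inv) (use inv in auto)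
  then show "continuous_on (cball 0 1) (\<lambda>z. matrix_inv (F z) $ i $ j)" by (rule continuous_on_entry)
  have h: "(\<lambda>z. F z $ k $ l) holomorphic_on ball 0 1" for k l using F by (simp add: disc_algebra_def)
  have "(\<lambda>z. det (\<chi> k l. if l = i then (if k = j then 1 else 0) else F z $ k $ l) / det (F z)) holomorphic_on ball 0 1"
  proof (intro holomorphic_on_divide holomorphic_on_det)
    show "(\<lambda>z. (\<chi> k l. if l = i then (if k = j then 1 else 0) else F z $ k $ l) $ a $ b) holomorphic_on ball 0 1" for a b
      using h[of a b] by (cases "b = i"; cases "a = j") auto
    show "det (F z) \<noteq> 0" if "z \<in> ball 0 1" for z using inv[of z] invertible_det_nz that by auto
  qed (use h in auto)
  then show "(\<lambda>z. matrix_inv (F z) $ i $ j) holomorphic_on ball 0 1"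
    by (rule holomorphic_transform) (simp add: matrix_inv_entry inv)
qed

lemma disc_algebra_continuous: "disc_algebra F \<Longrightarrow> continuous_on (sphere 0 1) F"
  unfolding disc_algebra_def continuous_on_matrix_iff[of _ F]
  using continuous_on_subset[OF _ sphere_cball] by blast

lemma integral_entry:
  fixes F :: "'a \<Rightarrow> complex^'n^'n"
  assumes "integrable M F"
  shows "(LINT x|M. F x) $ i $ j = (LINT x|M. F x $ i $ j)" "integrable M (\<lambda>x. F x $ i $ j)"
  using integral_bounded_linear[OF bounded_linear_entry assms] integrable_bounded_linear[OF bounded_linear_entry assms]
  by auto

text \<open>The matrix is the sum of its entries placed in matrix units, and each placement is
  bounded linear.\<close>

lemma integrable_entryI:
  fixes F :: "'a \<Rightarrow> complex^'n^'n"
  assumes "\<And>i j. integrable M (\<lambda>x. F x $ i $ j)"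
  shows "integrable M F"
proof -
  have "bounded_linear (\<lambda>c :: complex. (\<chi> k l. if k = i \<and> l = j then c else 0) :: complex^'n^'n)" for i j
  proof -
    have "bounded_linear (\<lambda>c :: complex. c *\<^sub>C ((\<chi> k l. if k = i \<and> l = j then 1 else 0) :: complex^'n^'n))"
      by (rule bounded_bilinear.bounded_linear_left[OF bounded_bilinear_cscale])
    moreover have "c *\<^sub>C ((\<chi> k l. if k = i \<and> l = j then 1 else 0) :: complex^'n^'n) = (\<chi> k l. if k = i \<and> l = j then c else 0)" for c
      by (rule matrix_eqI) auto
    ultimately show ?thesis by simp
  qed
  then have "integrable M (\<lambda>x. (\<chi> k l. if k = i \<and> l = j then F x $ i $ j else 0) :: complex^'n^'n)" for i j
    using assms[of i j] by (rule integrable_bounded_linear)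
  then have "integrable M (\<lambda>x. \<Sum>i\<in>UNIV. \<Sum>j\<in>UNIV. (\<chi> k l. if k = i \<and> l = j then F x $ i $ j else 0) :: complex^'n^'n)"
    by (intro Bochner_Integration.integrable_sum) auto
  moreover have "(\<Sum>i\<in>UNIV. \<Sum>j\<in>UNIV. (\<chi> k l. if k = i \<and> l = j then F x $ i $ j else 0)) = F x" for x
  proof (rule matrix_eqI)
    fix a b
    have "(\<Sum>i\<in>UNIV. \<Sum>j\<in>UNIV. (\<chi> k l. if k = i \<and> l = j then F x $ i $ j else 0)) $ a $ b
       = (\<Sum>i\<in>UNIV. \<Sum>j\<in>UNIV. if j = b then (if i = a then F x $ i $ j else 0) else 0)"
      unfolding sum_component by (intro sum.cong refl) auto
    then show "(\<Sum>i\<in>UNIV. \<Sum>j\<in>UNIV. (\<chi> k l. if k = i \<and> l = j then F x $ i $ j else 0)) $ a $ b = F x $ a $ b"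
      by simp
  qed
  ultimately show ?thesis by simp
qed

lemma mean_disc_algebra:
  fixes F :: "complex \<Rightarrow> complex^'n^'n"
  assumes "disc_algebra F"
  shows "circle_mean F = F 0"
proof (rule matrix_eqI)
  fix i j
  have "circle_mean F $ i $ j = circle_mean (\<lambda>z. F z $ i $ j)"
    using integrable_circle_continuous[OF disc_algebra_continuous[OF assms]] by (rule integral_entry)
  also have "\<dots> = F 0 $ i $ j"
    using assms by (intro mean_value) (auto simp: disc_algebra_def)
  finally show "circle_mean F $ i $ j = F 0 $ i $ j" .
qed

lemma circle_mean_trace:
  fixes F :: "complex \<Rightarrow> complex^'n^'n"
  assumes "continuous_on (sphere 0 1) F"
  shows "circle_mean (\<lambda>z. trace (F z)) = trace (circle_mean F)"
  by (rule integral_bounded_linear[OF bounded_linear_trace integrable_circle_continuous[OF assms]])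

lemma mean_trace_disc_algebra:
  fixes F :: "complex \<Rightarrow> complex^'n^'n"
  assumes "disc_algebra F"
  shows "circle_mean (\<lambda>z. trace (F z)) = trace (F 0)"
  using circle_mean_trace[OF disc_algebra_continuous[OF assms]] mean_disc_algebra[OF assms] by simp

lemma continuous_on_matrix_mult [continuous_intros]:
  fixes F G :: "'a :: topological_space \<Rightarrow> complex^'n^'n"
  shows "continuous_on S F \<Longrightarrow> continuous_on S G \<Longrightarrow> continuous_on S (\<lambda>z. F z ** G z)"
  by (rule bounded_bilinear.continuous_on[OF bounded_bilinear_matrix_mult])

lemma continuous_on_cscale [continuous_intros]:
  fixes F :: "'a :: topological_space \<Rightarrow> complex^'n^'n"
  shows "continuous_on S c \<Longrightarrow> continuous_on S F \<Longrightarrow> continuous_on S (\<lambda>z. c z *\<^sub>C F z)"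
  by (rule bounded_bilinear.continuous_on[OF bounded_bilinear_cscale])

lemma continuous_on_ht [continuous_intros]:
  fixes F :: "'a :: topological_space \<Rightarrow> complex^'n^'n"
  shows "continuous_on S F \<Longrightarrow> continuous_on S (\<lambda>z. ht (F z))"
  by (rule bounded_linear.continuous_on[OF bounded_linear_ht])

lemma continuous_on_trace [continuous_intros]:
  fixes F :: "'a :: topological_space \<Rightarrow> complex^'n^'n"
  shows "continuous_on S F \<Longrightarrow> continuous_on S (\<lambda>z. trace (F z))"
  by (rule bounded_linear.continuous_on[OF bounded_linear_trace])

text \<open>The uniqueness principle behind both the identification of moments and the relation of
  left and right polynomials. Vanishing almost everywhere becomes vanishing everywhere, because by
  continuity a nonzero value would persist on an arc of positive measure.\<close>

lemma mean_norm_zero: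
  fixes F :: "complex \<Rightarrow> complex^'n^'n"
  assumes F: "continuous_on (sphere 0 1) F"
    and 0: "circle_mean (\<lambda>z. trace (F z ** ht (F z))) = 0"
    and z: "norm z = 1"
  shows "F z = 0"
proof -
  let ?g = "\<lambda>z. (norm (F z))\<^sup>2"
  have cg: "continuous_on (sphere 0 1) ?g" by (intro continuous_intros F)
  have "complex_of_real (circle_mean ?g) = circle_mean (\<lambda>z. trace (F z ** ht (F z)))"
    unfolding integral_complex_of_real[symmetric] norm_matrix_trace ..
  then have "circle_mean ?g = 0" using 0 by simp
  then have "AE \<theta> in circle_lebesgue. ?g (cis \<theta>) = 0"
    using integral_nonneg_eq_0_iff_AE[OF integrable_circle_continuous[OF cg]] by simp
  then have ae: "AE \<theta> in circle_lebesgue. F (cis \<theta>) = 0" by simp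
  show ?thesis
  proof (rule ccontr)
    assume nz: "F z \<noteq> 0"
    define t where "t = Arg2pi z"
    have t: "0 \<le> t" "t < 2*pi" "cis t = z"
      using Arg2pi[of z] z by (auto simp: t_def cis_conv_exp is_Arg_def)
    have cF: "continuous_on UNIV (\<lambda>\<theta>. F (cis \<theta>))"
      by (rule continuous_on_compose2[OF F]) (auto intro!: continuous_intros)
    have "open ((\<lambda>\<theta>. F (cis \<theta>)) -` (- {0}))"
      by (intro open_vimage cF) auto
    moreover have "t \<in> (\<lambda>\<theta>. F (cis \<theta>)) -` (- {0})" using nz t by simp
    ultimately obtain e where e: "e > 0" "\<And>s. \<bar>s - t\<bar> < e \<Longrightarrow> F (cis s) \<noteq> 0"
      by (auto simp: open_dist dist_real_def)
    \<comment> \<open>The arc extends only to the right of t, which may be 0, and stops before the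
      cut at 2 pi.\<close>
    define d where "d = min e (2*pi - t)"
    have d: "d > 0" using e t by (simp add: d_def)
    have "{t<..<t+d} \<in> sets circle"
      using t by (auto simp: sets_restrict_space d_def intro!: image_eqI[of _ _ "{t<..<t+d}"])
    moreover have "AE \<theta> in circle_lebesgue. \<theta> \<notin> {t<..<t+d}"
      using ae by eventually_elim (use e in \<open>auto simp: d_def\<close>)
    ultimately have "emeasure circle_lebesgue {t<..<t+d} = 0"
      by (subst AE_iff_measurable[symmetric, of _ _ "\<lambda>\<theta>. \<theta> \<notin> {t<..<t+d}"])
        (use t in \<open>auto simp: d_def\<close>)
    then show False
      using emeasure_circle_lebesgue[OF \<open>{t<..<t+d} \<in> sets circle\<close>] d
      by (simp add: ennreal_mult[symmetric] ennreal_eq_0_iff field_simps)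
  qed
qed

section \<open>Matrix polynomials and matrix weights\<close>

text \<open>The degree bound n is kept apart from the coefficients: the top coefficient may vanish,
  and the reversal depends on n.\<close>

definition mpoly :: "nat \<Rightarrow> (nat \<Rightarrow> complex^'n^'n) \<Rightarrow> complex \<Rightarrow> complex^'n^'n" where
  "mpoly n a z = (\<Sum>k\<le>n. z ^ k *\<^sub>C a k)"

text \<open>The polynomial z^n P(1 / cnj z)^*, see \<open>reversed_eq\<close>; written through
  coefficients so that its value at 0 is defined too.\<close>

definition reversed :: "nat \<Rightarrow> (nat \<Rightarrow> complex^'n^'n) \<Rightarrow> complex \<Rightarrow> complex^'n^'n" where
  "reversed n a z = mpoly n (\<lambda>k. ht (a (n - k))) z"

lemma disc_algebra_mpoly: "disc_algebra (mpoly n a)"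
  unfolding mpoly_def by (intro disc_algebra_intros)

lemma disc_algebra_reversed: "disc_algebra (reversed n a)"
  unfolding reversed_def by (intro disc_algebra_mpoly)

lemma continuous_on_mpoly: "continuous_on S (mpoly n a)"
  unfolding mpoly_def by (intro continuous_intros)

lemma continuous_on_reversed: "continuous_on S (reversed n a)"
  unfolding reversed_def by (intro continuous_on_mpoly)

lemma mpoly_0 [simp]: "mpoly n a 0 = a 0"
proof -
  have "mpoly n a 0 = (\<Sum>k\<le>n. if k = 0 then a k else 0)"
    unfolding mpoly_def by (intro sum.cong) (auto simp: power_0_left)
  then show ?thesis by simp
qed

lemma reversed_0 [simp]: "reversed n a 0 = ht (a n)"
  by (simp add: reversed_def)

lemma mpoly_cmult: "A ** mpoly n a z = mpoly n (\<lambda>k. A ** a k) z" "mpoly n a z ** A = mpoly n (\<lambda>k. a k ** A) z"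
  by (simp_all add: mpoly_def matrix_mult_sum)

lemma reversed_eq:
  assumes "z \<noteq> 0"
  shows "reversed n a z = z ^ n *\<^sub>C ht (mpoly n a (1 / cnj z))"
proof -
  have "z ^ n *\<^sub>C ht (mpoly n a (1 / cnj z)) = (\<Sum>k\<le>n. z ^ (n - k) *\<^sub>C ht (a k))"
    unfolding mpoly_def ht_sum cscale_sum
    using assms by (intro sum.cong refl) (simp add: power_divide power_diff)
  also have "\<dots> = (\<Sum>k\<le>n. z ^ k *\<^sub>C ht (a (n - k)))"
    by (rule sum.reindex_bij_witness[where i="\<lambda>k. n - k" and j="\<lambda>k. n - k"]) auto
  finally show ?thesis by (simp add: reversed_def mpoly_def)
qed

lemma unit_circle:
  assumes "norm z = 1"
  shows "z \<noteq> 0" "cnj z = inverse z" "z * cnj z = 1" "cnj z * z = 1" "1 / cnj z = z"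
proof -
  show 0: "z \<noteq> 0" using assms by auto
  show 1: "z * cnj z = 1" "cnj z * z = 1" using assms by (simp_all add: cnj_mult_norm)
  then show "cnj z = inverse z" by (metis inverse_unique)
  show "1 / cnj z = z" using 0 1 by (simp add: field_simps)
qed

lemma unit_circle_powi:
  assumes "norm z = 1"
  shows "cnj (z powi j) = z powi (- j)" "z ^ k * cnj (z ^ l) = z powi (int k - int l)"
proof -
  have "cnj (z powi j) = cnj z powi j" by (simp add: power_int_def)
  then show "cnj (z powi j) = z powi (- j)"
    by (simp add: unit_circle[OF assms] power_int_minus power_int_inverse)
  show "z ^ k * cnj (z ^ l) = z powi (int k - int l)"
    using unit_circle(1,2)[OF assms] by (simp add: power_int_diff divide_inverse power_inverse)
qed

lemma reversed_circle:
  assumes "norm z = 1"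
  shows "reversed n a z = z ^ n *\<^sub>C ht (mpoly n a z)" "ht (mpoly n a z) = z powi (- int n) *\<^sub>C reversed n a z"
proof -
  show "reversed n a z = z ^ n *\<^sub>C ht (mpoly n a z)"
    using reversed_eq[of z n a] unit_circle[OF assms] by simp
  then show "ht (mpoly n a z) = z powi (- int n) *\<^sub>C reversed n a z"
    using unit_circle(1)[OF assms] by (simp add: power_int_minus)
qed

text \<open>Inversion in the circle sends the punctured disc to the exterior; at 0 the leading
  coefficient takes over.\<close>

lemma reversed_invertible:
  assumes lead: "invertible (a n)" and inv: "\<And>z. norm z \<ge> 1 \<Longrightarrow> invertible (mpoly n a z)"
    and z: "norm z \<le> 1"
  shows "invertible (reversed n a z)"
proof (cases "z = 0")
  case True
  then show ?thesis using invertible_ht(1)[OF lead] by simp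
next
  case False
  then have "norm (1 / cnj z) \<ge> 1" using z by (simp add: norm_divide)
  then show ?thesis
    unfolding reversed_eq[OF False] by (intro invertible_cscale invertible_ht inv) (use False in auto)
qed

section \<open>Integrals of matrix-valued functions\<close>

lemma measurable_matrix_mult:
  fixes A B :: "'a \<Rightarrow> complex^'n^'n"
  assumes "A \<in> borel_measurable M" "B \<in> borel_measurable M"
  shows "(\<lambda>x. A x ** B x) \<in> borel_measurable M"
  by (rule borel_measurable_continuous_Pair[OF assms]) (intro continuous_intros)

lemma integrable_matrix_mult:
  fixes A B R :: "'a \<Rightarrow> complex^'n^'n"
  assumes R: "integrable M R" and A: "A \<in> borel_measurable M" and B: "B \<in> borel_measurable M"
    and KA: "\<And>x. norm (A x) \<le> KA" and KB: "\<And>x. norm (B x) \<le> KB"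
  shows "integrable M (\<lambda>x. A x ** R x ** B x)"
proof (rule Bochner_Integration.integrable_bound)
  show "integrable M (\<lambda>x. (KA * KB) *\<^sub>R norm (R x))" using R by auto
  show "(\<lambda>x. A x ** R x ** B x) \<in> borel_measurable M"
    by (intro measurable_matrix_mult A B borel_measurable_integrable[OF R])
  show "AE x in M. norm (A x ** R x ** B x) \<le> norm ((KA * KB) *\<^sub>R norm (R x))"
  proof (rule AE_I2)
    fix x
    have "0 \<le> KA" "0 \<le> KB" using KA[of x] KB[of x] by (meson norm_ge_zero order_trans)+
    have "norm (A x ** R x ** B x) \<le> norm (A x) * norm (R x) * norm (B x)"
      by (intro order_trans[OF norm_matrix_mult] mult_right_mono norm_matrix_mult) auto
    also have "\<dots> \<le> KA * norm (R x) * KB"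
      using \<open>0 \<le> KA\<close> by (intro mult_mono KA KB order_refl mult_nonneg_nonneg) auto
    finally show "norm (A x ** R x ** B x) \<le> norm ((KA * KB) *\<^sub>R norm (R x))"
      using \<open>0 \<le> KA\<close> \<open>0 \<le> KB\<close> by (simp add: abs_mult mult_ac)
  qed
qed

lemma integral_matrix_const_mult:
  fixes F :: "'a \<Rightarrow> complex^'n^'n"
  assumes "integrable M F"
  shows "(LINT x|M. A ** F x) = A ** (LINT x|M. F x)" "(LINT x|M. F x ** A) = (LINT x|M. F x) ** A"
    "(LINT x|M. c *\<^sub>C F x) = c *\<^sub>C (LINT x|M. F x)"
  using integral_bounded_linear[OF bounded_bilinear.bounded_linear_right[OF bounded_bilinear_matrix_mult] assms]
    integral_bounded_linear[OF bounded_bilinear.bounded_linear_left[OF bounded_bilinear_matrix_mult] assms]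
    integral_bounded_linear[OF bounded_bilinear.bounded_linear_right[OF bounded_bilinear_cscale] assms]
  by auto

lemma integral_ht:
  fixes F :: "'a \<Rightarrow> complex^'n^'n"
  assumes "integrable M F"
  shows "(LINT x|M. ht (F x)) = ht (LINT x|M. F x)"
  using integral_bounded_linear[OF bounded_linear_ht assms] .

lemma integral_transpose:
  fixes F :: "'a \<Rightarrow> complex^'n^'n"
  assumes "integrable M F"
  shows "integrable M (\<lambda>x. transpose (F x))" "(LINT x|M. transpose (F x)) = transpose (LINT x|M. F x)"
proof -
  have t: "transpose X $ i $ j = X $ j $ i" for X :: "complex^'n^'n" and i j by (simp add: transpose_def)
  show i: "integrable M (\<lambda>x. transpose (F x))"
    by (rule integrable_entryI) (simp add: t integral_entry(2)[OF assms])
  show "(LINT x|M. transpose (F x)) = transpose (LINT x|M. F x)"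
    by (rule matrix_eqI) (simp add: integral_entry(1)[OF i] t integral_entry(1)[OF assms])
qed

definition matrix_moment :: "real measure \<Rightarrow> (real \<Rightarrow> complex^'n^'n) \<Rightarrow> int \<Rightarrow> complex^'n^'n" where
  "matrix_moment \<tau> R j = (LINT \<theta>|\<tau>. cis \<theta> powi j *\<^sub>C R \<theta>)"

text \<open>
  The paper's relations \<open>\<integral> \<phi> d\<rho> z\<^sup>-\<^sup>j = 0\<close> for \<open>j < n\<close> and
  \<open>\<integral> \<phi> d\<rho> z\<^sup>-\<^sup>n = (L\<^sub>n\<^sup>*)\<^sup>-\<^sup>1\<close>, in terms of the moments \<open>c\<close> only: they express that
  \<^term>\<open>mpoly n L\<close> is a left orthonormal polynomial.
\<close>

definition left_orthopoly :: "(int \<Rightarrow> complex^'n^'n) \<Rightarrow> nat \<Rightarrow> (nat \<Rightarrow> complex^'n^'n) \<Rightarrow> bool" where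
  "left_orthopoly c n L \<longleftrightarrow> invertible (L n) \<and>
     (\<forall>j\<le>n. (\<Sum>k\<le>n. L k ** c (int k - int j)) = (if j = n then matrix_inv (ht (L n)) else 0))"

text \<open>A matrix measure as a density with respect to a scalar measure; this covers the given
  measure, its transpose and the Bernstein--Szego weights alike. Semidefiniteness is required at
  every point, so that pointwise arguments meet no null sets.\<close>

locale matrix_weight =
  fixes \<tau> :: "real measure" and R :: "real \<Rightarrow> complex^'n^'n"
  assumes sets_weight: "sets \<tau> = sets circle"
    and integrable_weight: "integrable \<tau> R"
    and psd: "\<And>\<theta>. pos_semidef (R \<theta>)"
begin

definition ip :: "(complex \<Rightarrow> complex^'n^'n) \<Rightarrow> (complex \<Rightarrow> complex^'n^'n) \<Rightarrow> complex^'n^'n" where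
  "ip P Q = (LINT \<theta>|\<tau>. P (cis \<theta>) ** R \<theta> ** ht (Q (cis \<theta>)))"

lemma integrable_weighted:
  fixes P Q :: "complex \<Rightarrow> complex^'n^'n"
  assumes P: "continuous_on (sphere 0 1) P" and Q: "continuous_on (sphere 0 1) Q"
  shows "integrable \<tau> (\<lambda>\<theta>. P (cis \<theta>) ** R \<theta> ** Q (cis \<theta>))"
proof -
  obtain K1 K2 where "\<And>\<theta>. norm (P (cis \<theta>)) \<le> K1" "\<And>\<theta>. norm (Q (cis \<theta>)) \<le> K2"
    using sphere_bound[OF P] sphere_bound[OF Q] by metis
  then show ?thesis
    by (intro integrable_matrix_mult integrable_weight measurable_circle_continuous[OF P sets_weight]
        measurable_circle_continuous[OF Q sets_weight])
qed

lemma integrable_ip: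
  fixes P Q :: "complex \<Rightarrow> complex^'n^'n"
  assumes "continuous_on (sphere 0 1) P" "continuous_on (sphere 0 1) Q"
  shows "integrable \<tau> (\<lambda>\<theta>. P (cis \<theta>) ** R \<theta> ** ht (Q (cis \<theta>)))"
  using integrable_weighted[OF assms(1) continuous_on_ht[OF assms(2)]] .

lemma ip_cmult_left:
  assumes "continuous_on (sphere 0 1) P" "continuous_on (sphere 0 1) Q"
  shows "ip (\<lambda>z. A ** P z) Q = A ** ip P Q" "ip (\<lambda>z. c *\<^sub>C P z) Q = c *\<^sub>C ip P Q"
  using integral_matrix_const_mult[OF integrable_ip[OF assms]] by (simp_all add: ip_def matrix_mul_assoc)

lemma ht_ip:
  assumes "continuous_on (sphere 0 1) P" "continuous_on (sphere 0 1) Q"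
  shows "ht (ip P Q) = ip Q P"
  unfolding ip_def integral_ht[OF integrable_ip[OF assms], symmetric]
  by (simp add: pos_semidef_ht[OF psd] matrix_mul_assoc)

lemma ip_cmult_right:
  assumes "continuous_on (sphere 0 1) P" "continuous_on (sphere 0 1) Q"
  shows "ip P (\<lambda>z. A ** Q z) = ip P Q ** ht A" "ip P (\<lambda>z. c *\<^sub>C Q z) = cnj c *\<^sub>C ip P Q"
  using integral_matrix_const_mult[OF integrable_ip[OF assms]] by (simp_all add: ip_def matrix_mul_assoc)

lemma ip_add_left:
  assumes "continuous_on (sphere 0 1) P" "continuous_on (sphere 0 1) P'" "continuous_on (sphere 0 1) Q"
  shows "ip (\<lambda>z. P z + P' z) Q = ip P Q + ip P' Q" "ip (\<lambda>z. P z - P' z) Q = ip P Q - ip P' Q"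
  using integrable_ip[OF assms(1,3)] integrable_ip[OF assms(2,3)]
  by (simp_all add: ip_def matrix_mult_ring)

lemma ip_add_right:
  assumes "continuous_on (sphere 0 1) P" "continuous_on (sphere 0 1) Q" "continuous_on (sphere 0 1) Q'"
  shows "ip P (\<lambda>z. Q z + Q' z) = ip P Q + ip P Q'" "ip P (\<lambda>z. Q z - Q' z) = ip P Q - ip P Q'"
  using integrable_ip[OF assms(1,2)] integrable_ip[OF assms(1,3)]
  by (simp_all add: ip_def matrix_mult_ring)

lemma ip_sum_left:
  assumes "\<And>k. k \<in> S \<Longrightarrow> continuous_on (sphere 0 1) (P k)" "continuous_on (sphere 0 1) Q"
  shows "ip (\<lambda>z. \<Sum>k\<in>S. P k z) Q = (\<Sum>k\<in>S. ip (P k) Q)"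
  unfolding ip_def matrix_mult_sum
  by (intro Bochner_Integration.integral_sum integrable_ip assms)

lemma ip_sum_right:
  assumes "\<And>k. k \<in> S \<Longrightarrow> continuous_on (sphere 0 1) (P k)" "continuous_on (sphere 0 1) Q"
  shows "ip Q (\<lambda>z. \<Sum>k\<in>S. P k z) = (\<Sum>k\<in>S. ip Q (P k))"
  unfolding ip_def matrix_mult_sum ht_sum
  by (intro Bochner_Integration.integral_sum integrable_ip assms)



lemma ip_shift: "ip (\<lambda>z. z *\<^sub>C P z) (\<lambda>z. z *\<^sub>C Q z) = ip P Q"
proof -
  have "cnj (cis \<theta>) * cis \<theta> = 1" for \<theta> by (rule unit_circle) simp
  then show ?thesis by (simp add: ip_def del: cis_cnj)
qed

lemma ip_diag_nonneg:
  assumes "continuous_on (sphere 0 1) P"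
  shows "0 \<le> Re (ip P P $ i $ i)"
proof -
  note i = integrable_ip[OF assms assms]
  have "Re (ip P P $ i $ i) = (LINT \<theta>|\<tau>. Re ((P (cis \<theta>) ** R \<theta> ** ht (P (cis \<theta>))) $ i $ i))"
    unfolding ip_def integral_entry(1)[OF i] using integral_entry(2)[OF i] by simp
  also have "\<dots> \<ge> 0"
    by (intro integral_nonneg_AE AE_I2 pos_semidef_diag pos_semidef_congruence psd)
  finally show ?thesis .
qed

abbreviation moment :: "int \<Rightarrow> complex^'n^'n" where
  "moment \<equiv> matrix_moment \<tau> R"

lemma integrable_moment: "integrable \<tau> (\<lambda>\<theta>. cis \<theta> powi j *\<^sub>C R \<theta>)"
proof -
  have "continuous_on (sphere 0 1) (\<lambda>z :: complex. z powi j *\<^sub>C (mat 1 :: complex^'n^'n))"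
    by (intro continuous_intros) auto
  from integrable_weighted[OF this, of "\<lambda>_. mat 1"] show ?thesis
    by (simp add: mat_mult_eq_cscale)
qed

lemma ht_moment: "ht (moment j) = moment (- j)"
  unfolding matrix_moment_def integral_ht[OF integrable_moment, symmetric]
  by (simp only: ht_simps pos_semidef_ht[OF psd] unit_circle_powi(1)[OF norm_cis])

lemma ip_monomial:
  "ip (\<lambda>z. z ^ k *\<^sub>C A) (\<lambda>z. z ^ l *\<^sub>C B) = A ** moment (int k - int l) ** ht B"
proof -
  have "cnj (cis \<theta> ^ l) * cis \<theta> ^ k = cis \<theta> powi (int k - int l)" for \<theta>
    using unit_circle_powi(2)[of "cis \<theta>" k l] by (simp only: norm_cis mult.commute)
  then have eq: "(cis \<theta> ^ k *\<^sub>C A) ** R \<theta> ** ht (cis \<theta> ^ l *\<^sub>C B) = A ** (cis \<theta> powi (int k - int l) *\<^sub>C R \<theta>) ** ht B" for \<theta>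
    by (simp only: ht_simps cscale_mult cscale_simps)
  have "integrable \<tau> (\<lambda>\<theta>. A ** (cis \<theta> powi (int k - int l) *\<^sub>C R \<theta>))"
    by (rule integrable_bounded_linear[OF bounded_bilinear.bounded_linear_right[OF bounded_bilinear_matrix_mult] integrable_moment])
  then show ?thesis
    unfolding ip_def eq matrix_moment_def
    by (simp only: integral_matrix_const_mult integrable_moment)
qed

lemma ip_mpoly_monomial:
  "ip (mpoly n a) (\<lambda>z. z ^ l *\<^sub>C B) = (\<Sum>k\<le>n. a k ** moment (int k - int l)) ** ht B"
proof -
  have "ip (mpoly n a) (\<lambda>z. z ^ l *\<^sub>C B) = (\<Sum>k\<le>n. ip (\<lambda>z. z ^ k *\<^sub>C a k) (\<lambda>z. z ^ l *\<^sub>C B))"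
    unfolding mpoly_def[abs_def] by (intro ip_sum_left continuous_intros)
  then show ?thesis by (simp add: ip_monomial matrix_mult_sum)
qed

lemma ip_mpoly_right:
  assumes "continuous_on (sphere 0 1) P"
  shows "ip P (mpoly n b) = (\<Sum>l\<le>n. ip P (\<lambda>z. z ^ l *\<^sub>C b l))"
  unfolding mpoly_def[abs_def] by (intro ip_sum_right continuous_intros assms)

section \<open>Orthogonal polynomials and their zeros\<close>

context
  fixes n L assumes L: "left_orthopoly moment n L"
begin

lemma orthopoly_lead: "invertible (L n)"
  using L by (simp add: left_orthopoly_def)

lemma orthopoly_monomial:
  assumes "j \<le> n"
  shows "ip (mpoly n L) (\<lambda>z. z ^ j *\<^sub>C B) = (if j = n then matrix_inv (ht (L n)) ** ht B else 0)"
  using L assms by (simp add: ip_mpoly_monomial left_orthopoly_def)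

lemma orthopoly_mpoly:
  assumes "m \<le> n"
  shows "ip (mpoly n L) (mpoly m b) = (if m = n then matrix_inv (ht (L n)) ** ht (b n) else 0)"
proof -
  have "ip (mpoly n L) (mpoly m b) = (\<Sum>j\<le>m. if j = n then matrix_inv (ht (L n)) ** ht (b j) else 0)"
    unfolding ip_mpoly_right[OF continuous_on_mpoly]
    using assms by (intro sum.cong refl) (simp add: orthopoly_monomial)
  then show ?thesis using assms by auto
qed

lemma orthopoly_norm: "ip (mpoly n L) (mpoly n L) = mat 1"
  using orthopoly_mpoly[of n L] matrix_inv_works(2)[OF invertible_ht(1)[OF orthopoly_lead]] by simp

text \<open>If a nonzero row annihilates phi(z0) from the left, then V phi = (z - z0) Q with Q of
  degree below n, hence orthogonal to phi. Since multiplication by z is isometric, Pythagoras for z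
  Q = V phi + z0 Q gives |Q|^2 = |V|^2 + |z0|^2 |Q|^2, impossible when |z0| >= 1.\<close>

lemma orthopoly_invertible:
  assumes z: "norm z0 \<ge> 1"
  shows "invertible (mpoly n L z0)"
proof (rule ccontr)
  assume "\<not> invertible (mpoly n L z0)"
  then have "\<not> invertible (ht (mpoly n L z0))" using invertible_ht(1) ht_simps(1) by metis
  then have "\<nexists>B. B ** ht (mpoly n L z0) = mat 1"
    using invertible_left_inverse by blast
  then obtain x where x: "ht (mpoly n L z0) *v x = 0" "x \<noteq> 0"
    unfolding matrix_left_invertible_ker by blast
  \<comment> \<open>Every row of V is the adjoint of x: a square matrix keeps all products within
    the type of \<open>ip\<close>.\<close>
  define V :: "complex^'n^'n" where "V = (\<chi> i j. cnj (x $ j))"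
  have V0: "V \<noteq> 0" using x(2) by (auto simp: V_def vec_eq_iff)
  have "(V ** mpoly n L z0) $ i $ j = cnj ((ht (mpoly n L z0) *v x) $ j)" for i j
    by (simp add: V_def matrix_mult_nth matrix_vector_mult_def mult.commute)
  then have V: "V ** mpoly n L z0 = 0" using x(1) by (intro matrix_eqI) simp
  \<comment> \<open>Quotient coefficients of synthetic division by z - z0.\<close>
  define b where "b i = (\<Sum>k\<in>{i<..n}. z0 ^ (k - Suc i) *\<^sub>C (V ** L k))" for i
  define Q where "Q z = (\<Sum>i<n. z ^ i *\<^sub>C b i)" for z
  define \<Phi> where "\<Phi> z = V ** mpoly n L z" for z
  have cQ: "continuous_on S Q" for S unfolding Q_def[abs_def] by (intro continuous_intros)
  have c\<Phi>: "continuous_on S \<Phi>" for S unfolding \<Phi>_def[abs_def] by (intro continuous_intros continuous_on_mpoly)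
  have fac: "\<Phi> z = z *\<^sub>C Q z - z0 *\<^sub>C Q z" for z
  proof -
    have "\<Phi> z = \<Phi> z - V ** mpoly n L z0" by (simp add: V)
    also have "\<dots> = (\<Sum>k\<le>n. (z ^ k - z0 ^ k) *\<^sub>C (V ** L k))"
      by (simp add: \<Phi>_def mpoly_def matrix_mult_sum cscale_distribs sum_subtractf)
    also have "\<dots> = (\<Sum>k\<le>n. \<Sum>i<k. ((z - z0) * (z0 ^ (k - Suc i) * z ^ i)) *\<^sub>C (V ** L k))"
      by (simp add: power_diff_sumr2 sum_distrib_left sum_cscale)
    also have "\<dots> = (\<Sum>i<n. \<Sum>k\<in>{i<..n}. ((z - z0) * (z0 ^ (k - Suc i) * z ^ i)) *\<^sub>C (V ** L k))"
      by (subst sum.Sigma, simp, simp, subst sum.Sigma, simp, simp)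
        (rule sum.reindex_bij_witness[where i="\<lambda>(a,b). (b,a)" and j="\<lambda>(a,b). (b,a)"]; auto)
    also have "\<dots> = (z - z0) *\<^sub>C Q z"
      by (simp add: Q_def b_def cscale_sum mult_ac)
    finally show ?thesis by (simp add: cscale_distribs)
  qed
  have "ip (mpoly n L) Q = (\<Sum>i<n. ip (mpoly n L) (\<lambda>z. z ^ i *\<^sub>C b i))"
    unfolding Q_def[abs_def] by (intro ip_sum_right continuous_intros continuous_on_mpoly)
  also have "\<dots> = 0" by (simp add: orthopoly_monomial)
  finally have "ip \<Phi> Q = 0"
    unfolding \<Phi>_def by (subst ip_cmult_left) (simp_all add: cQ continuous_on_mpoly)
  then have Q\<Phi>: "ip \<Phi> Q = 0" "ip Q \<Phi> = 0" using ht_ip[OF c\<Phi> cQ] by auto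
  have \<Phi>\<Phi>: "ip \<Phi> \<Phi> = V ** ht V"
    unfolding \<Phi>_def by (simp add: ip_cmult_left ip_cmult_right continuous_on_mpoly continuous_on_matrix_mult orthopoly_norm)
  have "ip Q Q = ip (\<lambda>z. z *\<^sub>C Q z) (\<lambda>z. z *\<^sub>C Q z)" by (rule ip_shift[symmetric])
  also have "(\<lambda>z. z *\<^sub>C Q z) = (\<lambda>z. \<Phi> z + z0 *\<^sub>C Q z)" by (simp add: fac)
  also have "ip (\<lambda>z. \<Phi> z + z0 *\<^sub>C Q z) (\<lambda>z. \<Phi> z + z0 *\<^sub>C Q z) = V ** ht V + (z0 * cnj z0) *\<^sub>C ip Q Q"
    by (simp add: ip_add_left ip_add_right ip_cmult_left ip_cmult_right cQ c\<Phi> continuous_on_cscale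
        continuous_on_add Q\<Phi> \<Phi>\<Phi> mult.commute)
  finally have "Re (trace (ip Q Q)) = Re (trace (V ** ht V)) + Re (trace ((z0 * cnj z0) *\<^sub>C ip Q Q))"
    by (metis trace_add plus_complex.simps(1))
  then have eq: "Re (trace (ip Q Q)) = (norm V)\<^sup>2 + (norm z0)\<^sup>2 * Re (trace (ip Q Q))"
    by (simp add: cnj_mult_norm norm_matrix_trace[symmetric] flip: of_real_power)
  have "0 \<le> Re (trace (ip Q Q))" by (simp add: trace_def sum_nonneg ip_diag_nonneg cQ)
  moreover have "1 \<le> (norm z0)\<^sup>2" using z by simp
  ultimately have "Re (trace (ip Q Q)) \<le> (norm z0)\<^sup>2 * Re (trace (ip Q Q))"
    by (metis mult_1 mult_right_mono)
  moreover have "(norm V)\<^sup>2 > 0" using V0 by simp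
  ultimately show False using eq by linarith
qed

end

end

section \<open>Bernstein--Szego approximation\<close>

text \<open>The guards in the convolution keep the truncated subtraction i - k meaningful and the
  index within the degree of the second factor.\<close>

lemma mpoly_mult:
  "mpoly n a z ** mpoly m b z = mpoly (n + m) (\<lambda>i. \<Sum>k\<le>n. if k \<le> i \<and> i - k \<le> m then a k ** b (i - k) else 0) z"
proof -
  have "mpoly (n + m) (\<lambda>i. \<Sum>k\<le>n. if k \<le> i \<and> i - k \<le> m then a k ** b (i - k) else 0) z
      = (\<Sum>i\<le>n+m. \<Sum>k\<le>n. if k \<le> i \<and> i - k \<le> m then z ^ i *\<^sub>C (a k ** b (i - k)) else 0)"
    unfolding mpoly_def cscale_sum by (intro sum.cong refl) auto
  also have "\<dots> = (\<Sum>k\<le>n. \<Sum>i\<le>n+m. if k \<le> i \<and> i - k \<le> m then z ^ i *\<^sub>C (a k ** b (i - k)) else 0)"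
    by (rule sum.swap)
  also have "\<dots> = (\<Sum>k\<le>n. \<Sum>j\<le>m. z ^ (k + j) *\<^sub>C (a k ** b j))"
  proof (rule sum.cong[OF refl])
    fix k assume k: "k \<in> {..n}"
    have "(\<Sum>i\<le>n+m. if k \<le> i \<and> i - k \<le> m then z ^ i *\<^sub>C (a k ** b (i - k)) else 0)
        = (\<Sum>i\<in>{k..k+m}. z ^ i *\<^sub>C (a k ** b (i - k)))"
      by (rule sum.mono_neutral_cong_right) (use k in auto)
    also have "\<dots> = (\<Sum>j\<le>m. z ^ (k + j) *\<^sub>C (a k ** b j))"
      by (rule sum.reindex_bij_witness[where i="\<lambda>j. k + j" and j="\<lambda>i. i - k"]) auto
    finally show "(\<Sum>i\<le>n+m. if k \<le> i \<and> i - k \<le> m then z ^ i *\<^sub>C (a k ** b (i - k)) else 0)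
        = (\<Sum>j\<le>m. z ^ (k + j) *\<^sub>C (a k ** b j))" .
  qed
  also have "\<dots> = mpoly n a z ** mpoly m b z"
    by (simp add: mpoly_def matrix_mult_sum power_add sum.swap[of _ "{..m}"] mult.commute cscale_sum)
  finally show ?thesis by (rule sym)
qed

lemma infinite_unit_circle: "infinite (sphere (0::complex) 1)"
proof
  assume "finite (sphere (0::complex) 1)"
  moreover have "cis ` {0..1} \<subseteq> sphere 0 1" by auto
  ultimately have "finite (cis ` {0..1::real})" using finite_subset by blast
  moreover have "inj_on cis {0..1::real}"
  proof (rule inj_onI)
    fix x y :: real assume "x \<in> {0..1}" "y \<in> {0..1}" "cis x = cis y"
    moreover have "1 \<le> pi" using pi_gt3 by linarith
    ultimately show "x = y"
      using cos_inj_pi[of x y] by (auto simp: complex_eq_iff)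
  qed
  ultimately have "finite {0..1::real}" by (rule finite_imageD)
  then show False using infinite_Icc[of 0 "1::real"] by simp
qed

text \<open>The circle is infinite, so each entry is a polynomial with too many roots.\<close>

lemma mpoly_circle_zero:
  assumes "\<And>z. norm z = 1 \<Longrightarrow> mpoly n a z = 0" "k \<le> n"
  shows "a k = 0"
proof (rule matrix_eqI)
  fix i j
  have "sphere 0 1 \<subseteq> {z. (\<Sum>k\<le>n. a k $ i $ j * z ^ k) = 0}"
  proof
    fix z :: complex assume "z \<in> sphere 0 1"
    then have "mpoly n a z $ i $ j = 0" using assms(1) by simp
    then show "z \<in> {z. (\<Sum>k\<le>n. a k $ i $ j * z ^ k) = 0}"
      by (simp add: mpoly_def sum_component mult.commute)
  qed
  then have "infinite {z. (\<Sum>k\<le>n. a k $ i $ j * z ^ k) = 0}"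
    using infinite_unit_circle finite_subset by blast
  then show "a k $ i $ j = 0 $ i $ j"
    using polyfun_finite_roots[of "\<lambda>k. a k $ i $ j" n] assms(2) by auto
qed

text \<open>The reversal of an orthogonal polynomial is invertible on the closed disc, so this
  replaces an antianalytic factor by an analytic one, to which the mean value property
  applies.\<close>

lemma ht_inv_circle:
  assumes "norm z = 1" "invertible (mpoly n L z)"
  shows "ht (matrix_inv (mpoly n L z)) = z ^ n *\<^sub>C matrix_inv (reversed n L z)"
proof -
  have "z \<noteq> 0" using unit_circle(1)[OF assms(1)] .
  then show ?thesis
    unfolding reversed_circle(1)[OF assms(1)]
    using invertible_cscale(2)[OF invertible_ht(1)[OF assms(2)], of "z ^ n"] invertible_ht(2)[OF assms(2)] by simp
qed

text \<open>
  Splitting \<open>\<phi> E\<close> into positive and negative frequencies, hermiticity of \<open>\<phi> E \<phi>\<^sup>*\<close>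
  gives \<open>E = Y + Y\<^sup>*\<close> on the circle, where \<open>Y\<close> has only frequencies above the degree of \<open>E\<close>;
  so \<open>E\<close> is orthogonal to itself.
\<close>

lemma toeplitz_unique:
  fixes L :: "nat \<Rightarrow> complex^'n^'n" and e :: "int \<Rightarrow> complex^'n^'n"
  assumes lead: "invertible (L n)" and inv: "\<And>z. norm z \<ge> 1 \<Longrightarrow> invertible (mpoly n L z)"
    and herm: "\<And>j. ht (e j) = e (- j)"
    and eqs: "\<And>j. j \<le> n \<Longrightarrow> (\<Sum>k\<le>n. L k ** e (int k - int j)) = 0"
    and j: "\<bar>j\<bar> \<le> int n"
  shows "e j = 0"
proof -
  define \<phi> where "\<phi> = mpoly n L"
  define \<phi>' where "\<phi>' = reversed n L"
  \<comment> \<open>E has coefficient e(j) at z^{-j}, so it is the density with moments e(j); the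
    factor z^n in \<open>PE\<close> makes it a polynomial.\<close>
  define a where "a m = e (int n - int m)" for m
  define PE where "PE = mpoly (2*n) a"
  define E where "E z = z powi (- int n) *\<^sub>C PE z" for z
  \<comment> \<open>Coefficients of phi times \<open>PE\<close>. The equations \<open>eqs\<close>
    empty the band from n to 2 n; what remains of phi E are frequencies above n, collected in
    \<open>S\<close>, and negative ones, whose adjoint is \<open>T\<close>.\<close>
  define g where "g i = (\<Sum>k\<le>n. if k \<le> i \<and> i - k \<le> 2*n then L k ** a (i - k) else 0)" for i
  define S where "S z = (\<Sum>i\<in>{2*n+1..3*n}. z ^ (i - 2*n - 1) *\<^sub>C g i)" for z
  define T where "T z = (\<Sum>i<n. z ^ (n - i) *\<^sub>C ht (g i))" for z
  define A where "A z = z *\<^sub>C (S z ** \<phi>' z)" for z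
  define B where "B z = \<phi> z ** T z" for z
  define D where "D z = A z - B z" for z
  define Y where "Y z = z ^ n *\<^sub>C (T z ** matrix_inv (\<phi>' z))" for z
  have inv': "invertible (\<phi>' z)" if "norm z \<le> 1" for z
    unfolding \<phi>'_def by (rule reversed_invertible[of L n, OF lead inv that])
  have dS: "disc_algebra S" and dT: "disc_algebra T"
    unfolding S_def[abs_def] T_def[abs_def] by (intro disc_algebra_intros)+
  have d\<phi>: "disc_algebra \<phi>" "disc_algebra \<phi>'" "disc_algebra PE"
    unfolding \<phi>_def \<phi>'_def PE_def by (intro disc_algebra_mpoly disc_algebra_reversed)+
  have dinv: "disc_algebra (\<lambda>z. matrix_inv (\<phi>' z))"
    by (rule disc_algebra_matrix_inv[OF d\<phi>(2) inv'])
  have dD: "disc_algebra D"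
    unfolding D_def[abs_def] A_def B_def by (intro disc_algebra_intros dS dT d\<phi>)
  have T0: "T 0 = 0" unfolding T_def by (rule sum.neutral) (auto simp: power_0_left)
  have D0: "D 0 = 0" by (simp add: D_def A_def B_def T0)
  have g0: "g i = 0" if "n \<le> i" "i \<le> 2*n" for i
  proof -
    have "g i = (\<Sum>k\<le>n. L k ** e (int k - int (i - n)))"
      unfolding g_def a_def using that by (intro sum.cong refl) (auto simp: algebra_simps)
    then show ?thesis using eqs[of "i - n"] that by simp
  qed
  have Eh: "ht (E z) = E z" if z: "norm z = 1" for z
  proof -
    have "reversed (2*n) a z = PE z"
      unfolding reversed_def PE_def mpoly_def
      by (intro sum.cong refl) (auto simp: a_def herm of_nat_diff)
    then have "ht (PE z) = z powi (- int (2*n)) *\<^sub>C PE z"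
      using reversed_circle(2)[OF z, of "2*n" a] by (simp add: PE_def)
    moreover have "z powi int n * z powi (- int (2*n)) = z powi (- int n)"
      using unit_circle(1)[OF z] by (subst power_int_add[symmetric]) auto
    moreover have "cnj (z powi (- int n)) = z powi int n"
      using unit_circle_powi(1)[OF z, of "- int n"] by (simp only: minus_minus)
    ultimately show ?thesis by (simp only: E_def ht_simps cscale_simps)
  qed
  have \<phi>E: "\<phi> z ** E z = z ^ (n + 1) *\<^sub>C S z + ht (T z)" if z: "norm z = 1" for z
  proof -
    have nz: "z \<noteq> 0" using unit_circle(1)[OF z] .
    have "\<phi> z ** PE z = (\<Sum>i\<le>3*n. z ^ i *\<^sub>C g i)"
      unfolding \<phi>_def PE_def mpoly_mult by (simp add: mpoly_def g_def)
    also have "\<dots> = (\<Sum>i\<in>{..<n} \<union> {2*n+1..3*n}. z ^ i *\<^sub>C g i)"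
    proof (rule sum.mono_neutral_right)
      show "\<forall>i\<in>{..3*n} - ({..<n} \<union> {2*n+1..3*n}). z ^ i *\<^sub>C g i = 0"
      proof
        fix i assume "i \<in> {..3*n} - ({..<n} \<union> {2*n+1..3*n})"
        then have "n \<le> i" "i \<le> 2*n" by auto
        then show "z ^ i *\<^sub>C g i = 0" by (simp add: g0)
      qed
    qed auto
    also have "\<dots> = (\<Sum>i<n. z ^ i *\<^sub>C g i) + (\<Sum>i\<in>{2*n+1..3*n}. z ^ i *\<^sub>C g i)"
      by (rule sum.union_disjoint) auto
    finally have "\<phi> z ** E z = (\<Sum>i<n. (z powi (- int n) * z ^ i) *\<^sub>C g i) + (\<Sum>i\<in>{2*n+1..3*n}. (z powi (- int n) * z ^ i) *\<^sub>C g i)"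
      by (simp add: E_def cscale_distribs cscale_sum)
    moreover have "(\<Sum>i<n. (z powi (- int n) * z ^ i) *\<^sub>C g i) = ht (T z)"
      unfolding T_def ht_sum
    proof (intro sum.cong refl)
      fix i assume i: "i \<in> {..<n}"
      have "cnj (z ^ (n - i)) = z powi (- int (n - i))"
        using unit_circle_powi(1)[OF z, of "int (n - i)"] by simp
      also have "\<dots> = z powi (- int n + int i)" using i by (simp add: of_nat_diff)
      also have "\<dots> = z powi (- int n) * z ^ i" using nz by (subst power_int_add) simp_all
      finally show "(z powi (- int n) * z ^ i) *\<^sub>C g i = ht (z ^ (n - i) *\<^sub>C ht (g i))" by simp
    qed
    moreover have "(\<Sum>i\<in>{2*n+1..3*n}. (z powi (- int n) * z ^ i) *\<^sub>C g i) = z ^ (n + 1) *\<^sub>C S z"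
      unfolding S_def cscale_sum
    proof (intro sum.cong refl)
      fix i assume i: "i \<in> {2*n+1..3*n}"
      have "z ^ i = z ^ n * (z ^ (n + 1) * z ^ (i - 2*n - 1))"
        using i by (simp flip: power_add power_Suc)
      then show "(z powi (- int n) * z ^ i) *\<^sub>C g i = z ^ (n + 1) *\<^sub>C z ^ (i - 2*n - 1) *\<^sub>C g i"
        using nz by (simp add: power_int_minus flip: mult.assoc)
    qed
    ultimately show ?thesis by (simp add: add.commute)
  qed
  have \<phi>E\<phi>: "\<phi> z ** E z ** ht (\<phi> z) = A z + ht (B z)" if z: "norm z = 1" for z
    unfolding \<phi>E[OF z] A_def B_def \<phi>'_def reversed_circle(1)[OF z]
    by (simp add: \<phi>_def matrix_mult_ring)
  \<comment> \<open>phi E phi^* equals A + B^* and is Hermitian, so the analytic function A - B is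
    Hermitian on the circle; as it vanishes at 0, its mean square is 0.\<close>
  have Dh: "ht (D z) = D z" if z: "norm z = 1" for z
  proof -
    have "ht (\<phi> z ** E z ** ht (\<phi> z)) = \<phi> z ** E z ** ht (\<phi> z)" by (simp add: Eh[OF z] matrix_mul_assoc)
    then have "ht (A z) + B z = A z + ht (B z)" by (simp add: \<phi>E\<phi>[OF z])
    then show ?thesis by (simp add: D_def algebra_simps)
  qed
  have "circle_mean (\<lambda>z. trace (D z ** ht (D z))) = circle_mean (\<lambda>z. trace (D z ** D z))"
    by (simp add: Dh)
  also have "\<dots> = 0"
    using mean_trace_disc_algebra[OF disc_algebra_mult[OF dD dD]] by (simp add: D0 trace_def)
  finally have D: "D z = 0" if "norm z = 1" for z
    using mean_norm_zero[OF disc_algebra_continuous[OF dD]] that by blast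
  have EY: "E z = Y z + ht (Y z)" if z: "norm z = 1" for z
  proof -
    have i: "invertible (\<phi> z)" using inv[of z] z by (simp add: \<phi>_def)
    have hinv: "ht (\<phi> z) ** ht (matrix_inv (\<phi> z)) = mat 1"
      unfolding ht_mult[symmetric] matrix_inv_works(2)[OF i] by (rule ht_mat_1)
    have Yz: "Y z = T z ** ht (matrix_inv (\<phi> z))"
      using ht_inv_circle[OF z i[unfolded \<phi>_def]] by (simp add: Y_def \<phi>_def \<phi>'_def)
    have "E z = matrix_inv (\<phi> z) ** (\<phi> z ** E z ** ht (\<phi> z)) ** ht (matrix_inv (\<phi> z))"
      by (simp add: matrix_inv_cancel[OF i] hinv flip: matrix_mul_assoc)
    also have "\<phi> z ** E z ** ht (\<phi> z) = B z + ht (B z)"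
      using \<phi>E\<phi>[OF z] D[OF z] by (simp add: D_def)
    also have "matrix_inv (\<phi> z) ** (B z + ht (B z)) ** ht (matrix_inv (\<phi> z)) = Y z + ht (Y z)"
      unfolding Yz B_def
      by (simp add: matrix_mult_ring matrix_inv_cancel[OF i] hinv flip: matrix_mul_assoc)
    finally show ?thesis .
  qed
  have cE: "continuous_on (sphere 0 1) E"
    unfolding E_def[abs_def] by (intro continuous_intros disc_algebra_continuous[OF d\<phi>(3)]) auto
  have cY: "continuous_on (sphere 0 1) Y"
    unfolding Y_def[abs_def] by (intro continuous_intros disc_algebra_continuous[OF dinv] disc_algebra_continuous[OF dT])
  \<comment> \<open>Y starts at frequency n + 1 and E at -n, so E Y is analytic and zero at
    0.\<close>
  have mEY: "circle_mean (\<lambda>z. trace (E z ** Y z)) = 0"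
  proof -
    have "E z ** Y z = PE z ** T z ** matrix_inv (\<phi>' z)" if "norm z = 1" for z
      using unit_circle(1)[OF that] by (simp add: E_def Y_def power_int_minus matrix_mul_assoc)
    then have "circle_mean (\<lambda>z. trace (E z ** Y z)) = circle_mean (\<lambda>z. trace (PE z ** T z ** matrix_inv (\<phi>' z)))" by simp
    also have "\<dots> = 0"
      using mean_trace_disc_algebra[OF disc_algebra_mult[OF disc_algebra_mult[OF d\<phi>(3) dT] dinv]]
      by (simp add: T0 trace_def)
    finally show ?thesis .
  qed
  have "trace (E z ** ht (E z)) = trace (E z ** Y z) + cnj (trace (E z ** Y z))" if z: "norm z = 1" for z
  proof -
    have "E z ** ht (E z) = E z ** Y z + E z ** ht (Y z)"
      using Eh[OF z] EY[OF z] by (metis matrix_mult_ring(1))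
    moreover have "E z ** ht (Y z) = ht (Y z ** E z)" by (simp add: Eh[OF z])
    ultimately show ?thesis by (simp only: trace_add trace_ht trace_mul_sym[of "Y z"])
  qed
  then have "circle_mean (\<lambda>z. trace (E z ** ht (E z))) = circle_mean (\<lambda>z. trace (E z ** Y z) + cnj (trace (E z ** Y z)))" by simp
  also have "\<dots> = circle_mean (\<lambda>z. trace (E z ** Y z)) + circle_mean (\<lambda>z. cnj (trace (E z ** Y z)))"
    by (intro Bochner_Integration.integral_add integrable_circle_continuous continuous_intros cE cY)
  also have "\<dots> = 0" using mEY by simp
  finally have "E z = 0" if "norm z = 1" for z
    using mean_norm_zero[OF cE] that by blast
  then have "PE z = 0" if "norm z = 1" for z
  proof -
    have "PE z = z ^ n *\<^sub>C E z" using unit_circle(1)[OF that] by (simp add: E_def power_int_minus)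
    then show ?thesis using \<open>norm z = 1 \<Longrightarrow> E z = 0\<close> that by simp
  qed
  then have "a (nat (int n - j)) = 0"
    unfolding PE_def by (rule mpoly_circle_zero) (use j in auto)
  moreover have "j \<le> int n" using j by simp
  ultimately show ?thesis by (simp add: a_def)
qed

text \<open>The inverse of phi^* phi wherever phi is invertible, written as X X^* to make
  semidefiniteness evident.\<close>

definition bs_weight :: "nat \<Rightarrow> (nat \<Rightarrow> complex^'n^'n) \<Rightarrow> complex \<Rightarrow> complex^'n^'n" where
  "bs_weight n L z = matrix_inv (mpoly n L z) ** ht (matrix_inv (mpoly n L z))"

context matrix_weight
begin

context
  fixes n L assumes L: "left_orthopoly moment n L"
begin

lemma continuous_on_inv_mpoly: "continuous_on (sphere 0 1) (\<lambda>z. matrix_inv (mpoly n L z))"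
  by (intro continuous_on_matrix_inv continuous_on_mpoly orthopoly_invertible[OF L]) simp

lemma continuous_on_bs_weight: "continuous_on (sphere 0 1) (bs_weight n L)"
  unfolding bs_weight_def[abs_def] by (intro continuous_intros continuous_on_inv_mpoly)

lemma matrix_weight_bs: "matrix_weight circle_lebesgue (\<lambda>\<theta>. bs_weight n L (cis \<theta>))"
proof
  show "integrable circle_lebesgue (\<lambda>\<theta>. bs_weight n L (cis \<theta>))"
    by (rule integrable_circle_continuous[OF continuous_on_bs_weight])
qed (simp_all add: bs_weight_def pos_semidef_mult_ht)

text \<open>phi times its weight is the inverse adjoint, so pairing with z^j leaves z^{n-j} times
  the inverse of the reversed polynomial. This is analytic, and its value at 0 is zero unless j =
  n.\<close>

lemma bs_orthopoly: "left_orthopoly (matrix_moment circle_lebesgue (\<lambda>\<theta>. bs_weight n L (cis \<theta>))) n L"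
proof -
  interpret W: matrix_weight circle_lebesgue "\<lambda>\<theta>. bs_weight n L (cis \<theta>)" by (rule matrix_weight_bs)
  have "(\<Sum>k\<le>n. L k ** W.moment (int k - int j)) = (if j = n then matrix_inv (ht (L n)) else 0)" if j: "j \<le> n" for j
  proof -
    have d: "disc_algebra (\<lambda>z. z ^ (n - j) *\<^sub>C matrix_inv (reversed n L z))"
      by (intro disc_algebra_intros disc_algebra_matrix_inv disc_algebra_reversed
          reversed_invertible[OF orthopoly_lead[OF L] orthopoly_invertible[OF L]])
    have eq: "mpoly n L z ** bs_weight n L z ** ht (z ^ j *\<^sub>C mat 1) = z ^ (n - j) *\<^sub>C matrix_inv (reversed n L z)"
      if z: "norm z = 1" for z
    proof -
      have i: "invertible (mpoly n L z)" using orthopoly_invertible[OF L, of z] z by simp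
      have "cnj z ^ j * z ^ n = z ^ (n - j) * (cnj z * z) ^ j"
        using j by (simp add: power_mult_distrib mult.left_commute flip: power_add)
      then have "cnj z ^ j * z ^ n = z ^ (n - j)" by (simp add: unit_circle(4)[OF z])
      then show ?thesis
        by (simp add: bs_weight_def matrix_inv_cancel[OF i] matrix_mul_assoc ht_inv_circle[OF z i] matrix_inv_works[OF i])
    qed
    have "(\<Sum>k\<le>n. L k ** W.moment (int k - int j)) = W.ip (mpoly n L) (\<lambda>z. z ^ j *\<^sub>C mat 1)"
      by (simp add: W.ip_mpoly_monomial)
    also have "\<dots> = circle_mean (\<lambda>z. z ^ (n - j) *\<^sub>C matrix_inv (reversed n L z))"
      unfolding W.ip_def by (simp only: eq norm_cis)
    also have "\<dots> = (if j = n then matrix_inv (ht (L n)) else 0)"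
      unfolding mean_disc_algebra[OF d] using j by (auto simp: power_0_left)
    finally show ?thesis .
  qed
  then show ?thesis using orthopoly_lead[OF L] by (simp add: left_orthopoly_def)
qed

text \<open>Both moment sequences solve the equations of \<open>left_orthopoly\<close> with the same
  L, so their difference solves the homogeneous ones.\<close>

theorem bs_moments:
  assumes "\<bar>j\<bar> \<le> int n"
  shows "matrix_moment circle_lebesgue (\<lambda>\<theta>. bs_weight n L (cis \<theta>)) j = moment j"
proof -
  interpret W: matrix_weight circle_lebesgue "\<lambda>\<theta>. bs_weight n L (cis \<theta>)" by (rule matrix_weight_bs)
  have "W.moment j - moment j = 0"
  proof (rule toeplitz_unique[where L = L and n = n and e = "\<lambda>j. W.moment j - moment j"])
    show "(\<Sum>k\<le>n. L k ** (W.moment (int k - int j) - moment (int k - int j))) = 0" if "j \<le> n" for j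
      using L bs_orthopoly that by (simp add: left_orthopoly_def matrix_mult_ring sum_subtractf)
  qed (use assms in \<open>auto simp: ht_moment W.ht_moment orthopoly_lead[OF L] orthopoly_invertible[OF L]\<close>)
  then show ?thesis by simp
qed

end

lemma ip_mpoly_mpoly:
  "ip (mpoly n a) (mpoly m b) = (\<Sum>l\<le>m. \<Sum>k\<le>n. a k ** moment (int k - int l) ** ht (b l))"
  unfolding ip_mpoly_right[OF continuous_on_mpoly] ip_mpoly_monomial matrix_mult_sum ..

text \<open>Products of polynomials of degree at most n only involve moments of order at most
  n.\<close>

lemma ip_bs_eq:
  assumes W: "matrix_weight \<sigma> V" and m: "\<And>j. \<bar>j\<bar> \<le> int n \<Longrightarrow> matrix_moment \<sigma> V j = moment j"
  shows "matrix_weight.ip \<sigma> V (mpoly n a) (mpoly n b) = ip (mpoly n a) (mpoly n b)"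
  unfolding matrix_weight.ip_mpoly_mpoly[OF W] ip_mpoly_mpoly
  by (intro sum.cong refl) (simp add: m)

text \<open>Transposition reverses all products and keeps semidefiniteness, so results on left
  polynomials carry over to right ones.\<close>

lemma transposed: "matrix_weight \<tau> (\<lambda>\<theta>. transpose (R \<theta>))"
  using sets_weight integral_transpose(1)[OF integrable_weight] pos_semidef_transpose[OF psd]
  by unfold_locales auto

lemma transposed_moment: "matrix_moment \<tau> (\<lambda>\<theta>. transpose (R \<theta>)) j = transpose (moment j)"
proof -
  have "cis \<theta> powi j *\<^sub>C transpose (R \<theta>) = transpose (cis \<theta> powi j *\<^sub>C R \<theta>)" for \<theta>
    by (rule matrix_eqI) (simp add: transpose_def)
  then show ?thesis by (simp add: matrix_moment_def integral_transpose(2)[OF integrable_moment])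
qed

end

definition right_orthopoly :: "(int \<Rightarrow> complex^'n^'n) \<Rightarrow> nat \<Rightarrow> (nat \<Rightarrow> complex^'n^'n) \<Rightarrow> bool" where
  "right_orthopoly c n K \<longleftrightarrow> invertible (K n) \<and>
     (\<forall>j\<le>n. (\<Sum>k\<le>n. c (int k - int j) ** K k) = (if j = n then matrix_inv (ht (K n)) else 0))"

lemma transpose_mult: "transpose (A ** B) = transpose B ** transpose (A :: complex^'n^'n)"
  by (rule matrix_transpose_mul)

lemma transpose_sum: "transpose (\<Sum>k\<in>S. f k) = (\<Sum>k\<in>S. transpose (f k :: complex^'n^'n))"
  by (rule matrix_eqI) (simp add: transpose_def sum_component)

lemma invertible_transpose:
  fixes A :: "complex^'n^'n"
  assumes "invertible A"
  shows "invertible (transpose A)" "matrix_inv (transpose A) = transpose (matrix_inv A)"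
proof -
  have "transpose A ** transpose (matrix_inv A) = mat 1"
    using matrix_inv_works(2)[OF assms] by (metis transpose_mult transpose_mat)
  then show "invertible (transpose A)" "matrix_inv (transpose A) = transpose (matrix_inv A)"
    using matrix_inv_unique by blast+
qed

lemma transpose_mpoly: "transpose (mpoly n a z) = mpoly n (\<lambda>k. transpose (a k)) z"
  unfolding mpoly_def transpose_sum by (intro sum.cong refl matrix_eqI) (simp add: transpose_def)

lemma right_orthopoly_transpose_iff:
  fixes c :: "int \<Rightarrow> complex^'n^'n"
  shows "right_orthopoly c n K \<longleftrightarrow> left_orthopoly (\<lambda>j. transpose (c j)) n (\<lambda>k. transpose (K k))"
proof (cases "invertible (K n)")
  case True
  have s: "(\<Sum>k\<le>n. transpose (K k) ** transpose (c (int k - int j))) = transpose (\<Sum>k\<le>n. c (int k - int j) ** K k)" for j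
    by (simp add: transpose_sum transpose_mult)
  have l: "matrix_inv (ht (transpose (K n))) = transpose (matrix_inv (ht (K n)))"
    using invertible_transpose[OF invertible_ht(1)[OF True]] by (simp add: transpose_ht)
  have z: "transpose (0 :: complex^'n^'n) = 0" by (rule matrix_eqI) (simp add: transpose_def)
  have "transpose X = (if j = n then transpose (matrix_inv (ht (K n))) else 0) \<longleftrightarrow> X = (if j = n then matrix_inv (ht (K n)) else 0)"
    for X :: "complex^'n^'n" and j
    using transpose_iff[of X] z by (metis (full_types))
  then show ?thesis
    using True invertible_transpose(1)[OF True] unfolding left_orthopoly_def right_orthopoly_def s l by simp
next
  case False
  then have "\<not> invertible (transpose (K n))" using invertible_transpose(1) transpose_transpose by metis
  then show ?thesis using False by (simp add: left_orthopoly_def right_orthopoly_def)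
qed

section \<open>Left and right orthonormal polynomials\<close>

context matrix_weight
begin

lemma transposed_right:
  assumes "right_orthopoly moment n K"
  shows "left_orthopoly (matrix_moment \<tau> (\<lambda>\<theta>. transpose (R \<theta>))) n (\<lambda>k. transpose (K k))"
  using assms by (simp add: right_orthopoly_transpose_iff left_orthopoly_def transposed_moment)

lemma right_orthopoly_invertible:
  assumes K: "right_orthopoly moment n K" and z: "norm z \<ge> 1"
  shows "invertible (mpoly n K z)"
proof -
  interpret T: matrix_weight \<tau> "\<lambda>\<theta>. transpose (R \<theta>)" by (rule transposed)
  have "invertible (transpose (mpoly n K z))"
    unfolding transpose_mpoly by (rule T.orthopoly_invertible[OF transposed_right[OF K] z])
  then show ?thesis using invertible_transpose(1) by (metis transpose_transpose)
qed

text \<open>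
  Both Bernstein--Szego weights have the moments of the given weight up to order \<open>n\<close>, so the mean of
  \<open>|X|\<^sup>2\<close> and that of \<open>|X\<^sup>-\<^sup>1|\<^sup>2\<close> both equal the dimension; hence \<open>|X - X\<^sup>-\<^sup>*|\<^sup>2\<close> has mean zero.
\<close>

theorem left_right_unitary:
  assumes L: "left_orthopoly moment n L" and K: "right_orthopoly moment n K" and z: "norm z = 1"
  defines "X \<equiv> \<lambda>z. mpoly n L z ** ht (matrix_inv (mpoly n K z))"
  shows "X z ** ht (X z) = mat 1" "ht (matrix_inv (mpoly n L z)) ** mpoly n K z = X z"
proof -
  let ?KT = "\<lambda>k. transpose (K k)" and ?p = "complex_of_real (real CARD('n))"
  interpret T: matrix_weight \<tau> "\<lambda>\<theta>. transpose (R \<theta>)" by (rule transposed)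
  note KT = transposed_right[OF K]
  interpret W: matrix_weight circle_lebesgue "\<lambda>\<theta>. bs_weight n L (cis \<theta>)" by (rule matrix_weight_bs[OF L])
  interpret V: matrix_weight circle_lebesgue "\<lambda>\<theta>. bs_weight n ?KT (cis \<theta>)" by (rule T.matrix_weight_bs[OF KT])
  note WT = W.transposed and VT = V.transposed
  have iL: "invertible (mpoly n L z)" and iK: "invertible (mpoly n K z)" if "norm z = 1" for z
    using orthopoly_invertible[OF L, of z] right_orthopoly_invertible[OF K, of z] that by auto
  define Y where "Y z = ht (matrix_inv (mpoly n L z)) ** mpoly n K z" for z
  have cK: "continuous_on (sphere 0 1) (\<lambda>z. matrix_inv (mpoly n K z))"
    by (intro continuous_on_matrix_inv continuous_on_mpoly iK) simp
  have cX: "continuous_on (sphere 0 1) X" unfolding X_def by (intro continuous_intros continuous_on_mpoly cK)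
  have cY: "continuous_on (sphere 0 1) Y"
    unfolding Y_def[abs_def] by (intro continuous_intros continuous_on_mpoly continuous_on_inv_mpoly[OF L])
  have XY: "X z ** ht (Y z) = mat 1" if "norm z = 1" for z
    unfolding X_def Y_def
    by (simp add: matrix_inv_cancel[OF iK[OF that]] matrix_inv_works[OF iL[OF that]]
        invertible_ht(2)[OF iK[OF that], symmetric] matrix_inv_cancel[OF invertible_ht(1)[OF iK[OF that]]] flip: matrix_mul_assoc)
  have X2: "circle_mean (\<lambda>z. trace (X z ** ht (X z))) = ?p"
  proof -
    have Vm: "matrix_moment circle_lebesgue (\<lambda>\<theta>. transpose (bs_weight n ?KT (cis \<theta>))) j = moment j" if "\<bar>j\<bar> \<le> int n" for j
      unfolding V.transposed_moment T.bs_moments[OF KT that] transposed_moment by simp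
    have bs: "transpose (bs_weight n ?KT z) = ht (matrix_inv (mpoly n K z)) ** matrix_inv (mpoly n K z)" if "norm z = 1" for z
      unfolding bs_weight_def transpose_mpoly[symmetric] invertible_transpose(2)[OF iK[OF that]] transpose_mult transpose_ht by simp
    \<comment> \<open>\<open>X X^*\<close> is phi^L weighted by the right Bernstein--Szego weight,
      which shares all moments that phi^L can see; so its mean is the identity.\<close>
    have "mat 1 = matrix_weight.ip circle_lebesgue (\<lambda>\<theta>. transpose (bs_weight n ?KT (cis \<theta>))) (mpoly n L) (mpoly n L)"
      unfolding orthopoly_norm[OF L, symmetric] by (rule ip_bs_eq[OF VT Vm, symmetric])
    also have "\<dots> = circle_mean (\<lambda>z. X z ** ht (X z))"
      unfolding matrix_weight.ip_def[OF VT] by (simp add: bs X_def matrix_mul_assoc)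
    finally have *: "circle_mean (\<lambda>z. X z ** ht (X z)) = mat 1" by (rule sym)
    have "continuous_on (sphere 0 1) (\<lambda>z. X z ** ht (X z))" by (intro continuous_intros cX)
    then show ?thesis
      using circle_mean_trace[of "\<lambda>z. X z ** ht (X z)"] by (simp add: * trace_I)
  qed
  have Y2: "circle_mean (\<lambda>z. trace (Y z ** ht (Y z))) = ?p"
  proof -
    have Wm: "matrix_moment circle_lebesgue (\<lambda>\<theta>. transpose (bs_weight n L (cis \<theta>))) j = T.moment j" if "\<bar>j\<bar> \<le> int n" for j
      unfolding W.transposed_moment bs_moments[OF L that] transposed_moment ..
    have "mat 1 = matrix_weight.ip circle_lebesgue (\<lambda>\<theta>. transpose (bs_weight n L (cis \<theta>))) (mpoly n ?KT) (mpoly n ?KT)"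
      unfolding T.orthopoly_norm[OF KT, symmetric] by (rule T.ip_bs_eq[OF WT Wm, symmetric])
    also have "\<dots> = circle_mean (\<lambda>z. transpose (ht (Y z) ** Y z))"
      unfolding matrix_weight.ip_def[OF WT]
      by (simp add: bs_weight_def Y_def transpose_mult transpose_mpoly matrix_mul_assoc transpose_ht)
    finally have *: "circle_mean (\<lambda>z. transpose (ht (Y z) ** Y z)) = mat 1" ..
    have "trace (Y z ** ht (Y z)) = trace (transpose (ht (Y z) ** Y z))" for z
      by (simp add: trace_mul_sym[of "Y z"]) (simp add: trace_def transpose_def)
    moreover have "continuous_on (sphere 0 1) (\<lambda>z. transpose (ht (Y z) ** Y z))"
      by (subst continuous_on_matrix_iff) (auto simp: transpose_def intro!: continuous_on_entry continuous_intros cY)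
    ultimately show ?thesis
      using circle_mean_trace[of "\<lambda>z. transpose (ht (Y z) ** Y z)"] by (simp add: * trace_I)
  qed
  \<comment> \<open>Y is the inverse adjoint of X, so each of the two mixed terms of the square is
    the identity and contributes -p.\<close>
  have eq: "trace ((X z - Y z) ** ht (X z - Y z)) = trace (X z ** ht (X z)) + trace (Y z ** ht (Y z)) - 2 * ?p"
    if z: "norm z = 1" for z
  proof -
    have "ht (X z ** ht (Y z)) = mat 1" by (simp only: XY[OF z] ht_mat_1)
    then have "Y z ** ht (X z) = mat 1" by simp
    then have *: "Y z ** ht (X z) = mat 1" by simp
    show ?thesis
      by (simp only: ht_simps matrix_mult_ring trace_add trace_sub XY[OF z] * trace_I) simp
  qed
  have int: "integrable circle_lebesgue (\<lambda>\<theta>. trace (X (cis \<theta>) ** ht (X (cis \<theta>))))"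
    "integrable circle_lebesgue (\<lambda>\<theta>. trace (Y (cis \<theta>) ** ht (Y (cis \<theta>))))"
    by (rule integrable_circle_continuous, intro continuous_intros cX cY)+
  have "circle_mean (\<lambda>z. trace ((X z - Y z) ** ht (X z - Y z))) = ?p + ?p - 2 * ?p"
    unfolding eq[OF norm_cis] using int by (simp add: X2 Y2)
  then have "X z - Y z = 0"
    using mean_norm_zero[of "\<lambda>z. X z - Y z", OF _ _ z] cX cY by (simp add: continuous_on_diff)
  then show "ht (matrix_inv (mpoly n L z)) ** mpoly n K z = X z" "X z ** ht (X z) = mat 1"
    using XY[OF z] by (auto simp: Y_def)
qed

text \<open>After reindexing, pairing z^l with the reversed polynomial is equation n - l of
  \<open>right_orthopoly\<close>; only l = 0 hits the inhomogeneous one.\<close>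

lemma ip_monomial_reversed:
  assumes K: "right_orthopoly moment n K" and l: "l \<le> n"
  shows "ip (\<lambda>z. z ^ l *\<^sub>C A) (reversed n K) = (if l = 0 then A ** matrix_inv (ht (K n)) else 0)"
proof -
  have "ip (\<lambda>z. z ^ l *\<^sub>C A) (reversed n K) = (\<Sum>k\<le>n. A ** moment (int l - int k) ** K (n - k))"
    unfolding reversed_def[abs_def]
    by (subst ip_mpoly_right) (intro continuous_intros, simp add: ip_monomial)
  also have "\<dots> = (\<Sum>k\<le>n. A ** moment (int k - int (n - l)) ** K k)"
    by (rule sum.reindex_bij_witness[where i="\<lambda>k. n - k" and j="\<lambda>k. n - k"])
      (use l in \<open>auto simp: of_nat_diff algebra_simps\<close>)
  also have "\<dots> = A ** (\<Sum>k\<le>n. moment (int k - int (n - l)) ** K k)"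
    by (simp add: matrix_mult_sum matrix_mul_assoc)
  also have "(\<Sum>k\<le>n. moment (int k - int (n - l)) ** K k) = (if n - l = n then matrix_inv (ht (K n)) else 0)"
    using K unfolding right_orthopoly_def by (meson diff_le_self)
  finally show ?thesis using l by auto
qed

lemma ip_mpoly_reversed:
  assumes K: "right_orthopoly moment n K"
  shows "ip (mpoly n a) (reversed n K) = a 0 ** matrix_inv (ht (K n))"
proof -
  have "ip (mpoly n a) (reversed n K) = (\<Sum>l\<le>n. ip (\<lambda>z. z ^ l *\<^sub>C a l) (reversed n K))"
    unfolding mpoly_def[abs_def] by (intro ip_sum_left continuous_intros continuous_on_reversed)
  also have "\<dots> = (\<Sum>l\<le>n. if l = 0 then a l ** matrix_inv (ht (K n)) else 0)"
    by (intro sum.cong refl) (simp add: ip_monomial_reversed[OF K])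
  finally show ?thesis by simp
qed

text \<open>Both sides evaluate \<open>ip\<close> of phi^L and the reversed phi^R: one by
  orthogonality of phi^L, the other by that of phi^R.\<close>

lemma reflection_eq:
  assumes L: "left_orthopoly moment n L" and K: "right_orthopoly moment n K"
  shows "matrix_inv (ht (L n)) ** K 0 = L 0 ** matrix_inv (ht (K n))"
proof -
  have "ip (mpoly n L) (reversed n K) = matrix_inv (ht (L n)) ** K 0"
    unfolding reversed_def[abs_def] by (subst orthopoly_mpoly[OF L]) auto
  then show ?thesis using ip_mpoly_reversed[OF K] by simp
qed

section \<open>The Szego recurrence and the size of the reflection coefficients\<close>

lemma mpoly_diff: "mpoly m a z - mpoly m b z = mpoly m (\<lambda>k. a k - b k) z"
  by (simp add: mpoly_def cscale_distribs sum_subtractf)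

text \<open>The coefficient A of the recurrence, chosen to match the leading terms of z phi_n and A
  phi_{n+1}.\<close>

definition shift_ratio :: "nat \<Rightarrow> (nat \<Rightarrow> complex^'n^'n) \<Rightarrow> (nat \<Rightarrow> complex^'n^'n) \<Rightarrow> complex^'n^'n" where
  "shift_ratio n L L' = L n ** matrix_inv (L' (Suc n))"

context
  fixes n L L'
  assumes L: "left_orthopoly moment n L" and L': "left_orthopoly moment (Suc n) L'"
begin

text \<open>The term of the recurrence that involves the reversed phi^R; its degree is at most n
  because the leading terms cancel.\<close>

definition remainder :: "complex \<Rightarrow> complex^'n^'n" where
  "remainder z = z *\<^sub>C mpoly n L z - shift_ratio n L L' ** mpoly (Suc n) L' z"

lemma shift_mpoly: "z *\<^sub>C mpoly n L z = mpoly (Suc n) (\<lambda>k. if k = 0 then 0 else L (k - 1)) z"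
  by (simp add: mpoly_def cscale_sum sum.atMost_Suc_shift del: sum.atMost_Suc)

lemma remainder_mpoly:
  "remainder z = mpoly n (\<lambda>k. (if k = 0 then 0 else L (k - 1)) - shift_ratio n L L' ** L' k) z"
    (is "_ = mpoly n ?q z")
proof -
  have "shift_ratio n L L' ** L' (Suc n) = L n"
    unfolding shift_ratio_def by (rule matrix_inv_cancel(4)[OF orthopoly_lead[OF L']])
  then have "?q (Suc n) = 0" by simp
  then have "mpoly (Suc n) ?q z = mpoly n ?q z"
    unfolding mpoly_def sum.atMost_Suc by (simp only: cscale_simps add_0_right)
  then show ?thesis
    unfolding remainder_def shift_mpoly mpoly_cmult mpoly_diff .
qed

lemma continuous_remainder: "continuous_on S remainder"
  unfolding remainder_def[abs_def] by (intro continuous_intros continuous_on_mpoly)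

lemma continuous_shift: "continuous_on S (\<lambda>z. z *\<^sub>C mpoly n L z)"
  by (intro continuous_intros continuous_on_mpoly)

text \<open>Pythagoras: A is also the product of z phi_n with phi_{n+1}, so the remainder is z phi_n
  minus its projection.\<close>

lemma ip_remainder: "ip remainder remainder = mat 1 - shift_ratio n L L' ** ht (shift_ratio n L L')"
proof -
  let ?A = "shift_ratio n L L'"
  let ?Z = "\<lambda>z. z *\<^sub>C mpoly n L z" and ?F = "mpoly (Suc n) L'"
  have FZ: "ip ?F ?Z = ht ?A"
    unfolding shift_mpoly orthopoly_mpoly[OF L' order_refl] shift_ratio_def
    by (simp add: invertible_ht(2)[OF orthopoly_lead[OF L']])
  then have ZF: "ip ?Z ?F = ?A" using ht_ip[OF continuous_on_mpoly continuous_shift, of "Suc n" L'] by simp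
  have ZZ: "ip ?Z ?Z = mat 1" unfolding ip_shift orthopoly_norm[OF L] ..
  have cAF: "continuous_on S (\<lambda>z. ?A ** ?F z)" for S by (intro continuous_intros continuous_on_mpoly)
  have cZA: "continuous_on S (\<lambda>z. ?Z z - ?A ** ?F z)" for S by (intro continuous_intros continuous_on_mpoly)
  show ?thesis
    unfolding remainder_def[abs_def]
    by (simp add: ip_add_left ip_add_right cAF cZA continuous_shift ip_cmult_left ip_cmult_right continuous_on_mpoly
        ZZ ZF FZ orthopoly_norm[OF L'] matrix_mul_assoc)
qed

text \<open>The Gram matrix of the remainder has nonnegative trace, which bounds A uniformly in
  n.\<close>

lemma norm_shift_ratio: "(norm (shift_ratio n L L'))\<^sup>2 \<le> real CARD('n)"
proof -
  let ?A = "shift_ratio n L L'"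
  have "0 \<le> (\<Sum>i\<in>UNIV. Re (ip remainder remainder $ i $ i))"
    by (intro sum_nonneg ip_diag_nonneg continuous_remainder)
  also have "\<dots> = Re (trace (mat 1 - ?A ** ht ?A))" by (simp add: ip_remainder trace_def)
  also have "\<dots> = real CARD('n) - (norm ?A)\<^sup>2"
    by (simp add: trace_sub trace_I norm_matrix_trace[symmetric] flip: of_real_power)
  finally show ?thesis by simp
qed

text \<open>The difference D between the remainder and G times the reversed phi^R has no constant
  term and is orthogonal to z, ..., z^n, hence to itself. It therefore drops out of the Gram matrix
  of the remainder.\<close>

lemma shift_relations:
  assumes K: "right_orthopoly moment n K"
  defines "G \<equiv> ip (\<lambda>z. z *\<^sub>C mpoly n L z) (reversed n K)"
  shows "G = - (shift_ratio n L L' ** L' 0 ** matrix_inv (ht (K n)))"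
    and "shift_ratio n L L' ** ht (shift_ratio n L L') = mat 1 - G ** ht G"
proof -
  let ?A = "shift_ratio n L L'" and ?r = "reversed n K"
  have iK: "invertible (K n)" using K by (simp add: right_orthopoly_def)
  have cA: "continuous_on S (\<lambda>z. ?A ** mpoly (Suc n) L' z)" for S by (intro continuous_intros continuous_on_mpoly)
  have "ip (mpoly (Suc n) L') ?r = 0"
    unfolding reversed_def[abs_def] by (subst orthopoly_mpoly[OF L']) auto
  then have "ip remainder ?r = G"
    unfolding remainder_def[abs_def] G_def
    by (simp add: ip_add_left continuous_shift cA continuous_on_reversed ip_cmult_left continuous_on_mpoly)
  then show G: "G = - (?A ** L' 0 ** matrix_inv (ht (K n)))"
    unfolding remainder_mpoly ip_mpoly_reversed[OF K] by (simp add: matrix_mult_ring)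
  define D where "D z = remainder z - G ** ?r z" for z
  define d where "d k = (if k = 0 then 0 else L (k - 1)) - ?A ** L' k - G ** ht (K (n - k))" for k
  have cr: "continuous_on S ?r" "continuous_on S (\<lambda>z. G ** ?r z)" for S
    by (intro continuous_intros continuous_on_reversed)+
  have D: "D = mpoly n d"
    unfolding D_def[abs_def] remainder_mpoly reversed_def mpoly_cmult d_def
    by (simp only: mpoly_diff)
  have "G ** ht (K n) = - (?A ** L' 0)"
    unfolding G using matrix_inv_cancel(4)[OF invertible_ht(1)[OF iK]] by (simp add: matrix_mult_ring)
  \<comment> \<open>G is precisely the factor that removes the constant term.\<close>
  then have d0: "d 0 = 0" by (simp add: d_def)
  have cD: "continuous_on S D" for S unfolding D by (rule continuous_on_mpoly)
  have rl: "ip ?r (\<lambda>z. z ^ l *\<^sub>C B) = 0" if "1 \<le> l" "l \<le> n" for l B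
  proof -
    have "continuous_on (sphere 0 1) (\<lambda>z. z ^ l *\<^sub>C B)" by (intro continuous_intros)
    then have "ip ?r (\<lambda>z. z ^ l *\<^sub>C B) = ht (ip (\<lambda>z. z ^ l *\<^sub>C B) ?r)" by (rule ht_ip[symmetric]) (rule cr)
    then show ?thesis using that by (simp add: ip_monomial_reversed[OF K])
  qed
  have zero: "ip P (\<lambda>z. 0) = 0" for P by (simp add: ip_def)
  have rD: "ip ?r D = 0"
    unfolding D ip_mpoly_right[OF cr(1)]
  proof (intro sum.neutral ballI)
    fix l assume "l \<in> {..n}"
    then show "ip ?r (\<lambda>z. z ^ l *\<^sub>C d l) = 0"
      by (cases "l = 0") (simp_all add: d0 rl zero)
  qed
  have Dl: "ip D (\<lambda>z. z ^ l *\<^sub>C B) = 0" if l: "1 \<le> l" "l \<le> n" for l B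
  proof -
    have cB: "continuous_on S (\<lambda>z. z ^ l *\<^sub>C B)" for S by (intro continuous_intros)
    have "(\<lambda>z. z ^ l *\<^sub>C B) = (\<lambda>z. z *\<^sub>C z ^ (l - 1) *\<^sub>C B)"
      using l by (auto simp: fun_eq_iff power_eq_if)
    then have "ip (\<lambda>z. z *\<^sub>C mpoly n L z) (\<lambda>z. z ^ l *\<^sub>C B) = ip (mpoly n L) (\<lambda>z. z ^ (l - 1) *\<^sub>C B)"
      using ip_shift[of "mpoly n L" "\<lambda>z. z ^ (l - 1) *\<^sub>C B"] by simp
    then have 1: "ip (\<lambda>z. z *\<^sub>C mpoly n L z) (\<lambda>z. z ^ l *\<^sub>C B) = 0"
      using l by (simp add: orthopoly_monomial[OF L])
    have 2: "ip (mpoly (Suc n) L') (\<lambda>z. z ^ l *\<^sub>C B) = 0"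
      using l by (simp add: orthopoly_monomial[OF L'])
    show ?thesis
      unfolding D_def[abs_def]
      by (simp add: ip_add_left continuous_remainder cr cB ip_cmult_left rl[OF l])
        (simp add: remainder_def[abs_def] ip_add_left continuous_shift cA cB ip_cmult_left continuous_on_mpoly 1 2)
  qed
  have "ip D (mpoly n d) = 0"
    unfolding ip_mpoly_right[OF cD]
  proof (intro sum.neutral ballI)
    fix l assume "l \<in> {..n}"
    then show "ip D (\<lambda>z. z ^ l *\<^sub>C d l) = 0"
      by (cases "l = 0") (simp_all add: d0 Dl zero)
  qed
  then have DD: "ip D D = 0" by (simp only: D)
  have rr: "ip ?r ?r = mat 1"
  proof -
    have "ip ?r ?r = ip (mpoly n (\<lambda>k. ht (K (n - k)))) ?r" by (simp add: reversed_def[abs_def])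
    also have "\<dots> = ht (K n) ** matrix_inv (ht (K n))" by (simp add: ip_mpoly_reversed[OF K])
    finally show ?thesis using matrix_inv_works(1)[OF invertible_ht(1)[OF iK]] by simp
  qed
  have "ip D ?r = 0" using ht_ip[OF cr(1) cD] rD by simp
  moreover have "remainder = (\<lambda>z. G ** ?r z + D z)" by (simp add: D_def)
  moreover have "continuous_on S (\<lambda>z. G ** ?r z + D z)" for S by (intro continuous_intros cr cD)
  ultimately have "ip remainder remainder = G ** ht G"
    by (simp add: ip_add_left ip_add_right cr cD ip_cmult_left ip_cmult_right rD DD rr)
  then show "?A ** ht ?A = mat 1 - G ** ht G"
    using ip_remainder by (simp add: algebra_simps)
qed

end

text \<open>The recurrence and the symmetry \<open>reflection_eq\<close> give A H = - G B^*, with B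
  the ratio for the right polynomials. A is not inverted: A^* A is within 1/2 of the identity, so H
  = A^* A H + (1 - A^* A) H absorbs half of |H|, which is where the factor 2 comes from.\<close>

theorem reflection_bound:
  assumes L: "left_orthopoly moment n L" and L': "left_orthopoly moment (Suc n) L'"
    and K: "right_orthopoly moment n K" and K': "right_orthopoly moment (Suc n) K'"
  defines "G \<equiv> ip (\<lambda>z. z *\<^sub>C mpoly n L z) (reversed n K)"
    and "H \<equiv> matrix_inv (ht (L' (Suc n))) ** K' 0"
  assumes small: "(norm G)\<^sup>2 \<le> 1 / 2"
  shows "norm H \<le> 2 * real CARD('n) * norm G"
proof -
  let ?A = "shift_ratio n L L'" and ?KT = "\<lambda>k. transpose (K k)" and ?KT' = "\<lambda>k. transpose (K' k)"
  interpret T: matrix_weight \<tau> "\<lambda>\<theta>. transpose (R \<theta>)" by (rule transposed)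
  have iK: "invertible (K n)" "invertible (K' (Suc n))" using K K' by (simp_all add: right_orthopoly_def)
  \<comment> \<open>The transpose of B is the \<open>shift_ratio\<close> of the transposed weight
    and so obeys the same bound as A.\<close>
  define B where "B = matrix_inv (K' (Suc n)) ** K n"
  have "T.shift_ratio n ?KT ?KT' = transpose B"
    by (simp add: T.shift_ratio_def B_def transpose_mult invertible_transpose(2)[OF iK(2)])
  then have "(norm (transpose B))\<^sup>2 \<le> real CARD('n)"
    using T.norm_shift_ratio[OF transposed_right[OF K] transposed_right[OF K']] by simp
  moreover have "norm (transpose B) = norm B"
  proof -
    have "(norm (transpose B))\<^sup>2 = (norm B)\<^sup>2"
      unfolding norm_matrix_power2 by (subst sum.swap) (simp add: transpose_def)
    then show ?thesis by simp
  qed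
  ultimately have nB: "(norm B)\<^sup>2 \<le> real CARD('n)" by simp
  have nA: "(norm ?A)\<^sup>2 \<le> real CARD('n)" by (rule norm_shift_ratio[OF L L'])
  note rel = shift_relations[OF L L' K, folded G_def]
  have "?A ** H = ?A ** L' 0 ** matrix_inv (ht (K' (Suc n)))"
    unfolding H_def reflection_eq[OF L' K'] by (simp add: matrix_mul_assoc)
  also have "?A ** L' 0 = - G ** ht (K n)"
    unfolding rel(1) by (simp add: matrix_mult_ring matrix_inv_cancel(4)[OF invertible_ht(1)[OF iK(1)]])
  finally have AH: "?A ** H = - (G ** ht B)"
    by (simp add: B_def matrix_mult_ring invertible_ht(2)[OF iK(2)] matrix_mul_assoc)
  \<comment> \<open>A^* A and A A^* have equal traces of first and second powers, which determine
    the Frobenius distance to the identity.\<close>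
  have "norm (mat 1 - ht ?A ** ?A) = norm (mat 1 - ?A ** ht ?A)"
  proof -
    have tr: "complex_of_real ((norm (mat 1 - X ** ht X))\<^sup>2) = trace (mat 1 :: complex^'n^'n) - trace (X ** ht X) - (trace (X ** ht X) - trace (X ** ht X ** X ** ht X))"
      for X :: "complex^'n^'n"
      unfolding norm_matrix_trace
      by (simp only: ht_simps ht_mult ht_mat_1 matrix_mult_ring trace_sub matrix_mul_lid matrix_mul_rid matrix_mul_assoc)
    have t2: "trace (ht ?A ** ?A) = trace (?A ** ht ?A)" by (rule trace_mul_sym)
    have t3: "trace (ht ?A ** ?A ** ht ?A ** ?A) = trace (?A ** ht ?A ** ?A ** ht ?A)"
      using trace_mul_sym[of "ht ?A" "?A ** ht ?A ** ?A"] by (simp add: matrix_mul_assoc)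
    have "complex_of_real ((norm (mat 1 - ht ?A ** ?A))\<^sup>2) = complex_of_real ((norm (mat 1 - ?A ** ht ?A))\<^sup>2)"
      using tr[of ?A] tr[of "ht ?A"] t2 t3 by simp
    then have "(norm (mat 1 - ht ?A ** ?A))\<^sup>2 = (norm (mat 1 - ?A ** ht ?A))\<^sup>2" using of_real_eq_iff by blast
    then show ?thesis by simp
  qed
  also have "\<dots> = norm (G ** ht G)" by (simp add: rel(2))
  also have "\<dots> \<le> (norm G)\<^sup>2" using norm_matrix_mult[of G "ht G"] by (simp add: power2_eq_square)
  finally have nI: "norm (mat 1 - ht ?A ** ?A) \<le> 1 / 2" using small by simp
  have "H = ht ?A ** (?A ** H) + (mat 1 - ht ?A ** ?A) ** H"
    by (simp add: matrix_mult_ring matrix_mul_assoc)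
  then have "norm H \<le> norm (ht ?A ** (?A ** H)) + norm ((mat 1 - ht ?A ** ?A) ** H)"
    by (metis norm_triangle_ineq)
  also have "\<dots> \<le> norm ?A * (norm G * norm B) + 1 / 2 * norm H"
  proof (intro add_mono)
    have "norm (ht ?A ** (?A ** H)) \<le> norm ?A * norm (?A ** H)" using norm_matrix_mult[of "ht ?A"] by simp
    also have "\<dots> \<le> norm ?A * (norm G * norm B)"
      unfolding AH using norm_matrix_mult[of G "ht B"] by (intro mult_left_mono) simp_all
    finally show "norm (ht ?A ** (?A ** H)) \<le> norm ?A * (norm G * norm B)" .
    show "norm ((mat 1 - ht ?A ** ?A) ** H) \<le> 1 / 2 * norm H"
      by (rule order_trans[OF norm_matrix_mult mult_right_mono[OF nI]]) simp
  qed
  also have "norm ?A * (norm G * norm B) \<le> real CARD('n) * norm G"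
  proof -
    have "norm ?A * norm B \<le> ((norm ?A)\<^sup>2 + (norm B)\<^sup>2) / 2"
      using sum_squares_bound[of "norm ?A" "norm B"] by simp
    also have "\<dots> \<le> real CARD('n)" using nA nB by simp
    finally have "norm ?A * norm B * norm G \<le> real CARD('n) * norm G" by (rule mult_right_mono) simp
    then show ?thesis by (simp add: mult_ac)
  qed
  finally show ?thesis by simp
qed

end

section \<open>Weak convergence tested on compact sets\<close>

text \<open>Only values on the unit circle matter: at 0 the addition law of \<open>powi\<close>
  fails, which is why closure under products is stated for norm 1.\<close>

inductive trig_poly :: "(complex \<Rightarrow> complex) \<Rightarrow> bool" where
  monomial: "trig_poly (\<lambda>z. c * z powi j)"
| add: "trig_poly f \<Longrightarrow> trig_poly g \<Longrightarrow> trig_poly (\<lambda>z. f z + g z)"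

lemma trig_poly_mult_monomial:
  assumes "trig_poly f"
  shows "\<exists>h. trig_poly h \<and> (\<forall>z. norm z = 1 \<longrightarrow> h z = c * z powi j * f z)"
  using assms
proof induction
  case (monomial d i)
  have "c * d * z powi (j + i) = c * z powi j * (d * z powi i)" if "norm z = 1" for z
    using unit_circle(1)[OF that] by (simp add: power_int_add)
  then show ?case using trig_poly.monomial[of "c * d" "j + i"] by blast
next
  case (add f g)
  then obtain h1 h2 where "trig_poly h1" "trig_poly h2"
    "\<forall>z. norm z = 1 \<longrightarrow> h1 z = c * z powi j * f z" "\<forall>z. norm z = 1 \<longrightarrow> h2 z = c * z powi j * g z" by blast
  then show ?case
    by (intro exI[of _ "\<lambda>z. h1 z + h2 z"]) (auto intro: trig_poly.add simp: distrib_left)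
qed

lemma trig_poly_mult:
  assumes "trig_poly f" "trig_poly g"
  shows "\<exists>h. trig_poly h \<and> (\<forall>z. norm z = 1 \<longrightarrow> h z = f z * g z)"
  using assms(1)
proof induction
  case (monomial c j)
  then show ?case by (rule trig_poly_mult_monomial[OF assms(2)])
next
  case (add f1 f2)
  then obtain h1 h2 where "trig_poly h1" "trig_poly h2"
    "\<forall>z. norm z = 1 \<longrightarrow> h1 z = f1 z * g z" "\<forall>z. norm z = 1 \<longrightarrow> h2 z = f2 z * g z" by blast
  then show ?case
    by (intro exI[of _ "\<lambda>z. h1 z + h2 z"]) (auto intro: trig_poly.add simp: distrib_right)
qed

text \<open>Stone--Weierstrass produces polynomials in Re z and Im z; on the circle these are
  trigonometric polynomials, whose integrals are moments.\<close>

lemma real_polynomial_trig: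
  fixes g :: "complex \<Rightarrow> real"
  assumes "real_polynomial_function g"
  shows "\<exists>h. trig_poly h \<and> (\<forall>z. norm z = 1 \<longrightarrow> h z = complex_of_real (g z))"
  using assms
proof induction
  case (linear f)
  \<comment> \<open>A real-linear f is Re z f(1) + Im z f(i), and on the circle cnj z =
    z^{-1}.\<close>
  let ?a = "complex_of_real (f 1)" and ?b = "complex_of_real (f \<i>)"
  let ?h = "\<lambda>z. (?a / 2 - \<i> * ?b / 2) * z powi 1 + (?a / 2 + \<i> * ?b / 2) * z powi (-1)"
  have "?h z = complex_of_real (f z)" if "norm z = 1" for z
  proof -
    have l: "linear f" using linear by (rule bounded_linear.linear)
    have "f z = f (Re z *\<^sub>R 1 + Im z *\<^sub>R \<i>)" by (rule arg_cong[of _ _ f]) (simp add: complex_eq_iff)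
    also have "\<dots> = Re z * f 1 + Im z * f \<i>"
      unfolding linear_add[OF l] linear_scale[OF l] by simp
    finally have fz: "complex_of_real (f z) = Re z * ?a + Im z * ?b" by simp
    have "z powi (-1) = cnj z" using unit_circle(2)[OF that] by (simp add: power_int_minus)
    then have "?h z = ?a / 2 * (z + cnj z) - \<i> * ?b / 2 * (z - cnj z)"
      by (simp only: power_int_1_right) (simp add: algebra_simps diff_divide_distrib add_divide_distrib)
    also have "\<dots> = complex_of_real (f z)"
      unfolding complex_add_cnj complex_diff_cnj fz by (simp add: complex_eq_iff)
    finally show ?thesis .
  qed
  then show ?case using trig_poly.add[OF trig_poly.monomial trig_poly.monomial] by blast
next
  case (const c)
  then show ?case using trig_poly.monomial[of "complex_of_real c" 0] by (intro exI) auto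
next
  case (add f g)
  then obtain h1 h2 where "trig_poly h1" "trig_poly h2"
    "\<forall>z. norm z = 1 \<longrightarrow> h1 z = complex_of_real (f z)" "\<forall>z. norm z = 1 \<longrightarrow> h2 z = complex_of_real (g z)" by blast
  then show ?case by (intro exI[of _ "\<lambda>z. h1 z + h2 z"]) (auto intro: trig_poly.add)
next
  case (mult f g)
  then obtain h1 h2 where h: "trig_poly h1" "trig_poly h2"
    "\<forall>z. norm z = 1 \<longrightarrow> h1 z = complex_of_real (f z)" "\<forall>z. norm z = 1 \<longrightarrow> h2 z = complex_of_real (g z)" by blast
  then show ?case using trig_poly_mult[OF h(1,2)] by auto
qed

lemma trig_poly_continuous: "trig_poly h \<Longrightarrow> continuous_on (sphere 0 1) h"
  by (induction rule: trig_poly.induct) (auto intro!: continuous_intros)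

lemma cis_inj_on: "inj_on cis {0..<2*pi}"
proof (rule inj_onI)
  fix x y :: real assume xy: "x \<in> {0..<2*pi}" "y \<in> {0..<2*pi}" "cis x = cis y"
  then obtain k :: int where k: "x = y + 2 * pi * k"
    using sin_cos_eq_iff[of x y] by (auto simp: complex_eq_iff)
  then have "\<bar>2 * pi * k\<bar> < 2 * pi" using xy by auto
  then have "\<bar>real_of_int k\<bar> < 1" by (simp add: abs_mult)
  then show "x = y" using k by simp
qed

lemma integrable_mult_circle:
  fixes q :: "real \<Rightarrow> 'a :: {banach, second_countable_topology, real_normed_algebra}"
  assumes \<tau>: "sets \<tau> = sets circle" and q: "integrable \<tau> q" and f: "continuous_on (sphere 0 1) f"
  shows "integrable \<tau> (\<lambda>\<theta>. f (cis \<theta>) * q \<theta>)"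
proof -
  obtain K where K: "K \<ge> 0" "\<And>\<theta>. norm (f (cis \<theta>)) \<le> K" using sphere_bound[OF f] by blast
  show ?thesis
  proof (rule Bochner_Integration.integrable_bound)
    show "integrable \<tau> (\<lambda>\<theta>. K *\<^sub>R norm (q \<theta>))" using q by auto
    show "(\<lambda>\<theta>. f (cis \<theta>) * q \<theta>) \<in> borel_measurable \<tau>"
      by (intro borel_measurable_times measurable_circle_continuous[OF f \<tau>] borel_measurable_integrable q)
    show "AE \<theta> in \<tau>. norm (f (cis \<theta>) * q \<theta>) \<le> norm (K *\<^sub>R norm (q \<theta>))"
    proof (rule AE_I2)
      fix \<theta>
      have "norm (f (cis \<theta>) * q \<theta>) \<le> norm (f (cis \<theta>)) * norm (q \<theta>)" by (rule norm_mult_ineq)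
      also have "\<dots> \<le> K * norm (q \<theta>)" by (intro mult_right_mono K) auto
      finally show "norm (f (cis \<theta>) * q \<theta>) \<le> norm (K *\<^sub>R norm (q \<theta>))" using K by simp
    qed
  qed
qed

text \<open>A trigonometric polynomial involves finitely many moments, each of which agrees from
  some n on; so there is eventual equality and not just convergence.\<close>

lemma eventually_trig_poly_integral:
  assumes h: "trig_poly h" and \<tau>: "sets \<tau> = sets circle" and q: "integrable \<tau> q"
    and qn: "\<And>n. continuous_on (sphere 0 1) (qn n)"
    and moments: "\<And>j. \<forall>\<^sub>F n in sequentially. circle_mean (\<lambda>z. z powi j * complex_of_real (qn n z))
        = (LINT \<theta>|\<tau>. cis \<theta> powi j * complex_of_real (q \<theta>))"
  shows "\<forall>\<^sub>F n in sequentially. circle_mean (\<lambda>z. h z * complex_of_real (qn n z))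
        = (LINT \<theta>|\<tau>. h (cis \<theta>) * complex_of_real (q \<theta>))"
  using h
proof induction
  case (monomial c j)
  show ?case using moments[of j] by eventually_elim (simp add: mult.assoc)
next
  case (add f g)
  have i1: "integrable \<tau> (\<lambda>\<theta>. f (cis \<theta>) * complex_of_real (q \<theta>))" "integrable \<tau> (\<lambda>\<theta>. g (cis \<theta>) * complex_of_real (q \<theta>))"
    using add.hyps by (auto intro!: integrable_mult_circle[OF \<tau>] trig_poly_continuous integrable_of_real q)
  have i2: "integrable circle_lebesgue (\<lambda>\<theta>. f (cis \<theta>) * complex_of_real (qn n (cis \<theta>)))"
    "integrable circle_lebesgue (\<lambda>\<theta>. g (cis \<theta>) * complex_of_real (qn n (cis \<theta>)))" for n
    by (rule integrable_circle_continuous, intro continuous_intros trig_poly_continuous add.hyps qn)+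
  show ?case using add.IH by eventually_elim (simp add: distrib_right i1 i2)
qed

text \<open>The upper half of the portmanteau theorem: the indicator of T lies below bumps that
  shrink to it, and a bump lies below a nearby trigonometric polynomial. The bumps surround the
  image of T on the circle, so that they respect the identification of 0 with 2 pi.\<close>

theorem portmanteau_compact:
  fixes q :: "real \<Rightarrow> real" and qn :: "nat \<Rightarrow> complex \<Rightarrow> real"
  assumes \<tau>: "sets \<tau> = sets circle" and q: "integrable \<tau> q"
    and qn: "\<And>n. continuous_on (sphere 0 1) (qn n)" and pos: "\<And>n z. norm z = 1 \<Longrightarrow> 0 \<le> qn n z"
    and moments: "\<And>j. \<forall>\<^sub>F n in sequentially. circle_mean (\<lambda>z. z powi j * complex_of_real (qn n z))
        = (LINT \<theta>|\<tau>. cis \<theta> powi j * complex_of_real (q \<theta>))"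
    and T: "compact T" "T \<subseteq> {0..<2*pi}" and e: "0 < e"
  shows "\<forall>\<^sub>F n in sequentially. (LINT \<theta>:T|circle_lebesgue. qn n (cis \<theta>)) \<le> (LINT \<theta>:T|\<tau>. q \<theta>) + e"
\<comment> \<open>\<open>infdist\<close> to the empty set is 0, so the bumps would be constantly 1
  in that case.\<close>
proof (cases "T = {}")
  case True
  then show ?thesis using e by (simp add: set_lebesgue_integral_def)
next
  case False
  have space: "space \<tau> = {0..<2*pi}" using sets_eq_imp_space_eq[OF \<tau>] by (simp add: space_restrict_space)
  have Tm: "T \<in> sets \<tau>"
    unfolding \<tau> using T by (auto simp: sets_restrict_space borel_compact intro!: image_eqI[of _ _ T])
  define F where "F m z = max 0 (1 - real m * infdist z (cis ` T))" for m z
  have cF: "continuous_on (sphere 0 1) (F m)" for m unfolding F_def[abs_def] by (intro continuous_intros)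
  have F1: "0 \<le> F m z" "F m z \<le> 1" for m z by (auto simp: F_def infdist_nonneg)
  have "compact (cis ` T)" by (intro compact_continuous_image T) (auto intro!: continuous_intros)
  then have cl: "closed (cis ` T)" by (rule compact_imp_closed)
  have FT: "F m (cis \<theta>) = 1" if "\<theta> \<in> T" for m \<theta> using that by (simp add: F_def)
  \<comment> \<open>Off T the point cis \<theta> has positive distance to the image of T, because
    \<open>cis\<close> is injective on the half-open interval.\<close>
  have lim: "(\<lambda>m. F m (cis \<theta>) * q \<theta>) \<longlonglongrightarrow> indicat_real T \<theta> * q \<theta>" if \<theta>: "\<theta> \<in> space \<tau>" for \<theta>
  proof (cases "\<theta> \<in> T")
    case True
    then show ?thesis by (simp add: FT)
  next
    case nT: False
    have "cis \<theta> \<notin> cis ` T"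
    proof
      assume "cis \<theta> \<in> cis ` T"
      then obtain t where "t \<in> T" "cis \<theta> = cis t" by auto
      then show False using inj_onD[OF cis_inj_on, of \<theta> t] T(2) \<theta> nT by (auto simp: space)
    qed
    then have "infdist (cis \<theta>) (cis ` T) \<noteq> 0"
      using in_closed_iff_infdist_zero[OF cl, of "cis \<theta>"] False by simp
    then have d: "infdist (cis \<theta>) (cis ` T) > 0" (is "?d > 0")
      using infdist_nonneg[of "cis \<theta>" "cis ` T"] by linarith
    obtain m0 :: nat where m0: "1 / ?d < m0" using reals_Archimedean2 by blast
    have "F m (cis \<theta>) = 0" if "m \<ge> m0" for m
    proof -
      have "1 < real m0 * ?d" using m0 d by (simp add: field_simps)
      also have "\<dots> \<le> real m * ?d" using that d by (intro mult_right_mono) auto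
      finally show ?thesis by (simp add: F_def)
    qed
    then have "\<forall>\<^sub>F m in sequentially. F m (cis \<theta>) * q \<theta> = 0"
      by (intro eventually_sequentiallyI[of m0]) simp
    then show ?thesis using nT by (simp add: tendsto_eventually)
  qed
  have iF: "integrable \<tau> (\<lambda>\<theta>. F m (cis \<theta>) * q \<theta>)" for m by (rule integrable_mult_circle[OF \<tau> q cF])
  have "(\<lambda>m. LINT \<theta>|\<tau>. F m (cis \<theta>) * q \<theta>) \<longlonglongrightarrow> (LINT \<theta>|\<tau>. indicat_real T \<theta> * q \<theta>)"
  proof (rule integral_dominated_convergence[where w = "\<lambda>\<theta>. \<bar>q \<theta>\<bar>"])
    show "(\<lambda>\<theta>. indicat_real T \<theta> * q \<theta>) \<in> borel_measurable \<tau>"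
      using Tm borel_measurable_integrable[OF q] by measurable
    show "AE \<theta> in \<tau>. norm (F m (cis \<theta>) * q \<theta>) \<le> \<bar>q \<theta>\<bar>" for m
    proof (rule AE_I2)
      fix \<theta> show "norm (F m (cis \<theta>) * q \<theta>) \<le> \<bar>q \<theta>\<bar>"
        using mult_right_mono[OF F1(2)[of m "cis \<theta>"], of "\<bar>q \<theta>\<bar>"] F1(1)[of m "cis \<theta>"] by (simp add: abs_mult)
    qed
  qed (use lim q iF in \<open>auto intro: borel_measurable_integrable\<close>)
  then have "\<forall>\<^sub>F m in sequentially. (LINT \<theta>|\<tau>. F m (cis \<theta>) * q \<theta>) < (LINT \<theta>|\<tau>. indicat_real T \<theta> * q \<theta>) + e / 2"
    using e by (intro order_tendstoD(2)) auto
  then obtain m where "(LINT \<theta>|\<tau>. F m (cis \<theta>) * q \<theta>) < (LINT \<theta>|\<tau>. indicat_real T \<theta> * q \<theta>) + e / 2"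
    by (meson eventually_sequentially order_refl)
  then have m: "(LINT \<theta>|\<tau>. F m (cis \<theta>) * q \<theta>) \<le> (LINT \<theta>:T|\<tau>. q \<theta>) + e / 2"
    by (simp add: set_lebesgue_integral_def)
  define Q where "Q = (LINT \<theta>|\<tau>. \<bar>q \<theta>\<bar>)"
  have Q0: "Q \<ge> 0" unfolding Q_def by (intro integral_nonneg_AE) auto
  \<comment> \<open>A uniform error of 2 d then costs at most 2 d Q <= e / 2; the + 1 covers Q =
    0.\<close>
  define d where "d = e / (4 * (Q + 1))"
  have d: "d > 0" "2 * d * Q \<le> e / 2" using e Q0 by (auto simp: d_def field_simps)
  obtain g where g: "real_polynomial_function g" "\<And>z. z \<in> sphere 0 1 \<Longrightarrow> \<bar>F m z - g z\<bar> < d"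
    using Stone_Weierstrass_real_polynomial_function[OF compact_sphere[of "0 :: complex" 1] cF[of m] d(1)] by blast
  \<comment> \<open>The shift by d makes the approximation one-sided: g' lies above the bump, by at
    most 2 d.\<close>
  define g' where "g' z = g z + d" for z
  have pg': "real_polynomial_function g'"
    unfolding g'_def[abs_def] by (intro real_polynomial_function.intros g)
  then obtain h where h: "trig_poly h" "\<And>z. norm z = 1 \<Longrightarrow> h z = complex_of_real (g' z)"
    using real_polynomial_trig by blast
  have g'F: "F m z \<le> g' z" "g' z \<le> F m z + 2 * d" if "norm z = 1" for z
    using g(2)[of z] that by (auto simp: g'_def abs_less_iff)
  have cg': "continuous_on (sphere 0 1) g'"
    using pg' continuous_on_polymonial_function real_polynomial_function_eq by blast
  have ig': "integrable \<tau> (\<lambda>\<theta>. g' (cis \<theta>) * q \<theta>)" by (rule integrable_mult_circle[OF \<tau> q cg'])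
  have ign: "integrable circle_lebesgue (\<lambda>\<theta>. g' (cis \<theta>) * qn n (cis \<theta>))" for n
    by (rule integrable_circle_continuous) (intro continuous_intros cg' qn)
  have iqn: "integrable circle_lebesgue (\<lambda>\<theta>. qn n (cis \<theta>))" for n
    by (rule integrable_circle_continuous[OF qn])
  have bd: "(LINT \<theta>|\<tau>. g' (cis \<theta>) * q \<theta>) \<le> (LINT \<theta>:T|\<tau>. q \<theta>) + e"
  proof -
    have "(LINT \<theta>|\<tau>. g' (cis \<theta>) * q \<theta>) \<le> (LINT \<theta>|\<tau>. F m (cis \<theta>) * q \<theta> + 2 * d * \<bar>q \<theta>\<bar>)"
    proof (rule integral_mono[OF ig'])
      show "integrable \<tau> (\<lambda>\<theta>. F m (cis \<theta>) * q \<theta> + 2 * d * \<bar>q \<theta>\<bar>)" using iF q by auto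
      fix \<theta>
      have "(g' (cis \<theta>) - F m (cis \<theta>)) * q \<theta> \<le> \<bar>(g' (cis \<theta>) - F m (cis \<theta>)) * q \<theta>\<bar>" by (rule abs_ge_self)
      also have "\<dots> \<le> 2 * d * \<bar>q \<theta>\<bar>"
        using g'F[of "cis \<theta>"] unfolding abs_mult by (intro mult_right_mono) auto
      finally show "g' (cis \<theta>) * q \<theta> \<le> F m (cis \<theta>) * q \<theta> + 2 * d * \<bar>q \<theta>\<bar>" by (simp add: left_diff_distrib)
    qed
    also have "\<dots> = (LINT \<theta>|\<tau>. F m (cis \<theta>) * q \<theta>) + 2 * d * Q"
      using iF q by (simp add: Q_def)
    also have "\<dots> \<le> (LINT \<theta>:T|\<tau>. q \<theta>) + e / 2 + e / 2" using m d by linarith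
    finally show ?thesis by simp
  qed
  show ?thesis
    using eventually_trig_poly_integral[OF h(1) \<tau> q qn moments]
  proof eventually_elim
    case (elim n)
    then have "complex_of_real (LINT \<theta>|circle_lebesgue. g' (cis \<theta>) * qn n (cis \<theta>)) = complex_of_real (LINT \<theta>|\<tau>. g' (cis \<theta>) * q \<theta>)"
      by (simp add: h(2) flip: integral_complex_of_real)
    then have eq: "(LINT \<theta>|circle_lebesgue. g' (cis \<theta>) * qn n (cis \<theta>)) = (LINT \<theta>|\<tau>. g' (cis \<theta>) * q \<theta>)"
      using of_real_eq_iff by blast
    have "(LINT \<theta>:T|circle_lebesgue. qn n (cis \<theta>)) \<le> (LINT \<theta>|circle_lebesgue. g' (cis \<theta>) * qn n (cis \<theta>))"
      unfolding set_lebesgue_integral_def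
    proof (rule integral_mono[OF _ ign])
      show "integrable circle_lebesgue (\<lambda>\<theta>. indicat_real T \<theta> *\<^sub>R qn n (cis \<theta>))"
        using Tm \<tau> by (intro integrable_mult_indicator iqn) auto
      fix \<theta>
      have "indicat_real T \<theta> \<le> g' (cis \<theta>)"
        using g'F(1)[of "cis \<theta>"] F1(1)[of m "cis \<theta>"] FT[of \<theta> m] by (auto simp: indicator_def)
      then show "indicat_real T \<theta> *\<^sub>R qn n (cis \<theta>) \<le> g' (cis \<theta>) * qn n (cis \<theta>)"
        using pos[of "cis \<theta>" n] by (simp add: mult_right_mono)
    qed
    then show ?case using eq bd by linarith
  qed
qed

section \<open>Convergence in mean of the weighted polynomials\<close>

text \<open>By Hadamard's inequality a nonvanishing determinant makes all diagonal entries positive,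
  so logarithms may be taken.\<close>

lemma pos_semidef_ln_det:
  fixes A :: "complex^'n^'n"
  assumes A: "pos_semidef A" and d: "det A \<noteq> 0"
  shows "0 < Re (det A)" "0 < Re (A $ i $ i)" "ln (Re (det A)) \<le> (\<Sum>i\<in>UNIV. ln (Re (A $ i $ i)))"
proof -
  have "Re (det A) \<noteq> 0" using hadamard(1)[OF A] d by auto
  then show p: "0 < Re (det A)" using hadamard(2)[OF A] by simp
  then have pr: "0 < (\<Prod>i\<in>UNIV. Re (A $ i $ i))" using hadamard(3)[OF A] by linarith
  have nz: "Re (A $ i $ i) \<noteq> 0" for i
  proof
    assume "Re (A $ i $ i) = 0"
    then have "(\<Prod>i\<in>UNIV. Re (A $ i $ i)) = 0" by (intro prod_zero) auto
    then show False using pr by linarith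
  qed
  then show "0 < Re (A $ i $ i)" using pos_semidef_diag[OF A, of i] by (simp add: order_less_le)
  show "ln (Re (det A)) \<le> (\<Sum>i\<in>UNIV. ln (Re (A $ i $ i)))"
    using p pr hadamard(3)[OF A] nz by (simp flip: ln_prod)
qed

lemma pos_semidef_matrix_inv:
  fixes C :: "complex^'n^'n"
  assumes C: "pos_semidef C" "det C \<noteq> 0"
  shows "pos_semidef (matrix_inv C)"
proof -
  have iC: "invertible C" using C(2) invertible_det_nz by blast
  have "matrix_inv C ** C ** ht (matrix_inv C) = matrix_inv C"
    using invertible_ht(2)[OF iC] pos_semidef_ht[OF C(1)] by (simp add: matrix_inv_works[OF iC])
  then show ?thesis using pos_semidef_congruence[OF C(1), of "matrix_inv C"] by simp
qed

text \<open>
  Hadamard's inequality for the product of \<open>\<phi> R \<phi>\<^sup>*\<close> and \<open>\<phi>\<^sup>-\<^sup>* C\<^sup>-\<^sup>1 \<phi>\<^sup>-\<^sup>1\<close>, whose determinants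
  multiply to \<open>det R / det C\<close>, combined with \<open>ln x \<le> x - 1\<close>.
\<close>

lemma hadamard_log_bound:
  fixes P C R :: "complex^'n^'n"
  assumes P: "invertible P" and C: "pos_semidef C" "det C \<noteq> 0" and R: "pos_semidef R" "det R \<noteq> 0"
  shows "3 * real CARD('n) + ln (Re (det R)) - ln (Re (det C))
      - Re (trace (matrix_inv C ** (matrix_inv P ** ht (matrix_inv P))))
    \<le> 2 * (\<Sum>i\<in>UNIV. sqrt (Re ((P ** R ** ht P) $ i $ i)))"
proof -
  define M where "M = P ** R ** ht P"
  define N where "N = ht (matrix_inv P) ** matrix_inv C ** matrix_inv P"
  have iC: "invertible C" using C(2) invertible_det_nz by blast
  have N: "pos_semidef N"
    using pos_semidef_congruence[OF pos_semidef_matrix_inv[OF C], of "ht (matrix_inv P)"] by (simp add: N_def)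
  have M: "pos_semidef M" unfolding M_def by (rule pos_semidef_congruence[OF R(1)])
  have dC: "det (matrix_inv C) * det C = 1" and dP: "det (matrix_inv P) * det P = 1"
    using matrix_inv_works(2)[OF iC] matrix_inv_works(2)[OF P] by (metis det_mul det_I)+
  \<comment> \<open>The determinants of P and of its inverse cancel, which frees the bound from det
    phi.\<close>
  have "det M * det N * det C = det R * (det (matrix_inv P) * det P) * cnj (det (matrix_inv P) * det P) * (det (matrix_inv C) * det C)"
    by (simp add: M_def N_def det_mul)
  then have prod: "det M * det N * det C = det R" using dC dP by simp
  then have nz: "det M \<noteq> 0" "det N \<noteq> 0" using R(2) by auto
  note LM = pos_semidef_ln_det[OF M nz(1)] and LN = pos_semidef_ln_det[OF N nz(2)]
  have "complex_of_real (Re (det M) * Re (det N) * Re (det C)) = complex_of_real (Re (det R))"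
    using prod hadamard(1)[OF M] hadamard(1)[OF N] hadamard(1)[OF C(1)] hadamard(1)[OF R(1)] by simp
  then have "Re (det M) * Re (det N) * Re (det C) = Re (det R)" using of_real_eq_iff by blast
  then have "ln (Re (det R)) = ln (Re (det M)) + ln (Re (det N)) + ln (Re (det C))"
    using LM(1) LN(1) pos_semidef_ln_det(1)[OF C] by (simp add: ln_mult flip: \<open>_ = Re (det R)\<close>)
  then have "ln (Re (det R)) - ln (Re (det C)) \<le> (\<Sum>i\<in>UNIV. ln (Re (M $ i $ i)) + ln (Re (N $ i $ i)))"
    using LM(3) LN(3) by (simp add: sum.distrib)
  also have "\<dots> \<le> (\<Sum>i\<in>UNIV. 2 * (sqrt (Re (M $ i $ i)) - 1) + (Re (N $ i $ i) - 1))"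
  proof (intro sum_mono add_mono)
    fix i
    have "ln (Re (M $ i $ i)) = 2 * ln (sqrt (Re (M $ i $ i)))" using LM(2)[of i] by (simp add: ln_sqrt)
    also have "\<dots> \<le> 2 * (sqrt (Re (M $ i $ i)) - 1)" using LM(2)[of i] ln_le_minus_one[of "sqrt (Re (M $ i $ i))"] by simp
    finally show "ln (Re (M $ i $ i)) \<le> 2 * (sqrt (Re (M $ i $ i)) - 1)" .
    show "ln (Re (N $ i $ i)) \<le> Re (N $ i $ i) - 1" using LN(2)[of i] by (rule ln_le_minus_one)
  qed
  also have "\<dots> = 2 * (\<Sum>i\<in>UNIV. sqrt (Re (M $ i $ i))) + Re (trace N) - 3 * real CARD('n)"
    by (simp add: sum.distrib sum_subtractf sum_distrib_left trace_def algebra_simps)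
  also have "trace N = trace (matrix_inv C ** (matrix_inv P ** ht (matrix_inv P)))"
    unfolding N_def using trace_mul_sym[of "ht (matrix_inv P)" "matrix_inv C ** matrix_inv P"]
    by (simp add: matrix_mul_assoc)
  finally show ?thesis by (simp add: M_def)
qed

lemma norm_le_sum_entries:
  fixes A :: "complex^'n^'n"
  shows "norm A \<le> (\<Sum>i\<in>UNIV. \<Sum>j\<in>UNIV. norm (A $ i $ j))"
proof -
  have "norm A \<le> (\<Sum>i\<in>UNIV. norm (A $ i))" unfolding norm_vec_def by (rule L2_set_le_sum) auto
  also have "\<dots> \<le> (\<Sum>i\<in>UNIV. \<Sum>j\<in>UNIV. norm (A $ i $ j))"
    by (intro sum_mono) (unfold norm_vec_def, rule L2_set_le_sum, auto)
  finally show ?thesis .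
qed

lemma circle_inner_compact:
  assumes A: "A \<in> sets circle" and e: "0 < e"
  obtains T where "compact T" "T \<subseteq> A" "T \<in> sets circle" "measure circle_lebesgue A < measure circle_lebesgue T + e"
proof -
  have sub: "A \<subseteq> {0..<2*pi}" using sets.sets_into_space[OF A] by (simp add: space_restrict_space)
  have Ab: "A \<in> sets lborel" using sets_circle_borel[OF A] by simp
  then have "A \<in> sets lebesgue" by (rule sets_completionI_sets)
  then obtain T where T: "closed T" "T \<subseteq> A" "emeasure lebesgue (A - T) < ennreal e"
    using sets_lebesgue_inner_closed e by metis
  have "bounded T" by (rule bounded_subset[OF bounded_closed_interval[of 0 "2*pi"]]) (use T(2) sub in auto)
  then have cT: "compact T" using T(1) compact_eq_bounded_closed by blast
  have Tb: "T \<in> sets borel" using T(1) by (rule borel_closed)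
  have Ts: "T \<in> sets circle"
    using Tb T(2) sub by (auto simp: sets_restrict_space intro!: image_eqI[of _ _ T])
  have ATs: "A - T \<in> sets circle" using A Ts by (rule sets.Diff)
  have "emeasure circle_lebesgue (A - T) = ennreal (1 / (2*pi)) * emeasure lborel (A - T)"
    by (rule emeasure_circle_lebesgue[OF ATs])
  \<comment> \<open>The normalisation only shrinks measure, so inner regularity of Lebesgue measure
    works with the same e.\<close>
  also have "\<dots> \<le> 1 * emeasure lborel (A - T)"
  proof (rule mult_right_mono)
    have "1 / (2*pi) \<le> 1" using pi_gt3 by simp
    then show "ennreal (1 / (2*pi)) \<le> 1" by (metis ennreal_1 ennreal_leI)
  qed simp
  also have "\<dots> = emeasure lebesgue (A - T)" using sets_circle_borel[OF ATs] by simp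
  also have "\<dots> < ennreal e" by (rule T(3))
  finally have "measure circle_lebesgue (A - T) < e"
    using e by (simp add: circle_lebesgue.emeasure_eq_measure ennreal_less_iff)
  moreover have "measure circle_lebesgue (A - T) = measure circle_lebesgue A - measure circle_lebesgue T"
    using A Ts T(2) by (intro circle_lebesgue.finite_measure_Diff) auto
  ultimately show thesis using that[OF cT T(2) Ts] by simp
qed

lemma continuous_det: "continuous_on UNIV (det :: complex^'n^'n \<Rightarrow> complex)"
  by (rule continuous_on_det) (rule continuous_on_entry[OF continuous_on_id])

text \<open>\<open>N\<close> is to carry the singular part. Off \<open>N\<close> the measure is
  normalised Lebesgue measure itself and not merely equivalent to it, so that a density there plays
  the role of rho'.\<close>

locale circle_measure =
  fixes \<tau> :: "real measure" and N :: "real set"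
  assumes sets_tau: "sets \<tau> = sets circle"
    and N_sets: "N \<in> sets circle" and N_null: "emeasure circle_lebesgue N = 0"
    and off: "\<And>A. A \<in> sets circle \<Longrightarrow> A \<inter> N = {} \<Longrightarrow> emeasure \<tau> A = emeasure circle_lebesgue A"
begin

lemma space_weight: "space \<tau> = {0..<2*pi}"
  using sets_eq_imp_space_eq[OF sets_tau] by (simp add: space_restrict_space)

abbreviation "regular \<equiv> {0..<2*pi} - N"

lemma regular_sets: "regular \<in> sets circle"
proof -
  have "space circle - N \<in> sets circle" using N_sets by (rule sets.compl_sets)
  then show ?thesis by (simp add: space_restrict_space)
qed

lemma density_regular: "density \<tau> (indicator regular) = density circle_lebesgue (indicator regular)"
proof (rule measure_eqI)
  fix A assume "A \<in> sets (density \<tau> (indicator regular))"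
  then have A: "A \<in> sets circle" by (simp add: sets_tau)
  have "emeasure \<tau> (regular \<inter> A) = emeasure circle_lebesgue (regular \<inter> A)"
    using A regular_sets by (intro off) auto
  then show "emeasure (density \<tau> (indicator regular)) A = emeasure (density circle_lebesgue (indicator regular)) A"
    using A regular_sets sets_tau by (simp add: emeasure_restricted)
qed (simp add: sets_tau)

lemma AE_regular: "AE \<theta> in circle_lebesgue. \<theta> \<in> regular"
proof -
  have "N \<in> null_sets circle_lebesgue" using N_sets N_null by (simp add: null_sets_def)
  then have "AE \<theta> in circle_lebesgue. \<theta> \<notin> N" by (rule AE_not_in)
  then show ?thesis using AE_space by eventually_elim auto
qed

lemma integral_regular:
  fixes f :: "real \<Rightarrow> 'a :: {banach, second_countable_topology}"
  assumes f: "f \<in> borel_measurable circle"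
  shows "(LINT \<theta>:regular|\<tau>. f \<theta>) = (LINT \<theta>|circle_lebesgue. f \<theta>)"
    and "set_integrable \<tau> regular f \<longleftrightarrow> integrable circle_lebesgue f"
proof -
  have fm: "f \<in> borel_measurable \<tau>" "f \<in> borel_measurable circle_lebesgue"
    using f measurable_cong_sets[OF sets_tau refl] measurable_cong_sets[OF sets_circle_lebesgue refl] by blast+
  have rs: "regular \<in> sets \<tau>" "regular \<in> sets circle_lebesgue" using regular_sets sets_tau by simp_all
  have d: "density \<tau> (\<lambda>x. ennreal (indicat_real regular x)) = density circle_lebesgue (\<lambda>x. ennreal (indicat_real regular x))"
    using density_regular by (simp add: ennreal_indicator)
  have ind: "AE \<theta> in circle_lebesgue. indicat_real regular \<theta> *\<^sub>R f \<theta> = f \<theta>"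
    using AE_regular by eventually_elim simp
  have "(LINT \<theta>:regular|\<tau>. f \<theta>) = integral\<^sup>L (density \<tau> (\<lambda>x. ennreal (indicat_real regular x))) f"
    unfolding set_lebesgue_integral_def by (rule integral_density[symmetric]) (use fm rs in auto)
  also have "\<dots> = (LINT \<theta>:regular|circle_lebesgue. f \<theta>)"
    unfolding set_lebesgue_integral_def d by (rule integral_density) (use fm rs in auto)
  also have "\<dots> = (LINT \<theta>|circle_lebesgue. f \<theta>)"
    unfolding set_lebesgue_integral_def by (rule integral_cong_AE[OF _ _ ind]) (use fm rs in auto)
  finally show "(LINT \<theta>:regular|\<tau>. f \<theta>) = (LINT \<theta>|circle_lebesgue. f \<theta>)" .
  have "set_integrable \<tau> regular f \<longleftrightarrow> integrable (density \<tau> (\<lambda>x. ennreal (indicat_real regular x))) f"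
    unfolding set_integrable_def by (rule integrable_density[symmetric]) (use fm rs in auto)
  also have "\<dots> \<longleftrightarrow> set_integrable circle_lebesgue regular f"
    unfolding set_integrable_def d by (rule integrable_density) (use fm rs in auto)
  also have "\<dots> \<longleftrightarrow> integrable circle_lebesgue f"
    unfolding set_integrable_def
    by (rule integrable_cong_AE[OF _ _ ind]) (use fm rs in auto)
  finally show "set_integrable \<tau> regular f \<longleftrightarrow> integrable circle_lebesgue f" .
qed

lemma integrable_regular:
  fixes f :: "real \<Rightarrow> 'a :: {banach, second_countable_topology}"
  assumes f: "integrable \<tau> f"
  shows "integrable circle_lebesgue f"
    and "(LINT \<theta>|\<tau>. f \<theta>) = (LINT \<theta>|circle_lebesgue. f \<theta>) + (LINT \<theta>:N|\<tau>. f \<theta>)"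
proof -
  have fm: "f \<in> borel_measurable circle"
    using borel_measurable_integrable[OF f] measurable_cong_sets[OF sets_tau refl] by blast
  have i: "set_integrable \<tau> regular f" "set_integrable \<tau> N f"
    unfolding set_integrable_def using regular_sets N_sets sets_tau by (auto intro!: integrable_mult_indicator f)
  then show "integrable circle_lebesgue f" using integral_regular(2)[OF fm] by simp
  have "(LINT \<theta>|\<tau>. f \<theta>) = (LINT \<theta>:regular \<union> N|\<tau>. f \<theta>)"
    unfolding set_lebesgue_integral_def
    by (rule Bochner_Integration.integral_cong) (auto simp: space_weight indicator_def)
  also have "\<dots> = (LINT \<theta>:regular|\<tau>. f \<theta>) + (LINT \<theta>:N|\<tau>. f \<theta>)"
    by (rule set_integral_Un[OF _ i]) auto
  finally show "(LINT \<theta>|\<tau>. f \<theta>) = (LINT \<theta>|circle_lebesgue. f \<theta>) + (LINT \<theta>:N|\<tau>. f \<theta>)"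
    by (simp add: integral_regular(1)[OF fm])
qed

end

text \<open>\<open>det_nz\<close> is the form in which the hypothesis on det rho' enters; together
  with semidefiniteness it makes the determinant positive.\<close>

locale circle_weight = matrix_weight \<tau> R + circle_measure \<tau> N
  for \<tau> and R :: "real \<Rightarrow> complex^'n^'n" and N +
  assumes det_nz: "AE \<theta> in circle_lebesgue. det (R \<theta>) \<noteq> 0"
begin

lemma R_measurable: "R \<in> borel_measurable circle"
  using borel_measurable_integrable[OF integrable_weight] measurable_cong_sets[OF sets_weight refl] by blast

text \<open>Closeness of R to C k is one-sided, in the two directions that
  \<open>hadamard_log_bound\<close> uses: the determinant from below, the trace from above.\<close>

definition nearly_constant_pieces :: "real \<Rightarrow> nat \<Rightarrow> (nat \<Rightarrow> complex^'n^'n) \<Rightarrow> (nat \<Rightarrow> real set) \<Rightarrow> bool" where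
  "nearly_constant_pieces e K C F \<longleftrightarrow>
    (\<forall>k. pos_semidef (C k) \<and> det (C k) \<noteq> 0) \<and>
    (\<forall>k. compact (F k) \<and> F k \<in> sets circle \<and> F k \<subseteq> regular) \<and>
    (\<forall>k. \<forall>\<theta>\<in>F k. det (R \<theta>) \<noteq> 0 \<and> ln (Re (det (C k))) - e \<le> ln (Re (det (R \<theta>))) \<and>
        Re (trace (matrix_inv (C k) ** R \<theta>)) \<le> real CARD('n) + e) \<and>
    disjoint_family_on F {..<K} \<and> 1 - e \<le> (\<Sum>k<K. measure circle_lebesgue (F k))"

text \<open>Lindelof's theorem covers the positive definite matrices by countably many of the open
  sets U C. Their preimages under R cover almost the whole circle; made disjoint, cut to finitely
  many and shrunk to compact sets, they keep mass 1 - e.\<close>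

lemma nearly_constant_pieces_exist:
  assumes e: "0 < e"
  shows "\<exists>K C F. nearly_constant_pieces e K C F"
proof -
  define PD where "PD = {X :: complex^'n^'n. pos_semidef X \<and> det X \<noteq> 0}"
  \<comment> \<open>The factor exp (- e) is the shift by e of the logarithm, in a form continuous in
    X.\<close>
  define U where "U C = {X :: complex^'n^'n. exp (- e) * Re (det C) < Re (det X) \<and> Re (trace (matrix_inv C ** X)) < real CARD('n) + e}" for C
  have open_U: "open (U C)" for C
  proof -
    have "continuous_on UNIV (\<lambda>X :: complex^'n^'n. Re (det X))" by (intro continuous_intros continuous_det)
    moreover have "continuous_on UNIV (\<lambda>X :: complex^'n^'n. Re (trace (matrix_inv C ** X)))" by (intro continuous_intros)
    ultimately show ?thesis
      unfolding U_def Collect_conj_eq by (intro open_Int open_Collect_less continuous_on_const)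
  qed
  have U_self: "C \<in> U C" if "C \<in> PD" for C
  proof -
    have C: "pos_semidef C" "det C \<noteq> 0" using that by (auto simp: PD_def)
    have "invertible C" using C(2) invertible_det_nz by blast
    then have "trace (matrix_inv C ** C) = of_nat CARD('n)" by (simp add: matrix_inv_works trace_I)
    moreover have "exp (- e) * Re (det C) < 1 * Re (det C)"
      using pos_semidef_ln_det(1)[OF C] e by (intro mult_strict_right_mono) auto
    ultimately show ?thesis using e by (simp add: U_def)
  qed
  obtain F' where F': "F' \<subseteq> U ` PD" "countable F'" "\<Union>F' = \<Union>(U ` PD)"
    using Lindelof[of "U ` PD"] open_U by blast
  then obtain D where D: "countable D" "D \<subseteq> PD" "F' = U ` D"
    using countable_subset_image[of F' U PD] by auto
  have "mat 1 \<in> PD" by (simp add: PD_def pos_semidef_mat_1)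
  then have "D \<noteq> {}" using U_self F'(3) D(3) by force
  define c where "c = from_nat_into D"
  have cPD: "c k \<in> PD" for k using from_nat_into[OF \<open>D \<noteq> {}\<close>] D(2) by (auto simp: c_def)
  have cover: "\<exists>k. X \<in> U (c k)" if "X \<in> PD" for X
  proof -
    have "X \<in> \<Union>(U ` D)" using U_self[OF that] that F'(3) D(3) by auto
    then obtain C where "C \<in> D" "X \<in> U C" by auto
    then show ?thesis using from_nat_into_surj[OF D(1)] unfolding c_def by metis
  qed
  define B where "B k = {\<theta> \<in> regular. R \<theta> \<in> U (c k) \<and> det (R \<theta>) \<noteq> 0}" for k
  have B_sets: "B k \<in> sets circle" for k
  proof -
    have "U (c k) \<inter> {X. det X \<noteq> 0} \<in> sets borel"
      using open_U by (intro borel_open open_Int open_Collect_neq continuous_det continuous_on_const)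
    then have "R -` (U (c k) \<inter> {X. det X \<noteq> 0}) \<inter> space circle \<in> sets circle"
      using R_measurable by (rule measurable_sets[rotated])
    then have "regular \<inter> (R -` (U (c k) \<inter> {X. det X \<noteq> 0}) \<inter> space circle) \<in> sets circle"
      using regular_sets by blast
    moreover have "regular \<inter> (R -` (U (c k) \<inter> {X. det X \<noteq> 0}) \<inter> space circle) = B k"
      by (auto simp: B_def space_restrict_space)
    ultimately show ?thesis by simp
  qed
  have dsets: "disjointed B k \<in> sets circle" for k
    using sets.range_disjointed_sets[of B circle] B_sets by auto
  have "measure circle_lebesgue (\<Union>k. disjointed B k) = 1"
  proof -
    have "AE \<theta> in circle_lebesgue. \<theta> \<in> (\<Union>k. B k)"
      using AE_regular det_nz
    proof eventually_elim
      case (elim \<theta>)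
      then have "R \<theta> \<in> PD" using psd by (simp add: PD_def)
      then show ?case using cover elim by (auto simp: B_def)
    qed
    then have "measure circle_lebesgue (\<Union>k. B k) = measure circle_lebesgue (space circle_lebesgue)"
    proof (intro measure_eq_AE)
      assume ae: "AE \<theta> in circle_lebesgue. \<theta> \<in> (\<Union>k. B k)"
      show "AE \<theta> in circle_lebesgue. \<theta> \<in> (\<Union>k. B k) \<longleftrightarrow> \<theta> \<in> space circle_lebesgue"
        using ae AE_space by eventually_elim blast
    qed (use B_sets sets.top[of circle_lebesgue] in auto)
    then show ?thesis by (simp add: UN_disjointed_eq)
  qed
  then have "(\<lambda>k. measure circle_lebesgue (disjointed B k)) sums 1"
    using circle_lebesgue.finite_measure_UNION[of "disjointed B"] dsets disjoint_family_disjointed[of B]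
    by (auto simp: image_subset_iff)
  then have "(\<lambda>n. \<Sum>k<n. measure circle_lebesgue (disjointed B k)) \<longlonglongrightarrow> 1" by (simp add: sums_def)
  then have "\<forall>\<^sub>F n in sequentially. 1 - e / 2 < (\<Sum>k<n. measure circle_lebesgue (disjointed B k))"
    using e by (intro order_tendstoD(1)) auto
  then obtain K where K: "1 - e / 2 < (\<Sum>k<K. measure circle_lebesgue (disjointed B k))"
    by (meson eventually_sequentially order_refl)
  \<comment> \<open>Half of e is spent on cutting to K pieces, the other half on K approximations by
    compact sets.\<close>
  define d where "d = e / (2 * (real K + 1))"
  have d: "d > 0" using e by (simp add: d_def)
  define P where "P k T \<longleftrightarrow> compact T \<and> T \<subseteq> disjointed B k \<and> T \<in> sets circle \<and>
      measure circle_lebesgue (disjointed B k) < measure circle_lebesgue T + d" for k T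
  have "\<exists>T. P k T" for k
  proof -
    obtain T where "compact T" "T \<subseteq> disjointed B k" "T \<in> sets circle"
      "measure circle_lebesgue (disjointed B k) < measure circle_lebesgue T + d"
      by (rule circle_inner_compact[OF dsets d])
    then have "P k T" unfolding P_def by blast
    then show ?thesis ..
  qed
  then obtain F where "\<And>k. P k (F k)" by metis
  then have F: "\<And>k. compact (F k)" "\<And>k. F k \<subseteq> disjointed B k" "\<And>k. F k \<in> sets circle"
      "\<And>k. measure circle_lebesgue (disjointed B k) < measure circle_lebesgue (F k) + d"
    by (simp_all add: P_def)
  have FB: "F k \<subseteq> B k" for k by (rule order_trans[OF F(2) disjointed_subset])
  have "nearly_constant_pieces e K c F"
    unfolding nearly_constant_pieces_def
  proof (intro conjI allI ballI)
    show "pos_semidef (c k)" "det (c k) \<noteq> 0" for k using cPD[of k] by (simp_all add: PD_def)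
    have "B k \<subseteq> regular" for k by (auto simp: B_def)
    then show "compact (F k)" "F k \<in> sets circle" "F k \<subseteq> regular" for k
      by (intro F order_trans[OF FB])+
    show "det (R \<theta>) \<noteq> 0" "ln (Re (det (c k))) - e \<le> ln (Re (det (R \<theta>)))"
        "Re (trace (matrix_inv (c k) ** R \<theta>)) \<le> real CARD('n) + e" if "\<theta> \<in> F k" for k \<theta>
    proof -
      have 1: "R \<theta> \<in> U (c k)" "det (R \<theta>) \<noteq> 0" using subsetD[OF FB that] by (auto simp: B_def)
      have 2: "0 < Re (det (c k))" using cPD pos_semidef_ln_det(1) by (auto simp: PD_def)
      have "exp (- e) * Re (det (c k)) \<le> Re (det (R \<theta>))" using 1 by (simp add: U_def)
      then have "ln (exp (- e) * Re (det (c k))) \<le> ln (Re (det (R \<theta>)))" using 2 by (intro ln_mono) auto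
      then show "det (R \<theta>) \<noteq> 0" "ln (Re (det (c k))) - e \<le> ln (Re (det (R \<theta>)))"
        "Re (trace (matrix_inv (c k) ** R \<theta>)) \<le> real CARD('n) + e"
        using 1 2 by (simp_all add: ln_mult U_def)
    qed
    show "disjoint_family_on F {..<K}"
      unfolding disjoint_family_on_def
    proof (intro ballI impI)
      fix a b :: nat assume "a \<noteq> b"
      then have "disjointed B a \<inter> disjointed B b = {}"
        using disjoint_family_disjointed[of B] by (simp add: disjoint_family_on_def)
      then show "F a \<inter> F b = {}" using F(2)[of a] F(2)[of b] by blast
    qed
    have "(\<Sum>k<K. measure circle_lebesgue (disjointed B k)) \<le> (\<Sum>k<K. measure circle_lebesgue (F k) + d)"
      by (intro sum_mono less_imp_le F)
    also have "\<dots> = (\<Sum>k<K. measure circle_lebesgue (F k)) + real K * d" by (simp add: sum.distrib)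
    also have "real K * d \<le> e / 2" using e by (simp add: d_def field_simps)
    finally show "1 - e \<le> (\<Sum>k<K. measure circle_lebesgue (F k))" using K by linarith
  qed
  then show ?thesis by blast
qed

definition weighted :: "nat \<Rightarrow> (nat \<Rightarrow> complex^'n^'n) \<Rightarrow> real \<Rightarrow> complex^'n^'n" where
  "weighted n L \<theta> = mpoly n L (cis \<theta>) ** R \<theta> ** ht (mpoly n L (cis \<theta>))"

lemma weighted_psd: "pos_semidef (weighted n L \<theta>)"
  unfolding weighted_def by (rule pos_semidef_congruence[OF psd])

lemma weighted_integrable: "integrable \<tau> (weighted n L)"
  unfolding weighted_def[abs_def] by (intro integrable_ip continuous_on_mpoly)

lemma weighted_entry_integrable:
  "integrable circle_lebesgue (\<lambda>\<theta>. weighted n L \<theta> $ i $ j)"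
  by (rule integral_entry(2)[OF integrable_regular(1)[OF weighted_integrable]])

text \<open>The total mass is 1, so whatever the mean over the circle lacks sits on
  \<open>N\<close>: convergence of the means to 1 also removes the singular part.\<close>

lemma weighted_diag_mass:
  assumes L: "left_orthopoly moment n L"
  shows "(LINT \<theta>|circle_lebesgue. Re (weighted n L \<theta> $ i $ i)) + (LINT \<theta>:N|\<tau>. Re (weighted n L \<theta> $ i $ i)) = 1"
    and "(LINT \<theta>|circle_lebesgue. Re (weighted n L \<theta> $ i $ i)) \<le> 1"
proof -
  note e = integral_entry[OF weighted_integrable[of n L]]
  have i: "integrable \<tau> (\<lambda>\<theta>. Re (weighted n L \<theta> $ i $ i))" using e(2) by simp
  have "(LINT \<theta>|\<tau>. weighted n L \<theta>) = mat 1"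
    using orthopoly_norm[OF L] by (simp add: ip_def weighted_def)
  then have "(LINT \<theta>|\<tau>. weighted n L \<theta> $ i $ i) = 1" using e(1)[of i i] by (simp add: mat_nth)
  then have "(LINT \<theta>|\<tau>. Re (weighted n L \<theta> $ i $ i)) = 1" using e(2)[of i i] by simp
  then show *: "(LINT \<theta>|circle_lebesgue. Re (weighted n L \<theta> $ i $ i)) + (LINT \<theta>:N|\<tau>. Re (weighted n L \<theta> $ i $ i)) = 1"
    using integrable_regular(2)[OF i] by simp
  have "0 \<le> (LINT \<theta>:N|\<tau>. Re (weighted n L \<theta> $ i $ i))"
    unfolding set_lebesgue_integral_def
    by (intro integral_nonneg_AE AE_I2) (simp add: pos_semidef_diag[OF weighted_psd])
  then show "(LINT \<theta>|circle_lebesgue. Re (weighted n L \<theta> $ i $ i)) \<le> 1" using * by linarith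
qed

lemma weighted_sqrt_integrable:
  "integrable circle_lebesgue (\<lambda>\<theta>. sqrt (Re (weighted n L \<theta> $ i $ i)))"
proof (rule Bochner_Integration.integrable_bound)
  show "integrable circle_lebesgue (\<lambda>\<theta>. 1 + Re (weighted n L \<theta> $ i $ i))"
    using weighted_entry_integrable[of n L i i] by simp
  show "(\<lambda>\<theta>. sqrt (Re (weighted n L \<theta> $ i $ i))) \<in> borel_measurable circle_lebesgue"
    using borel_measurable_integrable[OF weighted_entry_integrable[of n L i i]] by measurable
  show "AE \<theta> in circle_lebesgue. norm (sqrt (Re (weighted n L \<theta> $ i $ i))) \<le> norm (1 + Re (weighted n L \<theta> $ i $ i))"
  proof (rule AE_I2)
    fix \<theta>
    have "0 \<le> Re (weighted n L \<theta> $ i $ i)" (is "0 \<le> ?x") by (rule pos_semidef_diag[OF weighted_psd])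
    moreover have "sqrt ?x \<le> 1 + ?x"
      using calculation arith_geo_mean_sqrt[of 1 ?x] by simp
    ultimately show "norm (sqrt ?x) \<le> norm (1 + ?x)" by simp
  qed
qed

end

text \<open>Reality of these traces reduces matrix moments to those of real scalar weights.\<close>

lemma trace_hermitian_real:
  fixes A X :: "complex^'n^'n"
  assumes "ht A = A" "ht X = X"
  shows "trace (A ** X) = complex_of_real (Re (trace (A ** X)))"
proof -
  have "cnj (trace (A ** X)) = trace (ht (A ** X))" by (rule trace_ht[symmetric])
  also have "\<dots> = trace (A ** X)" unfolding ht_mult assms by (rule trace_mul_sym)
  finally show ?thesis by (simp add: complex_eq_iff)
qed

lemma bounded_linear_trace_mult: "bounded_linear (\<lambda>X :: complex^'n^'n. trace (A ** X))"
  by (rule bounded_linear_compose[OF bounded_linear_trace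
        bounded_bilinear.bounded_linear_right[OF bounded_bilinear_matrix_mult]])

lemma (in matrix_weight) trace_moment:
  assumes A: "ht A = A"
  shows "(LINT \<theta>|\<tau>. cis \<theta> powi j * complex_of_real (Re (trace (A ** R \<theta>)))) = trace (A ** moment j)"
proof -
  have "cis \<theta> powi j * complex_of_real (Re (trace (A ** R \<theta>))) = trace (A ** (cis \<theta> powi j *\<^sub>C R \<theta>))" for \<theta>
    using trace_hermitian_real[OF A pos_semidef_ht[OF psd[of \<theta>]]] by simp
  then show ?thesis
    unfolding matrix_moment_def
    by (simp only: integral_bounded_linear[OF bounded_linear_trace_mult integrable_moment])
qed

context circle_weight
begin

text \<open>Weak convergence is tested on scalar weights, the traces against the inverse of C. They
  are nonnegative for the Bernstein--Szego weights by congruence, and on T the measure is Lebesgue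
  measure, so the bound b integrates to b times the mass of T.\<close>

lemma bs_compact_bound:
  assumes L: "\<And>n. left_orthopoly moment n (L n)"
    and C: "pos_semidef C" "det C \<noteq> 0"
    and T: "compact T" "T \<in> sets circle" "T \<subseteq> regular"
    and b: "\<And>\<theta>. \<theta> \<in> T \<Longrightarrow> Re (trace (matrix_inv C ** R \<theta>)) \<le> b" and e: "0 < e"
  shows "\<forall>\<^sub>F n in sequentially. (LINT \<theta>:T|circle_lebesgue. Re (trace (matrix_inv C ** bs_weight n (L n) (cis \<theta>))))
      \<le> b * measure circle_lebesgue T + e"
proof -
  let ?A = "matrix_inv C"
  define q where "q \<theta> = Re (trace (?A ** R \<theta>))" for \<theta>
  define qn where "qn n z = Re (trace (?A ** bs_weight n (L n) z))" for n z
  have psdA: "pos_semidef ?A" by (rule pos_semidef_matrix_inv[OF C])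
  note hA = pos_semidef_ht[OF psdA]
  have iq: "integrable \<tau> q"
    unfolding q_def[abs_def] using integrable_bounded_linear[OF bounded_linear_trace_mult integrable_weight] by simp
  have "\<forall>\<^sub>F n in sequentially. (LINT \<theta>:T|circle_lebesgue. qn n (cis \<theta>)) \<le> (LINT \<theta>:T|\<tau>. q \<theta>) + e"
  proof (rule portmanteau_compact[OF sets_weight iq _ _ _ T(1) _ e])
    show "continuous_on (sphere 0 1) (qn n)" for n
      unfolding qn_def[abs_def] by (intro continuous_intros continuous_on_bs_weight[OF L])
    show "0 \<le> qn n z" for n z
    proof -
      let ?X = "matrix_inv (mpoly n (L n) z)"
      have "trace (?A ** bs_weight n (L n) z) = trace (ht ?X ** ?A ** ht (ht ?X))"
        using trace_mul_sym[of "?A ** ?X" "ht ?X"] by (simp add: bs_weight_def matrix_mul_assoc)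
      moreover have "pos_semidef (ht ?X ** ?A ** ht (ht ?X))" by (rule pos_semidef_congruence[OF psdA])
      ultimately show ?thesis by (simp add: qn_def trace_def sum_nonneg pos_semidef_diag)
    qed
    fix j
    show "\<forall>\<^sub>F n in sequentially. circle_mean (\<lambda>z. z powi j * complex_of_real (qn n z))
        = (LINT \<theta>|\<tau>. cis \<theta> powi j * complex_of_real (q \<theta>))"
    proof (rule eventually_sequentiallyI[of "nat \<bar>j\<bar>"])
      fix n assume n: "nat \<bar>j\<bar> \<le> n"
      interpret W: matrix_weight circle_lebesgue "\<lambda>\<theta>. bs_weight n (L n) (cis \<theta>)"
        by (rule matrix_weight_bs[OF L])
      have "circle_mean (\<lambda>z. z powi j * complex_of_real (qn n z)) = trace (?A ** W.moment j)"
        unfolding qn_def by (rule W.trace_moment[OF hA])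
      also have "W.moment j = moment j" using n by (intro bs_moments[OF L]) simp
      also have "trace (?A ** moment j) = (LINT \<theta>|\<tau>. cis \<theta> powi j * complex_of_real (q \<theta>))"
        unfolding q_def by (rule trace_moment[OF hA, symmetric])
      finally show "circle_mean (\<lambda>z. z powi j * complex_of_real (qn n z))
        = (LINT \<theta>|\<tau>. cis \<theta> powi j * complex_of_real (q \<theta>))" .
    qed
  qed (use T(3) in auto)
  moreover have "(LINT \<theta>:T|\<tau>. q \<theta>) \<le> b * measure circle_lebesgue T"
  proof -
    have qm: "q \<in> borel_measurable circle"
      using borel_measurable_integrable[OF iq] measurable_cong_sets[OF sets_weight refl] by blast
    have "(LINT \<theta>:T|\<tau>. q \<theta>) = (LINT \<theta>:regular|\<tau>. indicat_real T \<theta> * q \<theta>)"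
      unfolding set_lebesgue_integral_def
      by (rule Bochner_Integration.integral_cong) (use T(3) in \<open>auto simp: indicator_def\<close>)
    also have "\<dots> = (LINT \<theta>|circle_lebesgue. indicat_real T \<theta> * q \<theta>)"
      by (rule integral_regular(1)) (use qm T(2) in measurable)
    also have "\<dots> \<le> (LINT \<theta>|circle_lebesgue. indicat_real T \<theta> * b)"
    proof (rule integral_mono)
      show "integrable circle_lebesgue (\<lambda>\<theta>. indicat_real T \<theta> * q \<theta>)"
        using integrable_mult_indicator[of T circle_lebesgue q] integrable_regular(1)[OF iq] T(2) by simp
      show "integrable circle_lebesgue (\<lambda>\<theta>. indicat_real T \<theta> * b)"
        using integrable_mult_indicator[of T circle_lebesgue "\<lambda>_. b"] T(2) by simp
    qed (use b in \<open>auto simp: indicator_def q_def\<close>)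
    also have "\<dots> = b * measure circle_lebesgue T"
      using T by (simp add: Int_absorb2 subset_iff)
    finally show ?thesis .
  qed
  ultimately show ?thesis unfolding qn_def by (elim eventually_mono) simp
qed

text \<open>On a piece the logarithmic bound is at least 3 p - d minus the Bernstein--Szego trace,
  whose integral is eventually at most p + d times the mass, up to a small error; 2 p - 2 d remains
  per unit of mass. Off the pieces the nonnegative roots are discarded.\<close>

theorem sqrt_mean_lower:
  assumes L: "\<And>n. left_orthopoly moment n (L n)" and e: "0 < e"
  shows "\<forall>\<^sub>F n in sequentially. real CARD('n) - e
    \<le> (LINT \<theta>|circle_lebesgue. (\<Sum>i\<in>UNIV. sqrt (Re (weighted n (L n) \<theta> $ i $ i))))"
proof -
  define p where "p = real CARD('n)"
  have p: "p > 0" by (simp add: p_def)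
  \<comment> \<open>The error p d for the missing mass and at most 2 d for the rest add up to
    e.\<close>
  define d where "d = e / (p + 2)"
  have d: "d > 0" using e p by (simp add: d_def)
  obtain K C F where pieces: "nearly_constant_pieces d K C F"
    using nearly_constant_pieces_exist[OF d] by blast
  have C: "pos_semidef (C k)" "det (C k) \<noteq> 0"
    and F: "compact (F k)" "F k \<in> sets circle" "F k \<subseteq> regular" for k
    using pieces unfolding nearly_constant_pieces_def by blast+
  have CF: "det (R \<theta>) \<noteq> 0" "ln (Re (det (C k))) - d \<le> ln (Re (det (R \<theta>)))"
    "Re (trace (matrix_inv (C k) ** R \<theta>)) \<le> p + d" if "\<theta> \<in> F k" for k \<theta>
    using pieces that unfolding nearly_constant_pieces_def p_def by blast+
  have dis: "disjoint_family_on F {..<K}" and mass: "1 - d \<le> (\<Sum>k<K. measure circle_lebesgue (F k))"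
    using pieces unfolding nearly_constant_pieces_def by blast+
  define \<Lambda> where "\<Lambda> = (\<Sum>k<K. measure circle_lebesgue (F k))"
  have \<Lambda>: "1 - d \<le> \<Lambda>" "\<Lambda> \<le> 1"
  proof -
    have "\<Lambda> = measure circle_lebesgue (\<Union>k\<in>{..<K}. F k)"
      unfolding \<Lambda>_def using F(2) dis by (intro circle_lebesgue.finite_measure_finite_Union[symmetric]) auto
    also have "\<dots> \<le> measure circle_lebesgue (space circle_lebesgue)" by (rule circle_lebesgue.bounded_measure)
    finally show "\<Lambda> \<le> 1" by simp
  qed (use mass \<Lambda>_def in simp)
  define qn where "qn k n \<theta> = Re (trace (matrix_inv (C k) ** bs_weight n (L n) (cis \<theta>)))" for k n \<theta>
  \<comment> \<open>The error of weak convergence is shared among the K pieces.\<close>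
  define \<eta> where "\<eta> = d / (real K + 1)"
  have \<eta>: "\<eta> > 0" "real K * \<eta> \<le> d" using d by (auto simp: \<eta>_def field_simps)
  have "\<forall>\<^sub>F n in sequentially. \<forall>k\<in>{..<K}. (LINT \<theta>:F k|circle_lebesgue. qn k n \<theta>) \<le> (p + d) * measure circle_lebesgue (F k) + \<eta>"
    unfolding qn_def
    by (intro eventually_ball_finite ballI bs_compact_bound[OF L C F CF(3) \<eta>(1)]) auto
  then show ?thesis
  proof eventually_elim
    case (elim n)
    let ?S = "\<lambda>\<theta>. \<Sum>i\<in>UNIV. sqrt (Re (weighted n (L n) \<theta> $ i $ i))"
    have S0: "0 \<le> ?S \<theta>" for \<theta> by (intro sum_nonneg) (simp add: pos_semidef_diag[OF weighted_psd])
    have iS: "integrable circle_lebesgue ?S" by (intro Bochner_Integration.integrable_sum weighted_sqrt_integrable)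
    have cq: "continuous_on (sphere 0 1) (\<lambda>z. Re (trace (matrix_inv (C k) ** bs_weight n (L n) z)))" for k
      by (intro continuous_intros continuous_on_bs_weight[OF L])
    have iq: "integrable circle_lebesgue (qn k n)" for k
      unfolding qn_def[abs_def] by (rule integrable_circle_continuous[OF cq])
    have ih: "integrable circle_lebesgue (\<lambda>\<theta>. indicat_real (F k) \<theta> *\<^sub>R (3 * p - d - qn k n \<theta>))" if "k < K" for k
      using F(2)[of k] by (intro integrable_mult_indicator Bochner_Integration.integrable_diff iq) auto
    have int: "(LINT \<theta>|circle_lebesgue. indicat_real (F k) \<theta> *\<^sub>R (3 * p - d - qn k n \<theta>))
        = (3 * p - d) * measure circle_lebesgue (F k) - (LINT \<theta>:F k|circle_lebesgue. qn k n \<theta>)" if "k < K" for k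
    proof -
      have Fs: "F k \<in> sets circle_lebesgue" "F k \<subseteq> {0..<2*pi}" using F(2,3)[of k] by auto
      have "(LINT \<theta>|circle_lebesgue. indicat_real (F k) \<theta> *\<^sub>R (3 * p - d - qn k n \<theta>))
         = (LINT \<theta>|circle_lebesgue. indicat_real (F k) \<theta> * (3 * p - d) - indicat_real (F k) \<theta> *\<^sub>R qn k n \<theta>)"
        by (simp add: right_diff_distrib)
      also have "\<dots> = (LINT \<theta>|circle_lebesgue. indicat_real (F k) \<theta> * (3 * p - d)) - (LINT \<theta>:F k|circle_lebesgue. qn k n \<theta>)"
        unfolding set_lebesgue_integral_def
        using integrable_mult_indicator[OF Fs(1), of "\<lambda>_. 3 * p - d"] integrable_mult_indicator[OF Fs(1) iq]
        by (intro Bochner_Integration.integral_diff) auto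
      finally show ?thesis using Fs by (simp add: Int_absorb2)
    qed
    \<comment> \<open>Each unit of mass gives (3 p - d) - (p + d), and K \<eta> is at most
      d.\<close>
    have "(2 * p - 2 * d) * \<Lambda> - d \<le> (\<Sum>k<K. (3 * p - d) * measure circle_lebesgue (F k) - ((p + d) * measure circle_lebesgue (F k) + \<eta>))"
      using \<eta> by (simp add: \<Lambda>_def sum.distrib sum_subtractf sum_distrib_left algebra_simps)
    also have "\<dots> \<le> (\<Sum>k<K. LINT \<theta>|circle_lebesgue. indicat_real (F k) \<theta> *\<^sub>R (3 * p - d - qn k n \<theta>))"
    proof (rule sum_mono)
      fix k assume k: "k \<in> {..<K}"
      then have "k < K" by simp
      have "(LINT \<theta>:F k|circle_lebesgue. qn k n \<theta>) \<le> (p + d) * measure circle_lebesgue (F k) + \<eta>"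
        using elim k by blast
      then show "(3 * p - d) * measure circle_lebesgue (F k) - ((p + d) * measure circle_lebesgue (F k) + \<eta>)
          \<le> (LINT \<theta>|circle_lebesgue. indicat_real (F k) \<theta> *\<^sub>R (3 * p - d - qn k n \<theta>))"
        unfolding int[OF \<open>k < K\<close>] by linarith
    qed
    also have "\<dots> = (LINT \<theta>|circle_lebesgue. (\<Sum>k<K. indicat_real (F k) \<theta> *\<^sub>R (3 * p - d - qn k n \<theta>)))"
      using ih by (intro Bochner_Integration.integral_sum[symmetric]) auto
    also have "\<dots> \<le> (LINT \<theta>|circle_lebesgue. 2 * ?S \<theta>)"
    proof (rule integral_mono)
      show "integrable circle_lebesgue (\<lambda>\<theta>. \<Sum>k<K. indicat_real (F k) \<theta> *\<^sub>R (3 * p - d - qn k n \<theta>))"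
        using ih by (intro Bochner_Integration.integrable_sum) auto
      show "integrable circle_lebesgue (\<lambda>\<theta>. 2 * ?S \<theta>)" using iS by simp
      fix \<theta>
      show "(\<Sum>k<K. indicat_real (F k) \<theta> *\<^sub>R (3 * p - d - qn k n \<theta>)) \<le> 2 * ?S \<theta>"
      proof (cases "\<exists>k<K. \<theta> \<in> F k")
        case False
        then have "(\<Sum>k<K. indicat_real (F k) \<theta> *\<^sub>R (3 * p - d - qn k n \<theta>)) = 0" by (intro sum.neutral) auto
        then show ?thesis using S0 by simp
      next
        case True
        then obtain k where k: "k < K" "\<theta> \<in> F k" by blast
        have "\<theta> \<notin> F j" if "j < K" "j \<noteq> k" for j
          using dis k that unfolding disjoint_family_on_def by blast
        then have "(\<Sum>j<K. indicat_real (F j) \<theta> *\<^sub>R (3 * p - d - qn j n \<theta>))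
            = (\<Sum>j<K. if j = k then 3 * p - d - qn k n \<theta> else 0)"
          using k by (intro sum.cong refl) auto
        also have "\<dots> = 3 * p - d - qn k n \<theta>" using k by simp
        also have "\<dots> \<le> 2 * ?S \<theta>"
        proof -
          have i: "invertible (mpoly n (L n) (cis \<theta>))" by (rule orthopoly_invertible[OF L]) simp
          have "3 * p + ln (Re (det (R \<theta>))) - ln (Re (det (C k))) - qn k n \<theta> \<le> 2 * ?S \<theta>"
            unfolding p_def qn_def bs_weight_def weighted_def
            by (rule hadamard_log_bound[OF i C psd CF(1)[OF k(2)]])
          moreover have "ln (Re (det (C k))) - d \<le> ln (Re (det (R \<theta>)))" by (rule CF(2)[OF k(2)])
          ultimately show ?thesis by linarith
        qed
        finally show ?thesis .
      qed
    qed
    also have "\<dots> = 2 * (LINT \<theta>|circle_lebesgue. ?S \<theta>)" by simp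
    finally have 1: "(2 * p - 2 * d) * \<Lambda> - d \<le> 2 * (LINT \<theta>|circle_lebesgue. ?S \<theta>)" .
    have "2 * p * (1 - d) \<le> 2 * p * \<Lambda>" using \<Lambda> p by (intro mult_left_mono) auto
    moreover have "2 * d * \<Lambda> \<le> 2 * d * 1" using \<Lambda> d by (intro mult_left_mono) auto
    ultimately have "2 * p - 2 * (p * d) - 3 * d \<le> 2 * (LINT \<theta>|circle_lebesgue. ?S \<theta>)"
      using 1 by (simp add: algebra_simps)
    moreover have "p * d + 2 * d = e"
      unfolding distrib_right[symmetric] d_def using p by simp
    ultimately show ?case using d unfolding p_def[symmetric] by linarith
  qed
qed

text \<open>With s_j the root of M_jj, the mean of (s_j - 1)^2 is at most 2 - 2 mean s_j. These
  means are nonnegative, so the lower bound on the sum of the mean s_j controls each single one, by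
  2 e. The identity |s^2 - 1| = |s - 1| (s + 1) then returns from mean square to mean.\<close>

theorem diag_mean_convergence:
  assumes L: "\<And>n. left_orthopoly moment n (L n)"
  shows "(\<lambda>n. LINT \<theta>|circle_lebesgue. \<bar>Re (weighted n (L n) \<theta> $ i $ i) - 1\<bar>) \<longlonglongrightarrow> 0"
proof (rule LIMSEQ_I)
  fix r :: real assume r: "0 < r"
  \<comment> \<open>\<eta> balances the linear term against the quadratic one in Young's inequality;
    e is such that the quadratic part costs r / 4, giving 3 r / 4 in total.\<close>
  define \<eta> where "\<eta> = r / 2"
  define e where "e = r / (8 * (1 + 1 / \<eta>))"
  have \<eta>: "\<eta> > 0" using r by (simp add: \<eta>_def)
  have "c * (2 * (r / (8 * c))) = r / 4" if "c > 0" for c :: real using that by (simp add: field_simps)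
  moreover have c: "1 + 1 / \<eta> > 0" using \<eta> by (simp add: add_pos_pos)
  ultimately have e2: "(1 + 1 / \<eta>) * (2 * e) = r / 4" unfolding e_def by blast
  have e: "e > 0"
    unfolding e_def using r c by (intro divide_pos_pos mult_pos_pos) simp_all
  let ?w = "\<lambda>n \<theta> j. Re (weighted n (L n) \<theta> $ j $ j)"
  let ?s = "\<lambda>n \<theta> j. sqrt (?w n \<theta> j)"
  have w0: "0 \<le> ?w n \<theta> j" for n \<theta> j by (rule pos_semidef_diag[OF weighted_psd])
  have iw: "integrable circle_lebesgue (\<lambda>\<theta>. ?w n \<theta> j)" for n j using weighted_entry_integrable[of n "L n" j j] by simp
  note isr = weighted_sqrt_integrable
  have sq: "(?s n \<theta> j - 1)\<^sup>2 = ?w n \<theta> j + 1 - 2 * ?s n \<theta> j" for n \<theta> j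
    using w0[of n \<theta> j] by (simp add: power2_diff)
  have isq: "integrable circle_lebesgue (\<lambda>\<theta>. (?s n \<theta> j - 1)\<^sup>2)" for n j
    unfolding sq using iw[of n j] isr[of n "L n" j] by auto
  have "\<forall>\<^sub>F n in sequentially. (LINT \<theta>|circle_lebesgue. \<bar>?w n \<theta> i - 1\<bar>) < r"
    using sqrt_mean_lower[OF L e]
  proof eventually_elim
    case (elim n)
    have "(LINT \<theta>|circle_lebesgue. (?s n \<theta> i - 1)\<^sup>2) \<le> (\<Sum>j\<in>UNIV. LINT \<theta>|circle_lebesgue. (?s n \<theta> j - 1)\<^sup>2)"
      by (rule member_le_sum) (auto intro: integral_nonneg_AE)
    also have "\<dots> = (\<Sum>j\<in>UNIV. (LINT \<theta>|circle_lebesgue. ?w n \<theta> j) + 1 - 2 * (LINT \<theta>|circle_lebesgue. ?s n \<theta> j))"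
      unfolding sq using iw isr by (intro sum.cong refl) simp
    also have "\<dots> \<le> (\<Sum>j\<in>(UNIV :: 'n set). 2) - 2 * (\<Sum>j\<in>UNIV. LINT \<theta>|circle_lebesgue. ?s n \<theta> j)"
      unfolding sum_distrib_left sum_subtractf[symmetric]
      using weighted_diag_mass(2)[OF L] by (intro sum_mono) simp
    also have "(\<Sum>j\<in>UNIV. LINT \<theta>|circle_lebesgue. ?s n \<theta> j) = (LINT \<theta>|circle_lebesgue. (\<Sum>j\<in>UNIV. ?s n \<theta> j))"
      by (intro Bochner_Integration.integral_sum[symmetric] isr)
    finally have small: "(LINT \<theta>|circle_lebesgue. (?s n \<theta> i - 1)\<^sup>2) \<le> 2 * e" using elim by simp
    have "(LINT \<theta>|circle_lebesgue. \<bar>?w n \<theta> i - 1\<bar>) \<le> (LINT \<theta>|circle_lebesgue. (1 + 1 / \<eta>) * (?s n \<theta> i - 1)\<^sup>2 + \<eta>)"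
    proof (rule integral_mono)
      show "integrable circle_lebesgue (\<lambda>\<theta>. \<bar>?w n \<theta> i - 1\<bar>)" using iw by simp
      show "integrable circle_lebesgue (\<lambda>\<theta>. (1 + 1 / \<eta>) * (?s n \<theta> i - 1)\<^sup>2 + \<eta>)" using isq by simp
      fix \<theta>
      define x where "x = \<bar>?s n \<theta> i - 1\<bar>"
      have "?w n \<theta> i - 1 = (?s n \<theta> i - 1) * (?s n \<theta> i + 1)" using w0[of n \<theta> i] by (simp add: algebra_simps)
      then have "\<bar>?w n \<theta> i - 1\<bar> = x * (?s n \<theta> i + 1)" using w0[of n \<theta> i] by (simp add: abs_mult x_def)
      also have "\<dots> \<le> x * (x + 2)" by (intro mult_left_mono) (auto simp: x_def)
      also have "\<dots> = x\<^sup>2 + 2 * x" by (simp add: power2_eq_square algebra_simps)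
      also have "2 * x \<le> x\<^sup>2 / \<eta> + \<eta>"
      proof -
        have "0 \<le> (x - \<eta>)\<^sup>2 / \<eta>" using \<eta> by simp
        also have "\<dots> = x\<^sup>2 / \<eta> + \<eta> - 2 * x" using \<eta> by (simp add: power2_eq_square field_simps)
        finally show ?thesis by simp
      qed
      finally have "\<bar>?w n \<theta> i - 1\<bar> \<le> x\<^sup>2 + (x\<^sup>2 / \<eta> + \<eta>)" by simp
      also have "\<dots> = (1 + 1 / \<eta>) * (?s n \<theta> i - 1)\<^sup>2 + \<eta>" by (simp add: x_def distrib_right)
      finally show "\<bar>?w n \<theta> i - 1\<bar> \<le> (1 + 1 / \<eta>) * (?s n \<theta> i - 1)\<^sup>2 + \<eta>" .
    qed
    also have "\<dots> = (1 + 1 / \<eta>) * (LINT \<theta>|circle_lebesgue. (?s n \<theta> i - 1)\<^sup>2) + \<eta>" using isq by simp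
    also have "\<dots> \<le> (1 + 1 / \<eta>) * (2 * e) + \<eta>"
      using \<eta> small by (intro add_right_mono mult_left_mono) (auto intro: add_nonneg_nonneg)
    also have "\<dots> < r" unfolding e2 using r by (simp add: \<eta>_def)
    finally show ?case .
  qed
  then obtain n0 where "\<forall>n\<ge>n0. (LINT \<theta>|circle_lebesgue. \<bar>?w n \<theta> i - 1\<bar>) < r"
    unfolding eventually_sequentially by blast
  moreover have "0 \<le> (LINT \<theta>|circle_lebesgue. \<bar>?w n \<theta> i - 1\<bar>)" for n by (rule integral_nonneg_AE) simp
  ultimately show "\<exists>n0. \<forall>n\<ge>n0. norm ((LINT \<theta>|circle_lebesgue. \<bar>?w n \<theta> i - 1\<bar>) - 0) < r" by auto
qed

end

text \<open>Polarisation: an off-diagonal entry appears in a diagonal entry of a unitarily congruent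
  matrix, where the diagonal theorem reaches it. U rotates the plane of coordinates i and k by 45
  degrees with a phase c and fixes the others.\<close>

lemma plane_rotation:
  fixes i k :: "'n :: finite"
  assumes ik: "i \<noteq> k" and c: "norm c = 1"
  obtains U :: "complex^'n^'n" where "U ** ht U = mat 1"
    "\<And>X. (U ** X ** ht U) $ i $ i = (X $ i $ i + c * X $ k $ i + cnj c * X $ i $ k + X $ k $ k) / 2"
proof -
  define s where "s = complex_of_real (1 / sqrt 2)"
  have s: "s * s = 1 / 2" "cnj s = s"
    unfolding s_def of_real_mult[symmetric] by (simp_all add: real_sqrt_mult[symmetric])
  have cc: "c * cnj c = 1" using unit_circle(3)[OF c] .
  define \<alpha> where "\<alpha> a = (if a = i then s else if a = k then - cnj c * s else 0)" for a
  define \<beta> where "\<beta> a = (if a = i then c * s else if a = k then s else 0)" for a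
  define \<gamma> :: "'n \<Rightarrow> complex" where "\<gamma> a = (if a = i \<or> a = k then 0 else 1)" for a
  define U :: "complex^'n^'n" where
    "U = (\<chi> a b. (if b = i then \<alpha> a else 0) + (if b = k then \<beta> a else 0) + (if b = a then \<gamma> a else 0))"
  have UX: "(U ** X) $ a $ j = \<alpha> a * X $ i $ j + \<beta> a * X $ k $ j + \<gamma> a * X $ a $ j" for X :: "complex^'n^'n" and a j
    by (simp add: matrix_mult_nth U_def distrib_right sum.distrib if_distrib[where f="\<lambda>x. x * _"] cong: if_cong)
  have XU: "(X ** ht U) $ j $ a = X $ j $ i * cnj (\<alpha> a) + X $ j $ k * cnj (\<beta> a) + X $ j $ a * cnj (\<gamma> a)" for X :: "complex^'n^'n" and a j
    by (simp add: matrix_mult_nth U_def distrib_left sum.distrib if_distrib[where f="\<lambda>x. _ * x"] if_distrib[where f=cnj] cong: if_cong)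
  have "U ** ht U = mat 1"
  proof (rule matrix_eqI)
    fix a b
    have 1: "c * (s * (s * cnj c)) = 1 / 2" "s * (cnj c * (s * c)) = 1 / 2" "s * (s * (c * cnj c)) = 1 / 2" "c * (s * (cnj c * s)) = 1 / 2"
      using s cc by (metis mult.assoc mult.commute mult_1_right)+
    show "(U ** ht U) $ a $ b = mat 1 $ a $ b"
      unfolding UX using ik by (auto simp: U_def mat_nth \<alpha>_def \<beta>_def \<gamma>_def s 1 mult_ac)
  qed
  moreover have "(U ** X ** ht U) $ i $ i = (X $ i $ i + c * X $ k $ i + cnj c * X $ i $ k + X $ k $ k) / 2" for X
  proof -
    have "(U ** X ** ht U) $ i $ i = (s * s) * (X $ i $ i + c * X $ k $ i + cnj c * X $ i $ k + (c * cnj c) * X $ k $ k)"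
      unfolding XU UX using ik by (simp add: \<alpha>_def \<beta>_def \<gamma>_def s(2) algebra_simps)
    then show ?thesis by (simp add: s cc)
  qed
  ultimately show thesis by (rule that)
qed

text \<open>The freedom of normalisation: the inverse adjoint of U L is U times that of L, so the
  inhomogeneous equation is preserved too.\<close>

lemma left_orthopoly_unitary:
  fixes U :: "complex^'n^'n"
  assumes U: "U ** ht U = mat 1" and L: "left_orthopoly c n L"
  shows "left_orthopoly c n (\<lambda>k. U ** L k)"
proof -
  have iL: "invertible (L n)" using L by (simp add: left_orthopoly_def)
  have iU: "invertible U" "matrix_inv U = ht U" using matrix_inv_unique[OF U] by auto
  have "matrix_inv (ht (U ** L n)) = U ** matrix_inv (ht (L n))"
    using matrix_inv_mult(2)[OF invertible_ht(1)[OF iL] invertible_ht(1)[OF iU(1)]] by (simp add: invertible_ht(2)[OF iU(1)] iU(2))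
  moreover have "(\<Sum>k\<le>n. U ** L k ** c (int k - int j)) = U ** (\<Sum>k\<le>n. L k ** c (int k - int j))" for j
    by (simp add: matrix_mult_sum matrix_mul_assoc)
  ultimately show ?thesis
    using L matrix_inv_mult(1)[OF iU(1) iL] by (simp add: left_orthopoly_def)
qed

context circle_weight
begin

theorem entry_mean_convergence:
  assumes L: "\<And>n. left_orthopoly moment n (L n)"
  shows "(\<lambda>n. LINT \<theta>|circle_lebesgue. norm ((weighted n (L n) \<theta> - mat 1) $ i $ k)) \<longlonglongrightarrow> 0"
proof (cases "i = k")
  case True
  have "norm ((weighted n (L n) \<theta> - mat 1) $ i $ k) = \<bar>Re (weighted n (L n) \<theta> $ i $ i) - 1\<bar>" for n \<theta>
  proof -
    have "(weighted n (L n) \<theta> - mat 1) $ i $ k = complex_of_real (Re (weighted n (L n) \<theta> $ i $ i) - 1)"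
      using True pos_semidef_diag_eq[OF weighted_psd[of n "L n" \<theta>], of i] by (simp add: mat_nth)
    then show ?thesis by (simp only: norm_of_real)
  qed
  then show ?thesis using diag_mean_convergence[OF L, of i] by simp
next
  case False
  have part: "(\<lambda>n. LINT \<theta>|circle_lebesgue. \<bar>Re (cnj c * weighted n (L n) \<theta> $ i $ k)\<bar>) \<longlonglongrightarrow> 0" if c: "norm c = 1" for c
  proof -
    obtain U :: "complex^'n^'n" where U: "U ** ht U = mat 1"
      "\<And>X. (U ** X ** ht U) $ i $ i = (X $ i $ i + c * X $ k $ i + cnj c * X $ i $ k + X $ k $ k) / 2"
      using plane_rotation[OF False c] by metis
    define L' where "L' n j = U ** L n j" for n j
    have L': "left_orthopoly moment n (L' n)" for n
      unfolding L'_def by (rule left_orthopoly_unitary[OF U(1) L])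
    have w': "weighted n (L' n) \<theta> = U ** weighted n (L n) \<theta> ** ht U" for n \<theta>
      unfolding weighted_def L'_def mpoly_cmult[symmetric] by (simp add: matrix_mul_assoc)
    let ?d = "\<lambda>n j. LINT \<theta>|circle_lebesgue. \<bar>Re (weighted n (L n) \<theta> $ j $ j) - 1\<bar>"
    let ?d' = "\<lambda>n. LINT \<theta>|circle_lebesgue. \<bar>Re (weighted n (L' n) \<theta> $ i $ i) - 1\<bar>"
    \<comment> \<open>With M' the rotated matrix, Re (cnj c M_ik) = (M'_ii - 1) - ((M_ii - 1) +
      (M_kk - 1)) / 2.\<close>
    have bd: "\<bar>Re (cnj c * weighted n (L n) \<theta> $ i $ k)\<bar> \<le> \<bar>Re (weighted n (L' n) \<theta> $ i $ i) - 1\<bar>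
        + \<bar>Re (weighted n (L n) \<theta> $ i $ i) - 1\<bar> + \<bar>Re (weighted n (L n) \<theta> $ k $ k) - 1\<bar>" for n \<theta>
    proof -
      have "weighted n (L n) \<theta> $ k $ i = cnj (weighted n (L n) \<theta> $ i $ k)"
        using pos_semidef_ht[OF weighted_psd[of n "L n" \<theta>]] by (metis ht_nth)
      then have "Re (c * weighted n (L n) \<theta> $ k $ i) = Re (cnj c * weighted n (L n) \<theta> $ i $ k)" by simp
      moreover have "Re (weighted n (L' n) \<theta> $ i $ i) = (Re (weighted n (L n) \<theta> $ i $ i) + Re (c * weighted n (L n) \<theta> $ k $ i)
          + Re (cnj c * weighted n (L n) \<theta> $ i $ k) + Re (weighted n (L n) \<theta> $ k $ k)) / 2"
        unfolding w' U(2) by simp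
      ultimately show ?thesis by (simp add: abs_if split: if_splits)
    qed
    have int: "integrable circle_lebesgue (\<lambda>\<theta>. \<bar>Re (weighted n M \<theta> $ j $ j) - 1\<bar>)" for n M j
      using weighted_entry_integrable[of n M j j] by simp
    show ?thesis
    proof (rule Lim_null_comparison)
      show "\<forall>\<^sub>F n in sequentially. norm (LINT \<theta>|circle_lebesgue. \<bar>Re (cnj c * weighted n (L n) \<theta> $ i $ k)\<bar>) \<le> ?d' n + ?d n i + ?d n k"
      proof (rule always_eventually, rule allI)
        fix n
        have "norm (LINT \<theta>|circle_lebesgue. \<bar>Re (cnj c * weighted n (L n) \<theta> $ i $ k)\<bar>) = (LINT \<theta>|circle_lebesgue. \<bar>Re (cnj c * weighted n (L n) \<theta> $ i $ k)\<bar>)"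
          by (simp add: integral_nonneg_AE)
        also have "\<dots> \<le> (LINT \<theta>|circle_lebesgue. \<bar>Re (weighted n (L' n) \<theta> $ i $ i) - 1\<bar>
          + \<bar>Re (weighted n (L n) \<theta> $ i $ i) - 1\<bar> + \<bar>Re (weighted n (L n) \<theta> $ k $ k) - 1\<bar>)"
        proof (rule integral_mono[OF _ _ bd])
          have "integrable circle_lebesgue (\<lambda>\<theta>. Re (cnj c * weighted n (L n) \<theta> $ i $ k))"
            using weighted_entry_integrable[of n "L n" i k] by (intro integrable_Re integrable_mult_right)
          then show "integrable circle_lebesgue (\<lambda>\<theta>. \<bar>Re (cnj c * weighted n (L n) \<theta> $ i $ k)\<bar>)" by (rule integrable_abs)
        qed (intro Bochner_Integration.integrable_add int)
        also have "\<dots> = ?d' n + ?d n i + ?d n k"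
          by (simp add: int Bochner_Integration.integrable_add del: integrable_abs_iff)
        finally show "norm (LINT \<theta>|circle_lebesgue. \<bar>Re (cnj c * weighted n (L n) \<theta> $ i $ k)\<bar>) \<le> ?d' n + ?d n i + ?d n k" .
      qed
      have "(\<lambda>n. ?d' n + ?d n i + ?d n k) \<longlonglongrightarrow> 0 + 0 + 0"
        by (intro tendsto_add diag_mean_convergence L L')
      then show "(\<lambda>n. ?d' n + ?d n i + ?d n k) \<longlonglongrightarrow> 0" by simp
    qed
  qed
  let ?a = "\<lambda>n. LINT \<theta>|circle_lebesgue. \<bar>Re (weighted n (L n) \<theta> $ i $ k)\<bar>"
  let ?b = "\<lambda>n. LINT \<theta>|circle_lebesgue. \<bar>Im (weighted n (L n) \<theta> $ i $ k)\<bar>"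
  \<comment> \<open>c = 1 gives the real part and c = i the imaginary part, as the real part of -i
    M_ik is Im M_ik.\<close>
  have ab: "?a \<longlonglongrightarrow> 0" "?b \<longlonglongrightarrow> 0" using part[of 1] part[of \<i>] by simp_all
  show ?thesis
  proof (rule Lim_null_comparison)
    show "(\<lambda>n. ?a n + ?b n) \<longlonglongrightarrow> 0" using tendsto_add[OF ab] by simp
    show "\<forall>\<^sub>F n in sequentially. norm (LINT \<theta>|circle_lebesgue. norm ((weighted n (L n) \<theta> - mat 1) $ i $ k)) \<le> ?a n + ?b n"
    proof (rule always_eventually, rule allI)
      fix n
      note e = weighted_entry_integrable[of n "L n" i k]
      have "norm (LINT \<theta>|circle_lebesgue. norm ((weighted n (L n) \<theta> - mat 1) $ i $ k)) = (LINT \<theta>|circle_lebesgue. norm (weighted n (L n) \<theta> $ i $ k))"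
        using False by (simp add: mat_nth integral_nonneg_AE)
      also have "\<dots> \<le> (LINT \<theta>|circle_lebesgue. \<bar>Re (weighted n (L n) \<theta> $ i $ k)\<bar> + \<bar>Im (weighted n (L n) \<theta> $ i $ k)\<bar>)"
        by (rule integral_mono) (use e cmod_le in auto)
      also have "\<dots> = ?a n + ?b n" using e by simp
      finally show "norm (LINT \<theta>|circle_lebesgue. norm ((weighted n (L n) \<theta> - mat 1) $ i $ k)) \<le> ?a n + ?b n" .
    qed
  qed
qed

text \<open>The first sum bounds the Lebesgue part: there the integrand is u M X, and u X has mean
  0, so only M - 1 contributes. The second bounds the part on \<open>N\<close>, where the norm of M
  is at most p times its trace and the mass of M_ii is the deficit of its Lebesgue mean. The factor
  sqrt p is the Frobenius norm of the unitary X.\<close>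

lemma shifted_ip_bound:
  assumes L: "left_orthopoly moment n L" and K: "right_orthopoly moment n K"
  shows "norm (ip (\<lambda>z. z *\<^sub>C mpoly n L z) (reversed n K)) \<le> sqrt (real CARD('n)) *
    ((\<Sum>i\<in>UNIV. \<Sum>k\<in>UNIV. LINT \<theta>|circle_lebesgue. norm ((weighted n L \<theta> - mat 1) $ i $ k))
      + real CARD('n) * (\<Sum>i\<in>UNIV. LINT \<theta>|circle_lebesgue. norm ((weighted n L \<theta> - mat 1) $ i $ i)))"
proof -
  define q where "q = sqrt (real CARD('n))"
  define X where "X z = mpoly n L z ** ht (matrix_inv (mpoly n K z))" for z
  note lr = left_right_unitary[OF L K, folded X_def]
  have cX: "continuous_on (sphere 0 1) X"
    unfolding X_def[abs_def]
    by (intro continuous_intros continuous_on_mpoly continuous_on_matrix_inv right_orthopoly_invertible[OF K]) simp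
  have nX: "norm (X z) = q" if "norm z = 1" for z
  proof -
    have "complex_of_real ((norm (X z))\<^sup>2) = of_nat CARD('n)"
      unfolding norm_matrix_trace lr(1)[OF that] by (rule trace_I)
    then have "(norm (X z))\<^sup>2 = real CARD('n)" by (metis of_real_of_nat_eq of_real_eq_iff)
    then show ?thesis unfolding q_def by (metis norm_ge_zero real_sqrt_unique)
  qed
  have q0: "0 \<le> q" by (simp add: q_def)
  \<comment> \<open>On the circle this is z^{1-n}. It cancels the z^n of the inverse adjoint and
    leaves one factor z, which makes the mean of u X zero.\<close>
  define u where "u z = z * cnj (z ^ n)" for z :: complex
  have nu: "norm (u z) = 1" if "norm z = 1" for z using that by (simp add: u_def norm_mult norm_power)
  define f where "f \<theta> = u (cis \<theta>) *\<^sub>C (weighted n L \<theta> ** X (cis \<theta>))" for \<theta>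
  let ?Z = "\<lambda>z. z *\<^sub>C mpoly n L z"
  have cZ: "continuous_on (sphere 0 1) ?Z" by (intro continuous_intros continuous_on_mpoly)
  have feq: "?Z (cis \<theta>) ** R \<theta> ** ht (reversed n K (cis \<theta>)) = f \<theta>" for \<theta>
  proof -
    have z: "norm (cis \<theta>) = 1" by simp
    have i: "invertible (mpoly n L (cis \<theta>))" by (rule orthopoly_invertible[OF L]) simp
    have "ht (mpoly n L (cis \<theta>)) ** X (cis \<theta>) = ht (mpoly n L (cis \<theta>)) ** ht (matrix_inv (mpoly n L (cis \<theta>))) ** mpoly n K (cis \<theta>)"
      unfolding lr(2)[OF z, symmetric] by (rule matrix_mul_assoc)
    also have "\<dots> = mpoly n K (cis \<theta>)"
      unfolding ht_mult[symmetric] matrix_inv_works(2)[OF i] by simp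
    finally show ?thesis
      unfolding reversed_circle(1)[OF z] f_def weighted_def u_def
      by (simp only: ht_simps cscale_mult cscale_simps matrix_mul_assoc[symmetric] mult.commute)
  qed
  have if': "integrable \<tau> f" using integrable_ip[OF cZ continuous_on_reversed, of n K] by (simp only: feq)
  have ipf: "ip ?Z (reversed n K) = (LINT \<theta>|circle_lebesgue. f \<theta>) + (LINT \<theta>:N|\<tau>. f \<theta>)"
    unfolding ip_def feq by (rule integrable_regular(2)[OF if'])
  have mean0: "circle_mean (\<lambda>z. u z *\<^sub>C X z) = 0"
  proof -
    have d: "disc_algebra (\<lambda>z. z *\<^sub>C (matrix_inv (reversed n L z) ** mpoly n K z))"
      by (intro disc_algebra_intros disc_algebra_matrix_inv disc_algebra_reversed disc_algebra_mpoly
          reversed_invertible[OF orthopoly_lead[OF L] orthopoly_invertible[OF L]])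
    have "u z *\<^sub>C X z = z *\<^sub>C (matrix_inv (reversed n L z) ** mpoly n K z)" if z: "norm z = 1" for z
    proof -
      have i: "invertible (mpoly n L z)" by (rule orthopoly_invertible[OF L]) (simp add: z)
      have "cnj (z ^ n) * z ^ n = 1" using z by (intro unit_circle) (simp add: norm_power)
      then have "u z * z ^ n = z" by (simp add: u_def mult.assoc)
      then show ?thesis
        unfolding lr(2)[OF z, symmetric] ht_inv_circle[OF z i] by simp
    qed
    then have "circle_mean (\<lambda>z. u z *\<^sub>C X z) = circle_mean (\<lambda>z. z *\<^sub>C (matrix_inv (reversed n L z) ** mpoly n K z))" by simp
    also have "\<dots> = 0" using mean_disc_algebra[OF d] by simp
    finally show ?thesis .
  qed
  have cu: "continuous_on (sphere 0 1) (\<lambda>z. u z *\<^sub>C X z)" unfolding u_def by (intro continuous_intros cX)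
  have iu: "integrable circle_lebesgue (\<lambda>\<theta>. u (cis \<theta>) *\<^sub>C X (cis \<theta>))" by (rule integrable_circle_continuous[OF cu])
  have intE: "integrable circle_lebesgue (\<lambda>\<theta>. norm ((weighted n L \<theta> - mat 1) $ i $ k))" for i k
    using weighted_entry_integrable[of n L i k] by simp
  have "(LINT \<theta>|circle_lebesgue. f \<theta>) = (LINT \<theta>|circle_lebesgue. f \<theta> - u (cis \<theta>) *\<^sub>C X (cis \<theta>))"
    using integrable_regular(1)[OF if'] iu mean0 by simp
  also have "norm \<dots> \<le> (LINT \<theta>|circle_lebesgue. norm (f \<theta> - u (cis \<theta>) *\<^sub>C X (cis \<theta>)))"
    by (rule integral_norm_bound)
  also have "\<dots> \<le> (LINT \<theta>|circle_lebesgue. q * (\<Sum>i\<in>UNIV. \<Sum>k\<in>UNIV. norm ((weighted n L \<theta> - mat 1) $ i $ k)))"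
  proof (rule integral_mono)
    show "integrable circle_lebesgue (\<lambda>\<theta>. norm (f \<theta> - u (cis \<theta>) *\<^sub>C X (cis \<theta>)))"
      using integrable_regular(1)[OF if'] iu by simp
    show "integrable circle_lebesgue (\<lambda>\<theta>. q * (\<Sum>i\<in>UNIV. \<Sum>k\<in>UNIV. norm ((weighted n L \<theta> - mat 1) $ i $ k)))"
      by (intro integrable_mult_right Bochner_Integration.integrable_sum intE)
    fix \<theta>
    have "f \<theta> - u (cis \<theta>) *\<^sub>C X (cis \<theta>) = u (cis \<theta>) *\<^sub>C ((weighted n L \<theta> - mat 1) ** X (cis \<theta>))"
      by (simp add: f_def matrix_mult_ring cscale_distribs)
    then have "norm (f \<theta> - u (cis \<theta>) *\<^sub>C X (cis \<theta>)) \<le> norm (weighted n L \<theta> - mat 1) * q"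
      using norm_matrix_mult[of "weighted n L \<theta> - mat 1" "X (cis \<theta>)"] by (simp add: nu nX)
    also have "\<dots> \<le> q * (\<Sum>i\<in>UNIV. \<Sum>k\<in>UNIV. norm ((weighted n L \<theta> - mat 1) $ i $ k))"
      unfolding mult.commute[of _ q] by (intro mult_left_mono norm_le_sum_entries q0)
    finally show "norm (f \<theta> - u (cis \<theta>) *\<^sub>C X (cis \<theta>)) \<le> q * (\<Sum>i\<in>UNIV. \<Sum>k\<in>UNIV. norm ((weighted n L \<theta> - mat 1) $ i $ k))" .
  qed
  also have "\<dots> = q * (\<Sum>i\<in>UNIV. \<Sum>k\<in>UNIV. LINT \<theta>|circle_lebesgue. norm ((weighted n L \<theta> - mat 1) $ i $ k))"
    using intE by (simp add: Bochner_Integration.integrable_sum)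
  finally have part1: "norm (LINT \<theta>|circle_lebesgue. f \<theta>) \<le> \<dots>" .
  have intD: "integrable \<tau> (\<lambda>\<theta>. Re (weighted n L \<theta> $ i $ i))" for i
    using integral_entry(2)[OF weighted_integrable[of n L], of i i] by simp
  have Ns: "N \<in> sets \<tau>" using N_sets sets_weight by simp
  have "norm (LINT \<theta>:N|\<tau>. f \<theta>) \<le> (LINT \<theta>|\<tau>. norm (indicat_real N \<theta> *\<^sub>R f \<theta>))"
    unfolding set_lebesgue_integral_def by (rule integral_norm_bound)
  also have "\<dots> \<le> (LINT \<theta>|\<tau>. q * (real CARD('n) * (\<Sum>i\<in>UNIV. indicat_real N \<theta> *\<^sub>R Re (weighted n L \<theta> $ i $ i))))"
  proof (rule integral_mono)
    show "integrable \<tau> (\<lambda>\<theta>. norm (indicat_real N \<theta> *\<^sub>R f \<theta>))"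
      using integrable_mult_indicator[OF Ns if'] by (rule integrable_norm)
    show "integrable \<tau> (\<lambda>\<theta>. q * (real CARD('n) * (\<Sum>i\<in>UNIV. indicat_real N \<theta> *\<^sub>R Re (weighted n L \<theta> $ i $ i))))"
      by (intro integrable_mult_right Bochner_Integration.integrable_sum integrable_mult_indicator[OF Ns intD])
    fix \<theta>
    let ?M = "weighted n L \<theta>"
    have "norm ?M \<le> (\<Sum>i\<in>UNIV. \<Sum>j\<in>UNIV. norm (?M $ i $ j))" by (rule norm_le_sum_entries)
    also have "\<dots> \<le> (\<Sum>i\<in>UNIV. \<Sum>j\<in>UNIV. (Re (?M $ i $ i) + Re (?M $ j $ j)) / 2)"
      by (intro sum_mono pos_semidef_entry_le weighted_psd)
    also have "\<dots> = real CARD('n) * (\<Sum>i\<in>UNIV. Re (?M $ i $ i))"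
      by (simp add: sum.distrib add_divide_distrib sum_distrib_left flip: sum_divide_distrib)
    finally have nM: "norm ?M \<le> real CARD('n) * (\<Sum>i\<in>UNIV. Re (?M $ i $ i))" .
    have "norm (f \<theta>) \<le> norm ?M * q"
      using norm_matrix_mult[of ?M "X (cis \<theta>)"] by (simp add: f_def nu nX)
    also have "\<dots> \<le> q * (real CARD('n) * (\<Sum>i\<in>UNIV. Re (?M $ i $ i)))"
      unfolding mult.commute[of _ q] by (intro mult_left_mono nM q0)
    finally show "norm (indicat_real N \<theta> *\<^sub>R f \<theta>) \<le> q * (real CARD('n) * (\<Sum>i\<in>UNIV. indicat_real N \<theta> *\<^sub>R Re (?M $ i $ i)))"
      by (auto simp: indicator_def)
  qed
  also have "\<dots> = q * (real CARD('n) * (\<Sum>i\<in>UNIV. LINT \<theta>:N|\<tau>. Re (weighted n L \<theta> $ i $ i)))"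
    unfolding set_lebesgue_integral_def integral_mult_right_zero
    by (subst Bochner_Integration.integral_sum) (use integrable_mult_indicator[OF Ns intD] in auto)
  also have "\<dots> \<le> q * (real CARD('n) * (\<Sum>i\<in>UNIV. LINT \<theta>|circle_lebesgue. norm ((weighted n L \<theta> - mat 1) $ i $ i)))"
  proof (intro mult_left_mono sum_mono q0)
    fix i
    have "(LINT \<theta>:N|\<tau>. Re (weighted n L \<theta> $ i $ i)) = 1 - (LINT \<theta>|circle_lebesgue. Re (weighted n L \<theta> $ i $ i))"
      using weighted_diag_mass(1)[OF L, of i] by linarith
    also have "\<dots> = (LINT \<theta>|circle_lebesgue. 1 - Re (weighted n L \<theta> $ i $ i))"
      using weighted_entry_integrable[of n L i i] by simp
    also have "\<dots> \<le> (LINT \<theta>|circle_lebesgue. norm ((weighted n L \<theta> - mat 1) $ i $ i))"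
    proof (rule integral_mono[OF _ intE])
      show "integrable circle_lebesgue (\<lambda>\<theta>. 1 - Re (weighted n L \<theta> $ i $ i))"
        using weighted_entry_integrable[of n L i i] by simp
      show "1 - Re (weighted n L \<theta> $ i $ i) \<le> norm ((weighted n L \<theta> - mat 1) $ i $ i)" for \<theta>
        using abs_Re_le_cmod[of "(weighted n L \<theta> - mat 1) $ i $ i"] by (simp add: mat_nth)
    qed
    finally show "(LINT \<theta>:N|\<tau>. Re (weighted n L \<theta> $ i $ i)) \<le> (LINT \<theta>|circle_lebesgue. norm ((weighted n L \<theta> - mat 1) $ i $ i))" .
  qed simp
  finally have part2: "norm (LINT \<theta>:N|\<tau>. f \<theta>) \<le> \<dots>" .
  have "norm (ip ?Z (reversed n K)) \<le> norm (LINT \<theta>|circle_lebesgue. f \<theta>) + norm (LINT \<theta>:N|\<tau>. f \<theta>)"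
    unfolding ipf by (rule norm_triangle_ineq)
  then show ?thesis using part1 part2 unfolding q_def[symmetric] by (simp add: distrib_left)
qed

theorem reflection_tendsto_zero:
  assumes L: "\<And>n. left_orthopoly moment n (L n)" and K: "\<And>n. right_orthopoly moment n (K n)"
  shows "(\<lambda>n. matrix_inv (ht (L n n)) ** K n 0) \<longlonglongrightarrow> 0"
proof -
  define G where "G n = ip (\<lambda>z. z *\<^sub>C mpoly n (L n) z) (reversed n (K n))" for n
  have G: "G \<longlonglongrightarrow> 0"
  proof (rule Lim_null_comparison)
    let ?b = "\<lambda>n. sqrt (real CARD('n)) *
      ((\<Sum>i\<in>UNIV. \<Sum>k\<in>UNIV. LINT \<theta>|circle_lebesgue. norm ((weighted n (L n) \<theta> - mat 1) $ i $ k))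
        + real CARD('n) * (\<Sum>i\<in>UNIV. LINT \<theta>|circle_lebesgue. norm ((weighted n (L n) \<theta> - mat 1) $ i $ i)))"
    show "\<forall>\<^sub>F n in sequentially. norm (G n) \<le> ?b n"
      unfolding G_def by (intro always_eventually allI shifted_ip_bound L K)
    have "?b \<longlonglongrightarrow> sqrt (real CARD('n)) * ((\<Sum>i\<in>(UNIV :: 'n set). \<Sum>k\<in>(UNIV :: 'n set). 0) + real CARD('n) * (\<Sum>i\<in>(UNIV :: 'n set). 0))"
      by (intro tendsto_intros entry_mean_convergence L)
    then show "?b \<longlonglongrightarrow> 0" by simp
  qed
  have "(\<lambda>n. matrix_inv (ht (L (Suc n) (Suc n))) ** K (Suc n) 0) \<longlonglongrightarrow> 0"
  proof (rule Lim_null_comparison)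
    have n0: "(\<lambda>n. norm (G n)) \<longlonglongrightarrow> 0" using G by (rule tendsto_norm_zero)
    have "(\<lambda>n. (norm (G n))\<^sup>2) \<longlonglongrightarrow> 0\<^sup>2" by (intro tendsto_intros n0)
    then have "\<forall>\<^sub>F n in sequentially. (norm (G n))\<^sup>2 < 1 / 2" by (rule order_tendstoD(2)) simp
    then show "\<forall>\<^sub>F n in sequentially. norm (matrix_inv (ht (L (Suc n) (Suc n))) ** K (Suc n) 0) \<le> 2 * real CARD('n) * norm (G n)"
    proof eventually_elim
      case (elim n)
      then show ?case using reflection_bound[OF L[of n] L[of "Suc n"] K[of n] K[of "Suc n"]] by (simp add: G_def)
    qed
    have "(\<lambda>n. 2 * real CARD('n) * norm (G n)) \<longlonglongrightarrow> 2 * real CARD('n) * 0" by (intro tendsto_intros n0)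
    then show "(\<lambda>n. 2 * real CARD('n) * norm (G n)) \<longlonglongrightarrow> 0" by simp
  qed
  then show ?thesis by (rule LIMSEQ_imp_Suc)
qed

end

section \<open>Matrix measures as weights\<close>

lemma sum_measure_exists:
  fixes \<mu> :: "'i \<Rightarrow> 'a measure"
  assumes J: "finite J" and s: "\<And>j. j \<in> J \<Longrightarrow> sets (\<mu> j) = sets M"
  shows "\<exists>\<tau>. sets \<tau> = sets M \<and> (\<forall>A\<in>sets M. emeasure \<tau> A = (\<Sum>j\<in>J. emeasure (\<mu> j) A))"
proof -
  define \<tau> where "\<tau> = measure_of (space M) (sets M) (\<lambda>A. \<Sum>j\<in>J. emeasure (\<mu> j) A)"
  have "emeasure \<tau> A = (\<Sum>j\<in>J. emeasure (\<mu> j) A)" if A: "A \<in> sets M" for A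
    unfolding \<tau>_def
  proof (rule emeasure_measure_of_sigma[OF sets.sigma_algebra_axioms _ _ A])
    show "positive (sets M) (\<lambda>A. \<Sum>j\<in>J. emeasure (\<mu> j) A)" by (simp add: positive_def)
    show "countably_additive (sets M) (\<lambda>A. \<Sum>j\<in>J. emeasure (\<mu> j) A)"
    proof (rule countably_additiveI)
      fix A :: "nat \<Rightarrow> 'a set" assume A: "range A \<subseteq> sets M" "disjoint_family A"
      have "(\<Sum>i. \<Sum>j\<in>J. emeasure (\<mu> j) (A i)) = (\<Sum>j\<in>J. \<Sum>i. emeasure (\<mu> j) (A i))"
        by (rule suminf_sum) simp
      also have "\<dots> = (\<Sum>j\<in>J. emeasure (\<mu> j) (\<Union>i. A i))"
        using A s by (intro sum.cong refl suminf_emeasure) auto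
      finally show "(\<Sum>i. \<Sum>j\<in>J. emeasure (\<mu> j) (A i)) = (\<Sum>j\<in>J. emeasure (\<mu> j) (\<Union>i. A i))" .
    qed
  qed
  moreover have "sets \<tau> = sets M" unfolding \<tau>_def by (rule sets.sets_measure_of_eq)
  ultimately show ?thesis by blast
qed

lemma real_density_exists:
  assumes \<tau>: "finite_measure \<tau>" and \<nu>: "finite_measure \<nu>" and s: "sets \<nu> = sets \<tau>"
    and ac: "absolutely_continuous \<tau> \<nu>"
  shows "\<exists>D :: 'a \<Rightarrow> real. integrable \<tau> D \<and> (\<forall>A\<in>sets \<tau>. (LINT x:A|\<tau>. D x) = measure \<nu> A)"
proof -
  interpret \<tau>: finite_measure \<tau> by fact
  interpret \<nu>: finite_measure \<nu> by fact
  obtain D where D: "D \<in> borel_measurable \<tau>" "AE x in \<tau>. RN_deriv \<tau> \<nu> x = ennreal (D x)" "\<And>x. 0 \<le> D x"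
    using \<tau>.real_RN_deriv[OF \<nu> ac s] by metis
  have "density \<tau> (\<lambda>x. ennreal (D x)) = density \<tau> (RN_deriv \<tau> \<nu>)"
    using D by (intro density_cong) (auto elim: eventually_mono)
  then have dens: "density \<tau> (\<lambda>x. ennreal (D x)) = \<nu>" using \<tau>.density_RN_deriv[OF ac s] by simp
  have em: "(\<integral>\<^sup>+x. ennreal (indicat_real A x * D x) \<partial>\<tau>) = ennreal (measure \<nu> A)" if A: "A \<in> sets \<tau>" for A
  proof -
    have "(\<integral>\<^sup>+x. ennreal (indicat_real A x * D x) \<partial>\<tau>) = (\<integral>\<^sup>+x. ennreal (D x) * indicator A x \<partial>\<tau>)"
      by (intro nn_integral_cong) (auto simp: indicator_def)
    also have "\<dots> = emeasure (density \<tau> (\<lambda>x. ennreal (D x))) A"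
      using D(1) A by (intro emeasure_density[symmetric]) auto
    finally show ?thesis by (simp add: dens \<nu>.emeasure_eq_measure)
  qed
  have i: "integrable \<tau> D"
  proof (rule integrableI_nonneg)
    have "(\<integral>\<^sup>+x. ennreal (D x) \<partial>\<tau>) = (\<integral>\<^sup>+x. ennreal (indicat_real (space \<tau>) x * D x) \<partial>\<tau>)"
      by (intro nn_integral_cong) auto
    then show "(\<integral>\<^sup>+x. ennreal (D x) \<partial>\<tau>) < \<infinity>" using em[OF sets.top] by simp
  qed (use D in auto)
  moreover have "(LINT x:A|\<tau>. D x) = measure \<nu> A" if A: "A \<in> sets \<tau>" for A
  proof -
    have "(LINT x|\<tau>. indicat_real A x * D x) = enn2real (\<integral>\<^sup>+x. ennreal (indicat_real A x * D x) \<partial>\<tau>)"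
      using D A by (intro integral_eq_nn_integral) auto
    then show ?thesis using em[OF A] by (simp add: set_lebesgue_integral_def)
  qed
  ultimately show ?thesis by blast
qed

text \<open>Closedness is what \<open>averaging_theorem\<close> asks for in order to pass from
  semidefinite averages to a density that is semidefinite almost everywhere.\<close>

lemma closed_pos_semidef: "closed {A :: complex^'n^'n. pos_semidef A}"
proof -
  have e: "continuous_on UNIV (\<lambda>A :: complex^'n^'n. A $ i $ j)" for i j by (rule continuous_on_entry[OF continuous_on_id])
  have "{A :: complex^'n^'n. pos_semidef A} = {A. ht A = A} \<inter>
     (\<Inter>v. {A. Re (\<Sum>i\<in>UNIV. \<Sum>j\<in>UNIV. cnj (v $ i) * A $ i $ j * v $ j) \<ge> 0} \<inter>
          {A. Im (\<Sum>i\<in>UNIV. \<Sum>j\<in>UNIV. cnj (v $ i) * A $ i $ j * v $ j) = 0})"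
    by (auto simp: pos_semidef_def less_eq_complex_def)
  also have "closed \<dots>"
    by (intro closed_Int closed_INT ballI closed_Collect_eq closed_Collect_le continuous_intros e)
  finally show ?thesis .
qed

text \<open>The positive parts of Re r, Im r, -Re r and -Im r are the densities of an admissible
  decomposition, and by \<open>complex_measure_integral_eq\<close> any decomposition computes the
  integral.\<close>

lemma complex_measure_integral_density:
  fixes r f :: "real \<Rightarrow> complex"
  assumes \<tau>: "sets \<tau> = sets circle" and r: "integrable \<tau> r"
    and \<nu>: "\<And>A. A \<in> sets circle \<Longrightarrow> \<nu> A = (LINT \<theta>:A|\<tau>. r \<theta>)"
    and f: "f \<in> borel_measurable circle" and bd: "\<And>\<theta>. norm (f \<theta>) \<le> B"
  shows "complex_measure_integral \<nu> f = (LINT \<theta>|\<tau>. r \<theta> * f \<theta>)"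
proof -
  define g :: "nat \<Rightarrow> real \<Rightarrow> real" where
    "g k \<theta> = max 0 (if k = 0 then Re (r \<theta>) else if k = 1 then Im (r \<theta>) else if k = 2 then - Re (r \<theta>) else - Im (r \<theta>))" for k \<theta>
  have g0: "0 \<le> g k \<theta>" for k \<theta> by (simp add: g_def)
  have ig: "integrable \<tau> (g k)" for k
  proof -
    have "integrable \<tau> (\<lambda>\<theta>. if k = 0 then Re (r \<theta>) else if k = 1 then Im (r \<theta>) else if k = 2 then - Re (r \<theta>) else - Im (r \<theta>))"
      using r by (cases "k = 0"; cases "k = 1"; cases "k = 2"; simp)
    then show ?thesis unfolding g_def[abs_def] by (intro integrable_max) auto
  qed
  have gm[measurable]: "g k \<in> borel_measurable \<tau>" for k using ig by (rule borel_measurable_integrable)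
  have fm: "f \<in> borel_measurable \<tau>" using f measurable_cong_sets[OF \<tau> refl] by blast
  have gr: "(\<Sum>k<4. \<i> ^ k * complex_of_real (g k \<theta>)) = r \<theta>" for \<theta>
    unfolding sum_i_powers by (simp add: g_def complex_eq_iff max_def)
  define m where "m k = density \<tau> (\<lambda>\<theta>. ennreal (g k \<theta>))" for k
  have sm: "sets (m k) = sets circle" for k by (simp add: m_def \<tau>)
  have em: "emeasure (m k) A = ennreal (LINT \<theta>:A|\<tau>. g k \<theta>)" if A: "A \<in> sets circle" for k A
  proof -
    have "emeasure (m k) A = (\<integral>\<^sup>+\<theta>. ennreal (g k \<theta>) * indicator A \<theta> \<partial>\<tau>)"
      unfolding m_def using A \<tau> by (intro emeasure_density) auto
    also have "\<dots> = (\<integral>\<^sup>+\<theta>. ennreal (indicat_real A \<theta> *\<^sub>R g k \<theta>) \<partial>\<tau>)"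
      by (intro nn_integral_cong) (auto simp: indicator_def)
    also have "\<dots> = ennreal (LINT \<theta>|\<tau>. indicat_real A \<theta> *\<^sub>R g k \<theta>)"
      using A \<tau> by (intro nn_integral_eq_integral integrable_mult_indicator ig) (auto simp: g0)
    finally show ?thesis by (simp add: set_lebesgue_integral_def)
  qed
  have i2: "integrable \<tau> (\<lambda>\<theta>. g k \<theta> *\<^sub>R f \<theta>)" for k
  proof (rule Bochner_Integration.integrable_bound)
    show "integrable \<tau> (\<lambda>\<theta>. B * g k \<theta>)" using ig by simp
    show "(\<lambda>\<theta>. g k \<theta> *\<^sub>R f \<theta>) \<in> borel_measurable \<tau>" using fm by measurable
    show "AE \<theta> in \<tau>. norm (g k \<theta> *\<^sub>R f \<theta>) \<le> norm (B * g k \<theta>)"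
    proof (rule AE_I2)
      fix \<theta>
      have "norm (g k \<theta> *\<^sub>R f \<theta>) \<le> B * g k \<theta>"
        using mult_right_mono[OF bd[of \<theta>] g0[of k \<theta>]] by (simp add: g0 mult.commute)
      then show "norm (g k \<theta> *\<^sub>R f \<theta>) \<le> norm (B * g k \<theta>)" by (simp add: order_trans[OF _ abs_ge_self])
    qed
  qed
  have "measure_decomposition \<nu> m"
    unfolding measure_decomposition_def
  proof (intro conjI allI impI ballI sm)
    fix k :: nat
    have "space (m k) \<in> sets circle" using sets.top[of "m k"] by (simp only: sm)
    then show "finite_measure (m k)" by (intro finite_measureI) (simp add: em)
  next
    fix A assume A: "A \<in> sets circle"
    have i: "integrable \<tau> (\<lambda>\<theta>. indicat_real A \<theta> *\<^sub>R g k \<theta>)" for k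
      using A \<tau> by (intro integrable_mult_indicator ig) auto
    have "\<nu> A = (LINT \<theta>|\<tau>. (\<Sum>k<4. \<i> ^ k * complex_of_real (indicat_real A \<theta> *\<^sub>R g k \<theta>)))"
      unfolding \<nu>[OF A] set_lebesgue_integral_def
      by (intro Bochner_Integration.integral_cong refl) (simp add: gr[symmetric] sum_distrib_left scaleR_conv_of_real mult_ac)
    also have "\<dots> = (\<Sum>k<4. \<i> ^ k * complex_of_real (LINT \<theta>|\<tau>. indicat_real A \<theta> *\<^sub>R g k \<theta>))"
      using i by (subst Bochner_Integration.integral_sum) (auto simp del: of_real_mult real_scaleR_def)
    also have "\<dots> = (\<Sum>k<4. \<i> ^ k * complex_of_real (measure (m k) A))"
    proof -
      have "measure (m k) A = (LINT \<theta>|\<tau>. indicat_real A \<theta> *\<^sub>R g k \<theta>)" for k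
        using em[OF A, of k] g0 by (simp add: measure_def set_lebesgue_integral_def integral_nonneg_AE)
      then show ?thesis by simp
    qed
    finally show "\<nu> A = (\<Sum>k<4. \<i> ^ k * complex_of_real (measure (m k) A))" .
  qed
  then have "complex_measure_integral \<nu> f = (\<Sum>k<4. \<i> ^ k * integral\<^sup>L (m k) f)"
    using f bd by (rule complex_measure_integral_eq)
  also have "\<dots> = (\<Sum>k<4. \<i> ^ k * (LINT \<theta>|\<tau>. g k \<theta> *\<^sub>R f \<theta>))"
    unfolding m_def using fm g0 by (intro sum.cong refl) (subst integral_density, auto)
  also have "\<dots> = (LINT \<theta>|\<tau>. (\<Sum>k<4. \<i> ^ k * (g k \<theta> *\<^sub>R f \<theta>)))"
    by (simp only: Bochner_Integration.integral_sum integrable_mult_right i2 integral_mult_right_zero)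
  also have "\<dots> = (LINT \<theta>|\<tau>. r \<theta> * f \<theta>)"
    by (intro Bochner_Integration.integral_cong refl)
      (simp add: gr[symmetric] sum_distrib_right sum_distrib_left scaleR_conv_of_real mult_ac)
  finally show ?thesis .
qed

text \<open>Entry by entry this is the density formula; continuity on the circle supplies
  boundedness and measurability.\<close>

lemma matrix_measure_integral_eq:
  fixes A B :: "complex \<Rightarrow> complex^'n^'n"
  assumes \<tau>: "sets \<tau> = sets circle" and R: "integrable \<tau> R"
    and \<rho>: "\<And>X. X \<in> sets circle \<Longrightarrow> \<rho> X = (LINT \<theta>:X|\<tau>. R \<theta>)"
    and A: "continuous_on (sphere 0 1) A" and B: "continuous_on (sphere 0 1) B"
  shows "matrix_measure_integral A \<rho> B = (LINT \<theta>|\<tau>. A (cis \<theta>) ** R \<theta> ** B (cis \<theta>))"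
proof (rule matrix_eqI)
  fix i j
  obtain KA KB where K: "\<And>\<theta>. norm (A (cis \<theta>)) \<le> KA" "\<And>\<theta>. norm (B (cis \<theta>)) \<le> KB"
    using sphere_bound[OF A] sphere_bound[OF B] by metis
  have int: "integrable \<tau> (\<lambda>\<theta>. A (cis \<theta>) ** R \<theta> ** B (cis \<theta>))"
    by (rule integrable_matrix_mult[OF R measurable_circle_continuous[OF A \<tau>] measurable_circle_continuous[OF B \<tau>] K])
  have e: "complex_measure_integral (\<lambda>X. \<rho> X $ k $ l) (\<lambda>\<theta>. A (cis \<theta>) $ i $ k * B (cis \<theta>) $ l $ j)
      = (LINT \<theta>|\<tau>. R \<theta> $ k $ l * (A (cis \<theta>) $ i $ k * B (cis \<theta>) $ l $ j))" for k l
  proof (rule complex_measure_integral_density[OF \<tau> integral_entry(2)[OF R], where B = "KA * KB"])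
    fix X assume X: "X \<in> sets circle"
    have "integrable \<tau> (\<lambda>\<theta>. indicat_real X \<theta> *\<^sub>R R \<theta>)" using X \<tau> by (intro integrable_mult_indicator R) auto
    then show "\<rho> X $ k $ l = (LINT \<theta>:X|\<tau>. R \<theta> $ k $ l)"
      unfolding \<rho>[OF X] set_lebesgue_integral_def by (simp add: integral_entry(1))
  next
    show "(\<lambda>\<theta>. A (cis \<theta>) $ i $ k * B (cis \<theta>) $ l $ j) \<in> borel_measurable circle"
      by (rule measurable_circle_continuous[where f = "\<lambda>z. A z $ i $ k * B z $ l $ j"])
        (intro continuous_on_mult continuous_on_entry A B, rule refl)
    show "norm (A (cis \<theta>) $ i $ k * B (cis \<theta>) $ l $ j) \<le> KA * KB" for \<theta>
      unfolding norm_mult using norm_entry_le[of "A (cis \<theta>)" i k] norm_entry_le[of "B (cis \<theta>)" l j] K[of \<theta>]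
      by (intro mult_mono) (auto intro: order_trans[OF norm_ge_zero])
  qed
  have iR: "integrable \<tau> (\<lambda>\<theta>. R \<theta> $ k $ l * (A (cis \<theta>) $ i $ k * B (cis \<theta>) $ l $ j))" for k l
  proof -
    have "integrable \<tau> (\<lambda>\<theta>. (\<lambda>z. A z $ i $ k * B z $ l $ j) (cis \<theta>) * R \<theta> $ k $ l)"
      by (rule integrable_mult_circle[OF \<tau> integral_entry(2)[OF R]]) (intro continuous_on_mult continuous_on_entry A B)
    then show ?thesis by (simp add: mult_ac)
  qed
  have "matrix_measure_integral A \<rho> B $ i $ j
      = (\<Sum>k\<in>UNIV. \<Sum>l\<in>UNIV. (LINT \<theta>|\<tau>. R \<theta> $ k $ l * (A (cis \<theta>) $ i $ k * B (cis \<theta>) $ l $ j)))"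
    by (simp add: matrix_measure_integral_def e)
  also have "\<dots> = (LINT \<theta>|\<tau>. (\<Sum>k\<in>UNIV. \<Sum>l\<in>UNIV. R \<theta> $ k $ l * (A (cis \<theta>) $ i $ k * B (cis \<theta>) $ l $ j)))"
    using iR by (simp add: Bochner_Integration.integral_sum Bochner_Integration.integrable_sum)
  also have "\<dots> = (LINT \<theta>|\<tau>. (A (cis \<theta>) ** R \<theta> ** B (cis \<theta>)) $ i $ j)"
  proof (intro Bochner_Integration.integral_cong refl)
    fix \<theta>
    show "(\<Sum>k\<in>UNIV. \<Sum>l\<in>UNIV. R \<theta> $ k $ l * (A (cis \<theta>) $ i $ k * B (cis \<theta>) $ l $ j)) = (A (cis \<theta>) ** R \<theta> ** B (cis \<theta>)) $ i $ j"
      by (subst sum.swap) (simp add: matrix_mult_nth sum_distrib_right sum_distrib_left mult_ac)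
  qed
  finally show "matrix_measure_integral A \<rho> B $ i $ j = (LINT \<theta>|\<tau>. A (cis \<theta>) ** R \<theta> ** B (cis \<theta>)) $ i $ j"
    by (simp add: integral_entry(1)[OF int])
qed

lemma matrix_poly_mpoly: "matrix_poly P = mpoly (degree P) (coeff P)"
  by (simp add: fun_eq_iff matrix_poly_def mpoly_def mat_mult_eq_cscale)

text \<open>Orthogonality to phi_j, whose leading coefficient is invertible, yields orthogonality to
  z^j once the lower powers are known; induction on j covers all powers below n. The norm condition
  then determines the top equation.\<close>

lemma (in matrix_weight) left_orthopolyI:
  assumes inv: "\<And>n. invertible (L n n)"
    and orth: "\<And>m n. ip (mpoly n (L n)) (mpoly m (L m)) = (if m = n then mat 1 else 0)"
  shows "left_orthopoly moment n (L n)"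
proof -
  have low: "ip (mpoly n (L n)) (\<lambda>z. z ^ j *\<^sub>C B) = 0" if "j < n" for j B
    using that
  proof (induction j arbitrary: B rule: less_induct)
    case (less j)
    have "0 = ip (mpoly n (L n)) (mpoly j (L j))" using less.prems by (simp add: orth)
    also have "\<dots> = (\<Sum>l\<le>j. ip (mpoly n (L n)) (\<lambda>z. z ^ l *\<^sub>C L j l))"
      by (rule ip_mpoly_right[OF continuous_on_mpoly])
    also have "\<dots> = (\<Sum>l\<le>j. if l = j then ip (mpoly n (L n)) (\<lambda>z. z ^ j *\<^sub>C L j j) else 0)"
      using less by (intro sum.cong refl) auto
    also have "\<dots> = (\<Sum>k\<le>n. L n k ** moment (int k - int j)) ** ht (L j j)"
      by (simp add: ip_mpoly_monomial)
    finally have "(\<Sum>k\<le>n. L n k ** moment (int k - int j)) ** ht (L j j) = 0" ..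
    then have "(\<Sum>k\<le>n. L n k ** moment (int k - int j)) ** ht (L j j) ** matrix_inv (ht (L j j)) = 0" by simp
    then have "(\<Sum>k\<le>n. L n k ** moment (int k - int j)) = 0"
      by (simp add: matrix_inv_cancel(3)[OF invertible_ht(1)[OF inv]])
    then show ?case by (simp add: ip_mpoly_monomial)
  qed
  have "mat 1 = (\<Sum>l\<le>n. ip (mpoly n (L n)) (\<lambda>z. z ^ l *\<^sub>C L n l))"
    using orth[of n n] ip_mpoly_right[OF continuous_on_mpoly[of "sphere 0 1" n "L n"], of n "L n"] by simp
  also have "\<dots> = (\<Sum>l\<le>n. if l = n then ip (mpoly n (L n)) (\<lambda>z. z ^ n *\<^sub>C L n n) else 0)"
    using low by (intro sum.cong refl) auto
  also have "\<dots> = (\<Sum>k\<le>n. L n k ** moment (int k - int n)) ** ht (L n n)" by (simp add: ip_mpoly_monomial)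
  finally have "(\<Sum>k\<le>n. L n k ** moment (int k - int n)) ** ht (L n n) = mat 1" ..
  then have top: "(\<Sum>k\<le>n. L n k ** moment (int k - int n)) = matrix_inv (ht (L n n))"
    using matrix_inv_unique(1) matrix_left_right_inverse by metis
  have "(\<Sum>k\<le>n. L n k ** moment (int k - int j)) = 0" if "j < n" for j
    using low[OF that, of "mat 1"] by (simp add: ip_mpoly_monomial)
  then show ?thesis using inv top by (auto simp: left_orthopoly_def le_less)
qed

text \<open>The dominating measure \<tau> is normalised Lebesgue measure plus all scalar pieces of a
  decomposition of \<rho>s, cut down to \<open>N\<close>. The density is W off \<open>N\<close> and
  is built from Radon--Nikodym derivatives on \<open>N\<close>.\<close>

lemma matrix_measure_weight:
  fixes \<rho> \<rho>s :: "real set \<Rightarrow> complex^'n^'n" and W :: "real \<Rightarrow> complex^'n^'n"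
  assumes \<rho>: "matrix_measure \<rho>" and dec: "lebesgue_decomposition \<rho> W \<rho>s"
    and det: "AE \<theta> in lborel. \<theta> \<in> {0..<2*pi} \<longrightarrow> 0 < det (W \<theta>)"
  shows "\<exists>\<tau> R N. circle_weight \<tau> R N \<and> (\<forall>A\<in>sets circle. \<rho> A = (LINT \<theta>:A|\<tau>. R \<theta>))"
proof -
  have iW: "set_integrable lborel {0..<2*pi} W" and \<rho>s: "matrix_measure \<rho>s"
    and \<rho>eq: "\<And>A. A \<in> sets circle \<Longrightarrow> \<rho> A = (1 / (2*pi)) *\<^sub>R (LINT \<theta>:A|lborel. W \<theta>) + \<rho>s A"
    using dec unfolding lebesgue_decomposition_def by blast+
  obtain N where N: "N \<in> sets circle" "N \<in> null_sets lborel" "\<And>A. A \<in> sets circle \<Longrightarrow> A \<inter> N = {} \<Longrightarrow> \<rho>s A = 0"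
    using dec unfolding lebesgue_decomposition_def by blast
  have "\<exists>m. measure_decomposition (\<lambda>A. \<rho>s A $ a $ b) m" for a b by (rule matrix_measure_decomposition[OF \<rho>s])
  then obtain m where m: "\<And>a b. measure_decomposition (\<lambda>A. \<rho>s A $ a $ b) (m a b)" by metis
  have mf: "finite_measure (m a b k)" and ms: "sets (m a b k) = sets circle" if "k < 4" for a b k
    using m[of a b] that unfolding measure_decomposition_def by blast+
  have meq: "\<rho>s A $ a $ b = (\<Sum>k<4. \<i> ^ k * complex_of_real (measure (m a b k) A))" if "A \<in> sets circle" for A a b
    using m[of a b] that unfolding measure_decomposition_def by blast
  \<comment> \<open>A decomposition of \<rho>s may have pieces that cancel off \<open>N\<close>;
    restricting them to \<open>N\<close> keeps \<tau> equal to Lebesgue measure elsewhere.\<close>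
  define \<nu> where "\<nu> a b k = density (m a b k) (indicator N)" for a b k
  have \<nu>s: "sets (\<nu> a b k) = sets circle" and \<nu>A: "A \<in> sets circle \<Longrightarrow> measure (\<nu> a b k) A = measure (m a b k) (N \<inter> A)"
    and \<nu>e: "A \<in> sets circle \<Longrightarrow> emeasure (\<nu> a b k) A = emeasure (m a b k) (N \<inter> A)"
    and \<nu>f: "finite_measure (\<nu> a b k)" if "k < 4" for a b k A
  proof -
    interpret finite_measure "m a b k" by (rule mf[OF that])
    have Nm: "N \<in> sets (m a b k)" using N(1) ms[OF that] by simp
    show "sets (\<nu> a b k) = sets circle" by (simp add: \<nu>_def ms[OF that])
    show e: "emeasure (\<nu> a b k) A = emeasure (m a b k) (N \<inter> A)" if "A \<in> sets circle"
      unfolding \<nu>_def using Nm that ms[OF \<open>k < 4\<close>] by (intro emeasure_restricted) auto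
    then show "measure (\<nu> a b k) A = measure (m a b k) (N \<inter> A)" if "A \<in> sets circle" using that by (simp add: measure_def)
    show "finite_measure (\<nu> a b k)" unfolding \<nu>_def using Nm by (rule finite_measure_restricted)
  qed
  \<comment> \<open>\<open>None\<close> stands for the Lebesgue part, \<open>Some (a, b, k)\<close>
    for the k-th piece of entry (a, b).\<close>
  define J :: "('n \<times> 'n \<times> nat) option set" where "J = insert None (Some ` (UNIV \<times> UNIV \<times> {..<4}))"
  define \<mu> where "\<mu> j = (case j of None \<Rightarrow> circle_lebesgue | Some (a, b, k) \<Rightarrow> \<nu> a b k)" for j
  have J: "finite J" by (simp add: J_def)
  have \<mu>s: "sets (\<mu> j) = sets circle" and \<mu>f: "finite_measure (\<mu> j)" if "j \<in> J" for j
    using that \<nu>s \<nu>f circle_lebesgue.finite_measure_axioms by (auto simp: J_def \<mu>_def)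
  obtain \<tau> where \<tau>: "sets \<tau> = sets circle" "\<And>A. A \<in> sets circle \<Longrightarrow> emeasure \<tau> A = (\<Sum>j\<in>J. emeasure (\<mu> j) A)"
    using sum_measure_exists[of J \<mu> circle, OF J \<mu>s] by blast
  have le: "emeasure (\<mu> j) A \<le> emeasure \<tau> A" if "j \<in> J" "A \<in> sets circle" for j A
    unfolding \<tau>(2)[OF that(2)] by (rule member_le_sum[OF that(1)]) (use J in auto)
  have \<tau>f: "finite_measure \<tau>"
  proof (rule finite_measureI)
    have "space \<tau> \<in> sets circle" using sets.top[of \<tau>] by (simp only: \<tau>(1))
    then have "emeasure \<tau> (space \<tau>) = (\<Sum>j\<in>J. emeasure (\<mu> j) (space \<tau>))" by (rule \<tau>(2))
    also have "\<dots> < \<infinity>"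
      using J finite_measure.emeasure_finite[OF \<mu>f] by (simp add: less_top[symmetric])
    finally show "emeasure \<tau> (space \<tau>) \<noteq> \<infinity>" by simp
  qed
  interpret \<tau>: finite_measure \<tau> by (rule \<tau>f)
  have ac: "absolutely_continuous \<tau> (\<mu> j)" if "j \<in> J" for j
    unfolding absolutely_continuous_def
  proof
    fix A assume "A \<in> null_sets \<tau>"
    then show "A \<in> null_sets (\<mu> j)" using le[OF that, of A] \<tau>(1) \<mu>s[OF that] by (auto simp: null_sets_def)
  qed
  have N0: "emeasure circle_lebesgue N = 0"
    using emeasure_circle_lebesgue[OF N(1)] N(2) by (auto simp: null_sets_def)
  have off: "emeasure \<tau> A = emeasure circle_lebesgue A" if A: "A \<in> sets circle" "A \<inter> N = {}" for A
  proof -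
    have "emeasure \<tau> A = (\<Sum>j\<in>J. if j = None then emeasure circle_lebesgue A else 0)"
      unfolding \<tau>(2)[OF A(1)]
      using A by (intro sum.cong refl) (auto simp: J_def \<mu>_def \<nu>e Int_commute)
    also have "\<dots> = emeasure circle_lebesgue A" using J by (simp add: J_def)
    finally show ?thesis .
  qed
  interpret C: circle_measure \<tau> N by unfold_locales (use \<tau> N N0 off in auto)
  define isD where "isD a b k D \<longleftrightarrow> integrable \<tau> D \<and> (\<forall>A\<in>sets circle. (LINT \<theta>:A|\<tau>. D \<theta>) = measure (\<nu> a b k) A)" for a b k D
  have "\<exists>D. integrable \<tau> D \<and> (\<forall>A\<in>sets circle. (LINT \<theta>:A|\<tau>. D \<theta>) = measure (\<nu> a b k) A)" if k: "k < 4" for a b k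
  proof -
    have j: "Some (a, b, k) \<in> J" and \<mu>j: "\<mu> (Some (a, b, k)) = \<nu> a b k" using k by (auto simp: J_def \<mu>_def)
    show ?thesis
      using real_density_exists[OF \<tau>f \<nu>f[OF k, of a b] _ ac[OF j, unfolded \<mu>j]] by (simp add: \<nu>s[OF k] \<tau>(1))
  qed
  then have ex: "\<exists>D. k < 4 \<longrightarrow> isD a b k D" for a b k unfolding isD_def by blast
  \<comment> \<open>The premise k < 4 sits inside the choice, so that a witness exists for every
    k.\<close>
  define D where "D a b k = (SOME D. k < 4 \<longrightarrow> isD a b k D)" for a b k
  have "k < 4 \<longrightarrow> isD a b k (D a b k)" for a b k unfolding D_def by (rule someI_ex[OF ex])
  then have D: "\<And>a b k. k < 4 \<Longrightarrow> integrable \<tau> (D a b k)"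
    "\<And>a b k A. k < 4 \<Longrightarrow> A \<in> sets circle \<Longrightarrow> (LINT \<theta>:A|\<tau>. D a b k \<theta>) = measure (\<nu> a b k) A"
    by (simp_all add: isD_def)
  define S where "S \<theta> = (\<chi> a b. \<Sum>k<4. \<i> ^ k * complex_of_real (D a b k \<theta>))" for \<theta>
  define R0 where "R0 \<theta> = indicat_real N \<theta> *\<^sub>R S \<theta> + indicat_real C.regular \<theta> *\<^sub>R W \<theta>" for \<theta>
  have iS: "integrable \<tau> S"
    by (rule integrable_entryI) (auto simp: S_def intro!: Bochner_Integration.integrable_sum integrable_mult_right integrable_of_real D)
  have Ns: "N \<in> sets \<tau>" using N(1) \<tau>(1) by simp
  have Wm: "W \<in> borel_measurable circle"
  proof -
    have "(\<lambda>\<theta>. indicat_real {0..<2*pi} \<theta> *\<^sub>R W \<theta>) \<in> borel_measurable borel"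
      using borel_measurable_integrable[OF iW[unfolded set_integrable_def]] by simp
    then have "(\<lambda>\<theta>. indicat_real {0..<2*pi} \<theta> *\<^sub>R W \<theta>) \<in> borel_measurable circle"
      by (rule measurable_restrict_space1)
    then show ?thesis by (rule measurable_cong[THEN iffD1, rotated]) (simp add: space_restrict_space)
  qed
  have iWr: "set_integrable \<tau> C.regular W"
    unfolding C.integral_regular(2)[OF Wm] integral_circle_lebesgue(2)[OF Wm] by (rule iW)
  have iR0: "integrable \<tau> R0"
    unfolding R0_def[abs_def]
    by (intro Bochner_Integration.integrable_add integrable_mult_indicator[OF Ns iS] iWr[unfolded set_integrable_def])
  have \<rho>R0: "\<rho> A = (LINT \<theta>:A|\<tau>. R0 \<theta>)" if A: "A \<in> sets circle" for A
  proof -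
    have A\<tau>: "A \<in> sets \<tau>" and NA: "N \<inter> A \<in> sets circle" using A N(1) \<tau>(1) by auto
    have AmN: "A - N \<in> sets circle" using A N(1) by auto
    have i1: "integrable \<tau> (\<lambda>\<theta>. indicat_real (N \<inter> A) \<theta> *\<^sub>R S \<theta>)"
      using NA \<tau>(1) by (intro integrable_mult_indicator iS) auto
    have i2: "integrable \<tau> (\<lambda>\<theta>. indicat_real A \<theta> *\<^sub>R (indicat_real C.regular \<theta> *\<^sub>R W \<theta>))"
      by (rule integrable_mult_indicator[OF A\<tau> iWr[unfolded set_integrable_def]])
    have AW: "(\<lambda>\<theta>. indicat_real A \<theta> *\<^sub>R W \<theta>) \<in> borel_measurable circle"
      using Wm A by measurable
    have "(LINT \<theta>:A|\<tau>. R0 \<theta>) = (LINT \<theta>|\<tau>. indicat_real (N \<inter> A) \<theta> *\<^sub>R S \<theta> + indicat_real A \<theta> *\<^sub>R (indicat_real C.regular \<theta> *\<^sub>R W \<theta>))"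
      unfolding set_lebesgue_integral_def R0_def
      by (intro Bochner_Integration.integral_cong refl) (auto simp: indicator_def scaleR_add_right)
    also have "\<dots> = (LINT \<theta>|\<tau>. indicat_real (N \<inter> A) \<theta> *\<^sub>R S \<theta>) + (LINT \<theta>|\<tau>. indicat_real A \<theta> *\<^sub>R (indicat_real C.regular \<theta> *\<^sub>R W \<theta>))"
      by (rule Bochner_Integration.integral_add[OF i1 i2])
    also have "(LINT \<theta>|\<tau>. indicat_real A \<theta> *\<^sub>R (indicat_real C.regular \<theta> *\<^sub>R W \<theta>)) = (LINT \<theta>:C.regular|\<tau>. indicat_real A \<theta> *\<^sub>R W \<theta>)"
      unfolding set_lebesgue_integral_def
      by (intro Bochner_Integration.integral_cong refl) (rule scaleR_left_commute)
    also have "\<dots> = (LINT \<theta>|circle_lebesgue. indicat_real A \<theta> *\<^sub>R W \<theta>)" by (rule C.integral_regular(1)[OF AW])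
    also have "\<dots> = (1 / (2*pi)) *\<^sub>R (LINT \<theta>:{0..<2*pi}|lborel. indicat_real A \<theta> *\<^sub>R W \<theta>)"
      by (rule integral_circle_lebesgue(1)[OF AW])
    also have "(LINT \<theta>:{0..<2*pi}|lborel. indicat_real A \<theta> *\<^sub>R W \<theta>) = (LINT \<theta>:A|lborel. W \<theta>)"
    proof -
      have "A \<subseteq> {0..<2*pi}" using sets.sets_into_space[OF A] by (simp add: space_restrict_space)
      then show ?thesis
        unfolding set_lebesgue_integral_def
        by (intro Bochner_Integration.integral_cong refl) (auto simp: indicator_def)
    qed
    also have "(LINT \<theta>|\<tau>. indicat_real (N \<inter> A) \<theta> *\<^sub>R S \<theta>) = \<rho>s A"
    proof (rule matrix_eqI)
      fix a b
      have mNA: "measure (\<nu> a b k) (N \<inter> A) = measure (m a b k) (N \<inter> A)" if "k < 4" for k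
        using \<nu>A[OF that NA, of a b] by (simp add: Int_left_absorb)
      have iD: "integrable \<tau> (\<lambda>\<theta>. indicat_real (N \<inter> A) \<theta> *\<^sub>R D a b k \<theta>)" if "k < 4" for k
        using NA \<tau>(1) by (intro integrable_mult_indicator D(1)[OF that]) auto
      have "(LINT \<theta>|\<tau>. indicat_real (N \<inter> A) \<theta> *\<^sub>R S \<theta>) $ a $ b
          = (LINT \<theta>|\<tau>. (\<Sum>k<4. \<i> ^ k * complex_of_real (indicat_real (N \<inter> A) \<theta> *\<^sub>R D a b k \<theta>)))"
        unfolding integral_entry(1)[OF i1]
        by (intro Bochner_Integration.integral_cong refl) (simp add: S_def sum_distrib_left scaleR_conv_of_real[where 'a = complex] mult_ac)
      also have "\<dots> = (\<Sum>k<4. (LINT \<theta>|\<tau>. \<i> ^ k * complex_of_real (indicat_real (N \<inter> A) \<theta> *\<^sub>R D a b k \<theta>)))"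
        by (intro Bochner_Integration.integral_sum integrable_mult_right integrable_of_real iD) simp
      also have "\<dots> = (\<Sum>k<4. \<i> ^ k * complex_of_real (LINT \<theta>:N \<inter> A|\<tau>. D a b k \<theta>))"
        unfolding set_lebesgue_integral_def by (simp only: integral_mult_right_zero integral_complex_of_real)
      also have "\<dots> = (\<Sum>k<4. \<i> ^ k * complex_of_real (measure (m a b k) (N \<inter> A)))"
        by (intro sum.cong refl) (simp add: D(2)[OF _ NA] mNA)
      also have "\<dots> = \<rho>s (N \<inter> A) $ a $ b" by (rule meq[OF NA, symmetric])
      \<comment> \<open>The discarded pieces cancel, because \<rho>s vanishes off
        \<open>N\<close>.\<close>
      also have "\<dots> = \<rho>s A $ a $ b"
      proof -
        have "\<rho>s A $ a $ b = (\<Sum>k<4. \<i> ^ k * complex_of_real (measure (m a b k) (N \<inter> A) + measure (m a b k) (A - N)))"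
          unfolding meq[OF A]
        proof (intro sum.cong refl)
          fix k :: nat assume "k \<in> {..<4}"
          then have k: "k < 4" by simp
          interpret finite_measure "m a b k" by (rule mf[OF k])
          have "measure (m a b k) ((N \<inter> A) \<union> (A - N)) = measure (m a b k) (N \<inter> A) + measure (m a b k) (A - N)"
            using NA AmN by (intro finite_measure_Union) (auto simp: ms[OF k])
          moreover have "(N \<inter> A) \<union> (A - N) = A" by blast
          ultimately show "\<i> ^ k * complex_of_real (measure (m a b k) A)
            = \<i> ^ k * complex_of_real (measure (m a b k) (N \<inter> A) + measure (m a b k) (A - N))" by simp
        qed
        also have "\<dots> = \<rho>s (N \<inter> A) $ a $ b + \<rho>s (A - N) $ a $ b"
          unfolding meq[OF NA] meq[OF AmN] by (simp add: distrib_left sum.distrib)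
        also have "\<rho>s (A - N) = 0" using AmN by (intro N(3)) auto
        finally show ?thesis by simp
      qed
      finally show "(LINT \<theta>|\<tau>. indicat_real (N \<inter> A) \<theta> *\<^sub>R S \<theta>) $ a $ b = \<rho>s A $ a $ b" .
    qed
    finally show ?thesis using \<rho>eq[OF A] by (simp add: add.commute)
  qed
  have psd_AE: "AE \<theta> in \<tau>. pos_semidef (R0 \<theta>)"
  proof -
    have "AE \<theta> in \<tau>. R0 \<theta> \<in> {A. pos_semidef A}"
    proof (rule \<tau>.averaging_theorem[OF iR0 closed_pos_semidef])
      fix A assume A: "A \<in> sets \<tau>" "0 < measure \<tau> A"
      \<comment> \<open>Division by the measure is written as a congruence with a scalar matrix,
        under which semidefiniteness is known.\<close>
      define c where "c = complex_of_real (sqrt (1 / measure \<tau> A))"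
      have "pos_semidef (\<rho> A)" using \<rho> A(1) \<tau>(1) unfolding matrix_measure_def by blast
      then have "pos_semidef ((c *\<^sub>C mat 1) ** \<rho> A ** ht (c *\<^sub>C mat 1))" by (rule pos_semidef_congruence)
      moreover have "(c *\<^sub>C mat 1) ** \<rho> A ** ht (c *\<^sub>C mat 1) = (cnj c * c) *\<^sub>C \<rho> A" by simp
      moreover have "cnj c * c = complex_of_real (1 / measure \<tau> A)"
        unfolding c_def complex_cnj_complex_of_real of_real_mult[symmetric] using A(2) by simp
      ultimately have "pos_semidef ((1 / measure \<tau> A) *\<^sub>R \<rho> A)" by (simp only: cscale_scaleR)
      then show "(1 / measure \<tau> A) *\<^sub>R (LINT \<theta>:A|\<tau>. R0 \<theta>) \<in> {A. pos_semidef A}"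
        using \<rho>R0 A(1) \<tau>(1) by simp
    qed
    then show ?thesis by simp
  qed
  \<comment> \<open>The null set of bad points is sent to 0, since \<open>matrix_weight\<close> asks
    for semidefiniteness everywhere.\<close>
  define R where "R \<theta> = (if R0 \<theta> \<in> {A. pos_semidef A} then R0 \<theta> else 0)" for \<theta>
  have AE_eq: "AE \<theta> in \<tau>. R0 \<theta> = R \<theta>" using psd_AE by eventually_elim (simp add: R_def)
  have R0m[measurable]: "R0 \<in> borel_measurable \<tau>" by (rule borel_measurable_integrable[OF iR0])
  have [measurable]: "{A :: complex^'n^'n. pos_semidef A} \<in> sets borel" by (rule borel_closed[OF closed_pos_semidef])
  have Rm[measurable]: "R \<in> borel_measurable \<tau>" unfolding R_def[abs_def] by measurable
  have iR: "integrable \<tau> R" by (rule integrable_cong_AE_imp[OF iR0 Rm]) (use AE_eq in \<open>auto elim: eventually_mono\<close>)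
  have \<rho>R: "\<rho> A = (LINT \<theta>:A|\<tau>. R \<theta>)" if A: "A \<in> sets circle" for A
  proof -
    have [measurable]: "A \<in> sets \<tau>" using A \<tau>(1) by simp
    have "(LINT \<theta>:A|\<tau>. R0 \<theta>) = (LINT \<theta>:A|\<tau>. R \<theta>)"
      unfolding set_lebesgue_integral_def
      by (rule integral_cong_AE) (measurable, use AE_eq in \<open>auto elim: eventually_mono\<close>)
    then show ?thesis using \<rho>R0[OF A] by simp
  qed
  have "circle_weight \<tau> R N"
  proof unfold_locales
    have "pos_semidef (0 :: complex^'n^'n)" by (simp add: pos_semidef_def)
    then show "pos_semidef (R \<theta>)" for \<theta> by (simp add: R_def)
    \<comment> \<open>Lebesgue measure is one of the summands of \<tau>, so the change on a
      \<tau>-null set is invisible to it.\<close>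
    have "absolutely_continuous \<tau> circle_lebesgue" using ac[of None] by (simp add: J_def \<mu>_def)
    then have e1: "AE \<theta> in circle_lebesgue. R0 \<theta> = R \<theta>"
      using AE_eq by (rule absolutely_continuous_AE[rotated]) (simp add: \<tau>(1))
    have e2: "AE \<theta> in circle_lebesgue. 0 < det (W \<theta>)"
      unfolding circle_lebesgue_def
    proof (subst AE_density)
      have "AE \<theta> in restrict_space lborel {0..<2*pi}. 0 < det (W \<theta>)"
        using det by (subst AE_restrict_space_iff) auto
      then show "AE \<theta> in restrict_space lborel {0..<2*pi}. 0 < ennreal (1 / (2*pi)) \<longrightarrow> 0 < det (W \<theta>)"
        by eventually_elim simp
    qed simp
    show "AE \<theta> in circle_lebesgue. det (R \<theta>) \<noteq> 0"
      using e1 e2 C.AE_regular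
    proof eventually_elim
      case (elim \<theta>)
      then have "R \<theta> = W \<theta>" by (simp add: R0_def)
      then show ?case using elim(2) by auto
    qed
  qed (rule iR \<tau>(1))+
  then show ?thesis using \<rho>R by blast
qed

theorem mainTheorem1:
  fixes \<rho> \<rho>s :: "real set \<Rightarrow> complex^'p^'p"
    and \<rho>' :: "real \<Rightarrow> complex^'p^'p"
    and \<phi>L \<phi>R :: "nat \<Rightarrow> (complex^'p^'p) poly"
  assumes "matrix_measure \<rho>"
    and "lebesgue_decomposition \<rho> \<rho>' \<rho>s"
    and "left_orthonormal \<rho> \<phi>L"
    and "right_orthonormal \<rho> \<phi>R"
    and "AE \<theta> in lborel. \<theta> \<in> {0..<2*pi} \<longrightarrow> 0 < det (\<rho>' \<theta>)"
  shows "(\<lambda>n. reflection_coeff \<phi>L \<phi>R n) \<longlonglongrightarrow> 0"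
proof -
  obtain \<tau> R N where cw: "circle_weight \<tau> R N" and \<rho>: "\<And>A. A \<in> sets circle \<Longrightarrow> \<rho> A = (LINT \<theta>:A|\<tau>. R \<theta>)"
    using matrix_measure_weight[OF assms(1,2,5)] by blast
  interpret circle_weight \<tau> R N by (rule cw)
  interpret T: matrix_weight \<tau> "\<lambda>\<theta>. transpose (R \<theta>)" by (rule transposed)
  note int_eq = matrix_measure_integral_eq[OF sets_weight integrable_weight \<rho>]
  have dL: "degree (\<phi>L n) = n" "invertible (coeff (\<phi>L n) n)" for n
    using assms(3) unfolding left_orthonormal_def by metis+
  have dR: "degree (\<phi>R n) = n" "invertible (coeff (\<phi>R n) n)" for n
    using assms(4) unfolding right_orthonormal_def by metis+
  have L: "left_orthopoly moment n (coeff (\<phi>L n))" for n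
  proof (rule left_orthopolyI[where L = "\<lambda>n. coeff (\<phi>L n)"])
    fix m n
    have "matrix_measure_integral (matrix_poly (\<phi>L n)) \<rho> (\<lambda>z. ht (matrix_poly (\<phi>L m) z)) = (if m = n then mat 1 else 0)"
      using assms(3) unfolding left_orthonormal_def by blast
    then show "ip (mpoly n (coeff (\<phi>L n))) (mpoly m (coeff (\<phi>L m))) = (if m = n then mat 1 else 0)"
      unfolding matrix_poly_mpoly dL
      by (subst (asm) int_eq) (auto simp: ip_def intro: continuous_on_mpoly continuous_on_ht)
  qed (rule dL)
  have K: "right_orthopoly moment n (coeff (\<phi>R n))" for n
  proof -
    have "left_orthopoly T.moment n (\<lambda>k. transpose (coeff (\<phi>R n) k))"
    proof (rule T.left_orthopolyI[where L = "\<lambda>n k. transpose (coeff (\<phi>R n) k)"])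
      fix m n
      let ?p = "\<lambda>n. mpoly n (coeff (\<phi>R n))"
      \<comment> \<open>Transposition swaps the outer factors, so the right relation is used with m
        and n exchanged.\<close>
      have "matrix_measure_integral (\<lambda>z. ht (matrix_poly (\<phi>R m) z)) \<rho> (matrix_poly (\<phi>R n)) = (if n = m then mat 1 else 0)"
        using assms(4) unfolding right_orthonormal_def by blast
      then have eq: "(LINT \<theta>|\<tau>. ht (?p m (cis \<theta>)) ** R \<theta> ** ?p n (cis \<theta>)) = (if n = m then mat 1 else 0)"
        unfolding matrix_poly_mpoly dR
        by (subst (asm) int_eq) (auto intro: continuous_on_mpoly continuous_on_ht)
      have i: "integrable \<tau> (\<lambda>\<theta>. ht (?p m (cis \<theta>)) ** R \<theta> ** ?p n (cis \<theta>))"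
        by (rule integrable_weighted[of "\<lambda>z. ht (?p m z)"]) (intro continuous_intros continuous_on_mpoly)+
      have "T.ip (mpoly n (\<lambda>k. transpose (coeff (\<phi>R n) k))) (mpoly m (\<lambda>k. transpose (coeff (\<phi>R m) k)))
          = (LINT \<theta>|\<tau>. transpose (ht (?p m (cis \<theta>)) ** R \<theta> ** ?p n (cis \<theta>)))"
        unfolding T.ip_def by (simp add: transpose_mult transpose_ht transpose_mpoly matrix_mul_assoc)
      also have "\<dots> = transpose (if n = m then mat 1 else 0 :: complex^'p^'p)"
        unfolding integral_transpose(2)[OF i] eq ..
      also have "\<dots> = (if m = n then mat 1 else 0)"
        by (auto simp: transpose_mat) (rule matrix_eqI, simp add: transpose_def)
      finally show "T.ip (mpoly n (\<lambda>k. transpose (coeff (\<phi>R n) k))) (mpoly m (\<lambda>k. transpose (coeff (\<phi>R m) k)))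
          = (if m = n then mat 1 else 0)" .
    qed (rule invertible_transpose(1)[OF dR(2)])
    then show ?thesis by (simp add: right_orthopoly_transpose_iff transposed_moment[abs_def])
  qed
  show ?thesis
    unfolding reflection_coeff_def by (rule reflection_tendsto_zero[OF L K])
qed

end
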